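(* Let $m\in C^2([0,1])$ and $c\in C([0,1])$, where $m$ is not constant and $m'$ changes sign at most finitely many times on $[0,1]$. Let $\hbar_i,\ell_i\ge 0$ be constants with $\hbar_i+\ell_i>0$ $(i=1,2)$. For $s\in\mathbb{R}$ let $\lambda_1(s)$ be the principal eigenvalue of $$-\varphi''(x)-2s\,m'(x)\varphi'(x)+c(x)\varphi(x)=\lambda\varphi(x),\ 0<x<1;\qquad -\hbar_1\varphi'(0)+\ell_1\varphi(0)=\hbar_2\varphi'(1)+\ell_2\varphi(1)=0 .$$ Let the set of points of local maximum of $m$ be represented as $\mathcal{M}=\bigcup_{i=1}^9\mathcal{M}_i$, the collection of isolated points and segments of local maximum of $m$, classified as in the context. Then: (i) $\lim_{s\to\infty}\lambda_1(s)=\infty$ if and only if (i-1) $\mathcal{M}=\mathcal{M}_1\subset\{0,1\}$ when $\ell_1>0$ and $\ell_2>0$; (i-2) $\mathcal{M}=\mathcal{M}_1=\{0\}$ when $\ell_1>0$ and $\ell_2=0$; (i-3) $\mathcal{M}=\mathcal{M}_1=\{1\}$ when $\ell_1=0$ and $\ell_2>0$. (ii) If $\lim_{s\to\infty}\lambda_1(s)<\infty$, then $\lim_{s\to\infty}\lambda_1(s)$ equals the minimum of the following quantities (those that are not present being omitted): $\mathfrak{L}$; $\min\{c(x): x\in\mathcal{M}_1\setminus\{0,1\}\}$; $\lambda_1^{\mathcal{RD}}(0,a^I)$ if $[0,a^I]\in\mathcal{M}_6$; $\lambda_1^{\mathcal{RN}}(0,a^D)$ if $[0,a^D]\in\mathcal{M}_7$;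 $\lambda_1^{\mathcal{NR}}(a^I,1)$ if $[a^I,1]\in\mathcal{M}_8$; $\lambda_1^{\mathcal{DR}}(a^D,1)$ if $[a^D,1]\in\mathcal{M}_9$; $c(0)$ if $0\in\mathcal{M}_1$ and $\ell_1=0$; $c(1)$ if $1\in\mathcal{M}_1$ and $\ell_2=0$. Here $$\mathfrak{L}=\min\Big\{\min_{[a,b]\in\mathcal{M}_2}\lambda_1^{\mathcal{ND}}(a,b),\ \min_{[a,b]\in\mathcal{M}_3}\lambda_1^{\mathcal{NN}}(a,b),\ \min_{[a,b]\in\mathcal{M}_4}\lambda_1^{\mathcal{DD}}(a,b),\ \min_{[a,b]\in\mathcal{M}_5}\lambda_1^{\mathcal{DN}}(a,b)\Big\},$$ with a minimum over an empty family omitted.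
   Context: Principal eigenvalue: the unique real eigenvalue admitting a positive eigenfunction. "$m'$ changes sign at most finitely many times on $[0,1]$" means that $[0,1]$ is a finite union of closed intervals on each of which $m'\ge0$ or $m'\le 0$. Isolated point of local maximum of $m$: a point $x_0\in[0,1]$ such that for some $\epsilon_0>0$, $m(x_0)>m(x)$ for all $x\in\big((x_0-\epsilon_0,x_0+\epsilon_0)\cap[0,1]\big)\setminus\{x_0\}$. $\mathcal{M}_1$ is the set of all isolated points of local maximum. Segment of local maximum of $m$ (it need not be a set of genuine local maxima): a closed interval $[a,b]\subset[0,1]$, $a<b$, such that $m$ is constant on $[a,b]$, for some $\epsilon_0>0$ $m$ is monotone (in the weak sense) on $[a-\epsilon_0,a]\cap[0,1]$ and on $[b,b+\epsilon_0]\cap[0,1]$, and for every small $\epsilon>0$, $m'$ is not identically zero on $(a-\epsilon,a)$ if $a>0$, and $m'$ is not identically zero on $(b,b+\epsilon)$ if $b<1$. If $a>0$, the left endpoint is of type $I$ if $m$ is non-decreasing on $[a-\epsilon_0,a]$ for some small $\epsilon_0>0$ and of type $D$ if $m$ is non-increasing there. If $b<1$, the right endpoint is of type $I$ if $m$ is non-decreasing on $[b,b+\epsilon_0]$ for some small $\epsilon_0>0$ and of type $D$ if $m$ is non-increasing there. The segments are classified as follows. For $0<a<b<1$: $\mathcal{M}_2$ = segments with (left type, right type) $=(I,I)$; $\mathcal{M}_3$: $(I,D)$; $\mathcal{M}_4$: $(D,I)$; $\mathcal{M}_5$: $(D,D)$. Segments $[0,b]$ with $0<b<1$: $\mathcal{M}_6$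 if $b$ is of type $I$ (written $[0,a^I]$), $\mathcal{M}_7$ if $b$ is of type $D$ (written $[0,a^D]$). Segments $[a,1]$ with $0<a<1$: $\mathcal{M}_8$ if $a$ is of type $I$ (written $[a^I,1]$), $\mathcal{M}_9$ if $a$ is of type $D$ (written $[a^D,1]$). $\mathcal{M}_2,\mathcal{M}_5$ are at most countable and the other families are finite; each of $\mathcal{M}_6,\dots,\mathcal{M}_9$ has at most one element; some $\mathcal{M}_i$ may be empty. "$\mathcal{M}=\mathcal{M}_1$" means that $\mathcal{M}_2,\dots,\mathcal{M}_9$ are all empty. For $i,j\in\{\mathcal{N},\mathcal{D}\}$, $\lambda_1^{ij}(a,b)$ is the principal eigenvalue of $-\varphi''+c\varphi=\lambda\varphi$ on $(a,b)$ with Neumann ($\mathcal N$) or Dirichlet ($\mathcal D$) condition at $a$ according to $i$ and at $b$ according to $j$. $\lambda_1^{\mathcal{R}j}(0,b)$ is the principal eigenvalue of the same equation on $(0,b)$ with $-\hbar_1\varphi'(0)+\ell_1\varphi(0)=0$ at $0$ and condition $j$ at $b$; $\lambda_1^{i\mathcal{R}}(a,1)$ is that on $(a,1)$ with condition $i$ at $a$ and $\hbar_2\varphi'(1)+\ell_2\varphi(1)=0$ at $1$. The minima over the possibly infinite families $\mathcal{M}_2,\mathcal{M}_5$ are well defined, since the corresponding eigenvalues tend to $\infty$ as the interval length tends to $0$. *)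

theory Defs
  imports "HOL-Analysis.Analysis"
begin

text \<open>
  \<open>f\<close> is of class $C^2$ on the closed interval $[a,b]$, with first and second derivatives
  \<open>f'\<close> and \<open>f''\<close>; derivatives at the endpoints are one-sided.
\<close>
definition C2_on :: "real \<Rightarrow> real \<Rightarrow> (real \<Rightarrow> real) \<Rightarrow> (real \<Rightarrow> real) \<Rightarrow> (real \<Rightarrow> real) \<Rightarrow> bool" where
  "C2_on a b f f' f'' \<longleftrightarrow>
     (\<forall>x\<in>{a..b}. (f has_real_derivative f' x) (at x within {a..b})) \<and>
     (\<forall>x\<in>{a..b}. (f' has_real_derivative f'' x) (at x within {a..b})) \<and>
     continuous_on {a..b} f''"

definition finitely_many_sign_changes :: "(real \<Rightarrow> real) \<Rightarrow> bool" where
  "finitely_many_sign_changes g \<longleftrightarrow>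
     (\<exists>F. finite F \<and> \<Union>F = {0..1::real} \<and>
        (\<forall>J\<in>F. (\<exists>a b. J = {a..b}) \<and> ((\<forall>x\<in>J. g x \<ge> 0) \<or> (\<forall>x\<in>J. g x \<le> 0))))"


subsection \<open>Principal eigenvalues\<close>

text \<open>
  A boundary condition $(h,l)$ stands for $h\,\partial_\nu\varphi + l\,\varphi = 0$ with
  $\partial_\nu$ the outward derivative, which is $-\varphi'(a)$ at the left endpoint and
  $\varphi'(b)$ at the right endpoint.
\<close>
type_synonym bdry_cond = "real \<times> real"

definition Neumann :: bdry_cond where "Neumann = (1, 0)"

definition Dirichlet :: bdry_cond where "Dirichlet = (0, 1)"

text \<open>
  The eigenvalue problem is $-\varphi'' - p\,\varphi' + c\,\varphi = \lambda\varphi$ on $(a,b)$.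
  Positivity is required in the open interval only, since Dirichlet conditions force zeros at
  the endpoints.
\<close>
definition positive_eigenfunction ::
  "(real \<Rightarrow> real) \<Rightarrow> (real \<Rightarrow> real) \<Rightarrow> bdry_cond \<Rightarrow> bdry_cond \<Rightarrow> real \<Rightarrow> real \<Rightarrow> real \<Rightarrow> (real \<Rightarrow> real) \<Rightarrow> bool"
where
  "positive_eigenfunction p c L R a b \<mu> \<phi> \<longleftrightarrow>
     (\<exists>\<phi>' \<phi>''. C2_on a b \<phi> \<phi>' \<phi>'' \<and>
        (\<forall>x\<in>{a<..<b}. \<phi> x > 0) \<and>
        (\<forall>x\<in>{a<..<b}. - \<phi>'' x - p x * \<phi>' x + c x * \<phi> x = \<mu> * \<phi> x) \<and>
        - fst L * \<phi>' a + snd L * \<phi> a = 0 \<and>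
        fst R * \<phi>' b + snd R * \<phi> b = 0)"

definition principal_eigenvalue ::
  "(real \<Rightarrow> real) \<Rightarrow> (real \<Rightarrow> real) \<Rightarrow> bdry_cond \<Rightarrow> bdry_cond \<Rightarrow> real \<Rightarrow> real \<Rightarrow> real"
where
  "principal_eigenvalue p c L R a b = (THE \<mu>. \<exists>\<phi>. positive_eigenfunction p c L R a b \<mu> \<phi>)"

text \<open>$\lambda_1^{ij}(a,b)$, the eigenvalue without first order term.\<close>
abbreviation lambda1 ::
  "(real \<Rightarrow> real) \<Rightarrow> bdry_cond \<Rightarrow> bdry_cond \<Rightarrow> real \<Rightarrow> real \<Rightarrow> real" where
  "lambda1 c i j a b \<equiv> principal_eigenvalue (\<lambda>_. 0) c i j a b"


subsection \<open>Isolated points and segments of local maximum\<close>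

definition M1 :: "(real \<Rightarrow> real) \<Rightarrow> real set" where
  "M1 m = {x0\<in>{0..1}. \<exists>e>0. \<forall>x\<in>({x0-e<..<x0+e} \<inter> {0..1}) - {x0}. m x0 > m x}"

text \<open>
  ``For every small $\epsilon>0$'' is rendered by the filter \<open>at_right 0\<close>, so that for
  $a>0$, $b<1$ the intervals $(a-\epsilon,a)$ and $(b,b+\epsilon)$ may be taken inside $[0,1]$.
\<close>
definition segment_of_local_max ::
  "(real \<Rightarrow> real) \<Rightarrow> (real \<Rightarrow> real) \<Rightarrow> real \<Rightarrow> real \<Rightarrow> bool" where
  "segment_of_local_max m m' a b \<longleftrightarrow>
     0 \<le> a \<and> a < b \<and> b \<le> 1 \<and> m constant_on {a..b} \<and>
     (\<exists>e>0. (mono_on ({a-e..a} \<inter> {0..1}) m \<or> antimono_on ({a-e..a} \<inter> {0..1}) m) \<and>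
            (mono_on ({b..b+e} \<inter> {0..1}) m \<or> antimono_on ({b..b+e} \<inter> {0..1}) m)) \<and>
     (a > 0 \<longrightarrow> (\<forall>\<^sub>F e in at_right 0. \<exists>x\<in>{a-e<..<a}. m' x \<noteq> 0)) \<and>
     (b < 1 \<longrightarrow> (\<forall>\<^sub>F e in at_right 0. \<exists>x\<in>{b<..<b+e}. m' x \<noteq> 0))"

definition left_I :: "(real \<Rightarrow> real) \<Rightarrow> real \<Rightarrow> bool" where
  "left_I m a \<longleftrightarrow> (\<exists>e>0. mono_on ({a-e..a} \<inter> {0..1}) m)"

definition left_D :: "(real \<Rightarrow> real) \<Rightarrow> real \<Rightarrow> bool" where
  "left_D m a \<longleftrightarrow> (\<exists>e>0. antimono_on ({a-e..a} \<inter> {0..1}) m)"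

definition right_I :: "(real \<Rightarrow> real) \<Rightarrow> real \<Rightarrow> bool" where
  "right_I m b \<longleftrightarrow> (\<exists>e>0. mono_on ({b..b+e} \<inter> {0..1}) m)"

definition right_D :: "(real \<Rightarrow> real) \<Rightarrow> real \<Rightarrow> bool" where
  "right_D m b \<longleftrightarrow> (\<exists>e>0. antimono_on ({b..b+e} \<inter> {0..1}) m)"

text \<open>A segment $[a,b]$ is encoded by the pair of its endpoints.\<close>

definition M2 :: "(real \<Rightarrow> real) \<Rightarrow> (real \<Rightarrow> real) \<Rightarrow> (real \<times> real) set" where
  "M2 m m' = {(a, b). segment_of_local_max m m' a b \<and> 0 < a \<and> b < 1 \<and> left_I m a \<and> right_I m b}"

definition M3 :: "(real \<Rightarrow> real) \<Rightarrow> (real \<Rightarrow> real) \<Rightarrow> (real \<times> real) set" where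
  "M3 m m' = {(a, b). segment_of_local_max m m' a b \<and> 0 < a \<and> b < 1 \<and> left_I m a \<and> right_D m b}"

definition M4 :: "(real \<Rightarrow> real) \<Rightarrow> (real \<Rightarrow> real) \<Rightarrow> (real \<times> real) set" where
  "M4 m m' = {(a, b). segment_of_local_max m m' a b \<and> 0 < a \<and> b < 1 \<and> left_D m a \<and> right_I m b}"

definition M5 :: "(real \<Rightarrow> real) \<Rightarrow> (real \<Rightarrow> real) \<Rightarrow> (real \<times> real) set" where
  "M5 m m' = {(a, b). segment_of_local_max m m' a b \<and> 0 < a \<and> b < 1 \<and> left_D m a \<and> right_D m b}"

definition M6 :: "(real \<Rightarrow> real) \<Rightarrow> (real \<Rightarrow> real) \<Rightarrow> (real \<times> real) set" where
  "M6 m m' = {(a, b). segment_of_local_max m m' a b \<and> a = 0 \<and> b < 1 \<and> right_I m b}"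

definition M7 :: "(real \<Rightarrow> real) \<Rightarrow> (real \<Rightarrow> real) \<Rightarrow> (real \<times> real) set" where
  "M7 m m' = {(a, b). segment_of_local_max m m' a b \<and> a = 0 \<and> b < 1 \<and> right_D m b}"

definition M8 :: "(real \<Rightarrow> real) \<Rightarrow> (real \<Rightarrow> real) \<Rightarrow> (real \<times> real) set" where
  "M8 m m' = {(a, b). segment_of_local_max m m' a b \<and> 0 < a \<and> b = 1 \<and> left_I m a}"

definition M9 :: "(real \<Rightarrow> real) \<Rightarrow> (real \<Rightarrow> real) \<Rightarrow> (real \<times> real) set" where
  "M9 m m' = {(a, b). segment_of_local_max m m' a b \<and> 0 < a \<and> b = 1 \<and> left_D m a}"

text \<open>$\mathcal{M} = \mathcal{M}_1$: there are no segments of local maximum.\<close>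
definition M_eq_M1 :: "(real \<Rightarrow> real) \<Rightarrow> (real \<Rightarrow> real) \<Rightarrow> bool" where
  "M_eq_M1 m m' \<longleftrightarrow>
     M2 m m' = {} \<and> M3 m m' = {} \<and> M4 m m' = {} \<and> M5 m m' = {} \<and>
     M6 m m' = {} \<and> M7 m m' = {} \<and> M8 m m' = {} \<and> M9 m m' = {}"


subsection \<open>The limiting quantities\<close>

text \<open>
  The singleton of the minimum of a family, and the empty set for an empty family: taking unions
  of such sets omits the quantities that are not present. On \<open>real\<close>, \<open>LEAST\<close> is
  the minimum when it is attained and unspecified otherwise.
\<close>
definition min_omit :: "real set \<Rightarrow> real set" where
  "min_omit S = (if S = {} then {} else {LEAST y. y \<in> S})"

text \<open>$\mathfrak{L}$ (empty when $\mathcal{M}_2,\dots,\mathcal{M}_5$ all are).\<close>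
definition frakL :: "(real \<Rightarrow> real) \<Rightarrow> (real \<Rightarrow> real) \<Rightarrow> (real \<Rightarrow> real) \<Rightarrow> real set" where
  "frakL m m' c = min_omit
     (min_omit {lambda1 c Neumann   Dirichlet a b | a b. (a, b) \<in> M2 m m'} \<union>
      min_omit {lambda1 c Neumann   Neumann   a b | a b. (a, b) \<in> M3 m m'} \<union>
      min_omit {lambda1 c Dirichlet Dirichlet a b | a b. (a, b) \<in> M4 m m'} \<union>
      min_omit {lambda1 c Dirichlet Neumann   a b | a b. (a, b) \<in> M5 m m'})"

text \<open>\<open>L = (hbar1, l1)\<close> and \<open>R = (hbar2, l2)\<close> are the boundary conditions at 0 and 1.\<close>
definition limit_quantities ::
  "(real \<Rightarrow> real) \<Rightarrow> (real \<Rightarrow> real) \<Rightarrow> (real \<Rightarrow> real) \<Rightarrow> bdry_cond \<Rightarrow> bdry_cond \<Rightarrow> real set" where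
  "limit_quantities m m' c L R =
     frakL m m' c \<union>
     min_omit {c x | x. x \<in> M1 m - {0, 1}} \<union>
     {lambda1 c L Dirichlet 0 a | a. (0, a) \<in> M6 m m'} \<union>
     {lambda1 c L Neumann 0 a | a. (0, a) \<in> M7 m m'} \<union>
     {lambda1 c Neumann R a 1 | a. (a, 1) \<in> M8 m m'} \<union>
     {lambda1 c Dirichlet R a 1 | a. (a, 1) \<in> M9 m m'} \<union>
     (if 0 \<in> M1 m \<and> snd L = 0 then {c 0} else {}) \<union>
     (if 1 \<in> M1 m \<and> snd R = 0 then {c 1} else {})"

definition is_minimum :: "real set \<Rightarrow> real \<Rightarrow> bool" where
  "is_minimum S y \<longleftrightarrow> y \<in> S \<and> (\<forall>z\<in>S. y \<le> z)"

end

theory Submission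
  imports Defs
begin

text \<open>
Write an eigenfunction in polar form, \<open>\<phi> = r sin \<theta>\<close>, \<open>\<phi>' = r cos \<theta>\<close>. Then
  \<open>\<theta>' = cos\<^sup>2 \<theta> + 2 s m' sin \<theta> cos \<theta> + (\<lambda> - c) sin\<^sup>2 \<theta>\<close>, the condition at 0 prescribes
  \<open>\<theta>(0) \<in> [0,\<pi>/2]\<close>, and \<open>\<lambda>\<close> lies below (above) the principal eigenvalue iff \<open>\<theta>(1)\<close> lies below
  (above) a target angle in \<open>[\<pi>/2,\<pi>]\<close> given by the condition at 1. Everything thus reduces to
  following one scalar flow for fixed \<open>\<lambda>\<close> and large \<open>s\<close>. Where \<open>m\<close> increases, the drift pushes the
  angles in \<open>(0,\<pi>)\<close> to \<open>\<pi>/2\<close>; where \<open>m\<close> decreases, it pushes those below \<open>\<pi>/2\<close> to 0 and those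
  above \<open>\<pi>/2\<close> to \<open>\<pi>\<close>, from where they never return. On a segment of local maximum the flow is that
  of the limiting eigenvalue problem, entered at \<open>\<pi>/2\<close> (Neumann) or 0 (Dirichlet), and at an isolated
  maximum \<open>x\<close> the sign of \<open>\<lambda> - c(x)\<close> decides on which side of \<open>\<pi>/2\<close> the angle leaves. The
  reflection \<open>\<pi> - \<theta>\<close> and the shift \<open>\<theta> + \<pi>/2\<close> turn lower into upper estimates and decreasing into
  increasing potentials. For \<open>\<lambda>\<close> below all limiting quantities the angle is controlled along
  \<open>[0,1]\<close> by real induction, which copes with infinitely many segments.
\<close>

subsection \<open>Scalar differential equations\<close>

text \<open>The two bounds differ in nature. For an upper bound on the eigenvalue one limiting
  quantity below \<nu> suffices: it carries the angle past pi, and since the coefficient of cos^2 is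
  1, the angle has slope 1 wherever it is a multiple of pi, so pi is crossed upwards only. For a
  lower bound no point may be neglected, and since flat pieces may accumulate there is no finite
  subdivision along which to argue. Every estimate over a monotone stretch loses \<open>K\<close>
  times its length, where \<open>K\<close> bounds the terms that do not grow with s; the loss is
  removed by restarting ever closer to the point of interest, which needs m to change strictly up to
  that point. The drift vanishes at the angles 0, pi/2 and pi, so it only brings the angle close to
  these values. Whether the angle actually lies beyond them is decided by the bounded terms: by
  cos^2 at 0 and pi, by \<nu> - c at pi/2. Hence \<nu> is compared strictly with the limiting
  quantities, and the limit is obtained by squeezing.\<close>

lemma deriv_le_linear_imp_nonpos:
  fixes d :: "real \<Rightarrow> real"
  assumes ab: "a \<le> b"
    and der: "\<And>x. x \<in> {a..b} \<Longrightarrow> (d has_real_derivative d' x) (at x within {a..b})"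
    and le: "\<And>x. x \<in> {a..b} \<Longrightarrow> d x > 0 \<Longrightarrow> d' x \<le> L * d x"
    and init: "d a \<le> 0"
  shows "d b \<le> 0"
proof (rule ccontr)
  assume "\<not> d b \<le> 0"
  hence pos: "d b > 0" by simp
  have cont: "continuous_on {a..b} d"
    using der by (meson DERIV_continuous continuous_on_eq_continuous_within)
  \<comment> \<open>\<open>Sup S\<close> is the last point with \<open>d x \<le> 0\<close>. Beyond
    it \<open>d\<close> is positive, so \<open>exp (- L * x) * d x\<close> is nonincreasing there
    and cannot become positive.\<close>
  define S where "S = {x\<in>{a..b}. d x \<le> 0}"
  have "closed S" unfolding S_def
    using continuous_closed_preimage[OF cont closed_atLeastAtMost, of "{..0}"]
    by (simp add: vimage_def Int_def)
  moreover have "S \<noteq> {}" using init ab by (auto simp: S_def)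
  moreover have "bdd_above S" by (auto simp: S_def)
  ultimately have tS: "Sup S \<in> S" using closed_contains_Sup by blast
  define t where "t = Sup S"
  have t: "a \<le> t" "t \<le> b" "d t \<le> 0" using tS by (auto simp: S_def t_def)
  with pos have tb: "t < b" by (cases "t = b") auto
  have dpos: "d x > 0" if "t < x" "x \<le> b" for x
  proof (rule ccontr)
    assume "\<not> d x > 0"
    hence "x \<in> S" using that t by (auto simp: S_def)
    hence "x \<le> t" unfolding t_def using \<open>bdd_above S\<close> by (rule cSup_upper)
    thus False using that by simp
  qed
  define g where "g x = exp (- L * x) * d x" for x
  have "g b \<le> g t"
  proof (rule DERIV_nonpos_imp_decreasing_open[where f=g])
    show "t \<le> b" by fact
    fix x assume x: "t < x" "x < b"
    hence "(d has_real_derivative d' x) (at x)"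
      using der[of x] t at_within_Icc_at[of a x b] by auto
    hence "(g has_real_derivative (exp (- L * x) * (d' x - L * d x))) (at x)"
      unfolding g_def by (auto intro!: derivative_eq_intros simp: algebra_simps)
    moreover have "exp (- L * x) * (d' x - L * d x) \<le> 0"
      using le[of x] dpos[of x] x t by (intro mult_nonneg_nonpos) auto
    ultimately show "\<exists>y. (g has_real_derivative y) (at x) \<and> y \<le> 0" by blast
  next
    show "continuous_on {t..b} g" unfolding g_def
      using t by (intro continuous_intros continuous_on_subset[OF cont]) auto
  qed
  moreover have "g b > 0" using pos by (simp add: g_def)
  moreover have "g t \<le> 0" using t by (simp add: g_def mult_nonneg_nonpos)
  ultimately show False by simp
qed

text \<open>Picard iteration in an exponentially weighted sup norm (Bielecki), which makes the
  integral operator a contraction on all of [a,b] at once. The fixed point is sought for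
  \<open>exp (- K * (x - a)) * f x\<close>.\<close>

lemma lipschitz_ode_exists:
  fixes F :: "real \<Rightarrow> real \<Rightarrow> real"
  assumes ab: "a \<le> b"
    and cont: "\<And>g. continuous_on {a..b} g \<Longrightarrow> continuous_on {a..b} (\<lambda>x. F x (g x))"
    and lip: "\<And>x y z. x \<in> {a..b} \<Longrightarrow> \<bar>F x y - F x z\<bar> \<le> L * \<bar>y - z\<bar>"
  obtains f where "f a = y0" "\<And>x. x \<in> {a..b} \<Longrightarrow> (f has_real_derivative F x (f x)) (at x within {a..b})"
proof -
  have L0: "L \<ge> 0" using lip[of a 1 0] ab by auto
  \<comment> \<open>The weight turns the contraction constant into \<open>L / K\<close>, hence at
    most 1/2.\<close>
  define K where "K = 2 * L + 1"
  have K: "K > 0" "L / K \<le> 1/2" using L0 by (auto simp: K_def field_simps)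
  \<comment> \<open>Bounded continuous functions live on the whole line, so functions on [a,b] are
    extended by clamping the argument.\<close>
  define cl where "cl x = max a (min b x)" for x :: real
  have cl: "cl x \<in> {a..b}" for x using ab by (auto simp: cl_def)
  have cl_id: "cl x = x" if "x \<in> {a..b}" for x using that by (auto simp: cl_def)
  define G where "G g t = F t (exp (K * (t - a)) * g t)" for g :: "real \<Rightarrow> real" and t
  have Gc: "continuous_on {a..b} (G g)" if "continuous_on {a..b} g" for g
    unfolding G_def by (intro cont continuous_intros that)
  define T where "T g x = exp (- K * (cl x - a)) * (y0 + integral {a..cl x} (G g))" for g x
  have Tb: "T g \<in> bcontfun" if "continuous_on {a..b} g" for g
  proof -
    let ?h = "\<lambda>x. exp (- K * (x - a)) * (y0 + integral {a..x} (G g))"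
    have c: "continuous_on {a..b} ?h"
      using Gc[OF that] by (intro continuous_intros indefinite_integral_continuous_1 integrable_continuous_real)
    have "continuous_on UNIV cl" unfolding cl_def by (intro continuous_intros)
    hence "continuous_on UNIV (?h \<circ> cl)"
      using c cl by (intro continuous_on_compose) (auto intro: continuous_on_subset)
    moreover have "bounded (range (?h \<circ> cl))"
    proof (rule bounded_subset)
      show "bounded (?h ` {a..b})" using c compact_continuous_image compact_imp_bounded by blast
      show "range (?h \<circ> cl) \<subseteq> ?h ` {a..b}" using cl by auto
    qed
    moreover have "T g = ?h \<circ> cl" by (auto simp: T_def)
    ultimately show ?thesis by (simp add: bcontfun_def)
  qed
  define S where "S g = Bcontfun (T (apply_bcontfun g))" for g
  have S: "apply_bcontfun (S g) = T (apply_bcontfun g)" for g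
    unfolding S_def by (rule Bcontfun_inverse) (auto intro: Tb)
  have "\<exists>!g. S g = g"
  proof (rule banach_fix_type[where c="1/2"])
    show "\<forall>f g. dist (S f) (S g) \<le> 1/2 * dist f g"
    proof (intro allI)
      fix f g :: "real \<Rightarrow>\<^sub>C real"
      show "dist (S f) (S g) \<le> 1/2 * dist f g"
      proof (rule dist_bound)
        fix x
        define D where "D = dist f g"
        have D: "\<bar>f t - g t\<bar> \<le> D" for t using dist_bounded[of f t g] by (simp add: D_def dist_real_def)
        have D0: "D \<ge> 0" by (simp add: D_def)
        define \<xi> where "\<xi> = cl x"
        have \<xi>: "a \<le> \<xi>" "\<xi> \<le> b" using cl[of x] by (auto simp: \<xi>_def)
        have int: "G h integrable_on {a..\<xi>}" if "continuous_on {a..b} h" for h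
          using Gc[OF that] \<xi> by (intro integrable_continuous_real) (auto intro: continuous_on_subset)
        have I: "((\<lambda>t. L * D * exp (K * (t - a))) has_integral
                   (L * D / K * exp (K * (\<xi> - a)) - L * D / K * exp (K * (a - a)))) {a..\<xi>}"
          using K \<xi> by (intro fundamental_theorem_of_calculus)
            (auto simp flip: has_real_derivative_iff_has_vector_derivative intro!: derivative_eq_intros)
        have "\<bar>integral {a..\<xi>} (G f) - integral {a..\<xi>} (G g)\<bar> = norm (integral {a..\<xi>} (\<lambda>t. G f t - G g t))"
          by (simp add: integral_diff int)
        also have "\<dots> \<le> integral {a..\<xi>} (\<lambda>t. L * D * exp (K * (t - a)))"
        proof (rule integral_norm_bound_integral)
          show "(\<lambda>t. G f t - G g t) integrable_on {a..\<xi>}" by (intro integrable_diff int) auto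
          show "(\<lambda>t. L * D * exp (K * (t - a))) integrable_on {a..\<xi>}" using I by blast
          fix t assume t: "t \<in> {a..\<xi>}"
          hence "\<bar>G f t - G g t\<bar> \<le> L * \<bar>exp (K * (t - a)) * f t - exp (K * (t - a)) * g t\<bar>"
            unfolding G_def using \<xi> by (intro lip) auto
          also have "\<dots> = L * (exp (K * (t - a)) * \<bar>f t - g t\<bar>)"
            by (simp add: abs_mult flip: right_diff_distrib)
          also have "\<dots> \<le> L * (exp (K * (t - a)) * D)"
            using D L0 by (intro mult_left_mono) auto
          finally show "norm (G f t - G g t) \<le> L * D * exp (K * (t - a))" by (simp add: mult_ac)
        qed
        also have "\<dots> = L * D / K * exp (K * (\<xi> - a)) - L * D / K * exp (K * (a - a))"
          using I by (rule integral_unique)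
        also have "\<dots> \<le> L * D / K * exp (K * (\<xi> - a))" using L0 D0 K by simp
        finally have *: "\<bar>integral {a..\<xi>} (G f) - integral {a..\<xi>} (G g)\<bar> \<le> L * D / K * exp (K * (\<xi> - a))" .
        have "dist (S f x) (S g x) = exp (- K * (\<xi> - a)) * \<bar>integral {a..\<xi>} (G f) - integral {a..\<xi>} (G g)\<bar>"
          unfolding S T_def dist_real_def \<xi>_def[symmetric] by (simp add: abs_mult flip: right_diff_distrib)
        also have "\<dots> \<le> exp (- K * (\<xi> - a)) * (L * D / K * exp (K * (\<xi> - a)))"
          using * by (intro mult_left_mono) auto
        also have "\<dots> = L / K * D * (exp (- K * (\<xi> - a)) * exp (K * (\<xi> - a)))" by simp
        also have "\<dots> = L / K * D" by (simp flip: exp_add)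
        also have "\<dots> \<le> 1/2 * D" using K D0 by (intro mult_right_mono) auto
        finally show "dist (S f x) (S g x) \<le> 1/2 * dist f g" by (simp add: D_def)
      qed
    qed
  qed auto
  then obtain g where g: "S g = g" by blast
  define f where "f x = exp (K * (x - a)) * g x" for x
  have fx: "f x = y0 + integral {a..x} (\<lambda>t. F t (f t))" if "x \<in> {a..b}" for x
  proof -
    have "g x = exp (- K * (x - a)) * (y0 + integral {a..x} (G g))"
    proof -
      have "g x = T g x" using S[of g] g by metis
      thus ?thesis by (simp add: T_def cl_id[OF that])
    qed
    moreover have "exp (K * (x - a)) * exp (- K * (x - a)) = 1" by (simp flip: exp_add)
    ultimately have "f x = y0 + integral {a..x} (G g)" unfolding f_def by (metis mult.assoc mult.left_neutral)
    thus ?thesis by (simp add: G_def[abs_def] f_def)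
  qed
  have fc: "continuous_on {a..b} f" unfolding f_def by (intro continuous_intros) auto
  show thesis
  proof (rule that[of f])
    show "f a = y0" using fx[of a] ab by simp
    fix x assume x: "x \<in> {a..b}"
    have "((\<lambda>x. y0 + integral {a..x} (\<lambda>t. F t (f t))) has_real_derivative 0 + F x (f x)) (at x within {a..b})"
      by (intro DERIV_add DERIV_const integral_has_real_derivative cont fc x)
    thus "(f has_real_derivative F x (f x)) (at x within {a..b})"
      using fx x by (auto intro: has_field_derivative_transform_within[where d=1])
  qed
qed

subsection \<open>The Pruefer angle\<close>

text \<open>Right-hand side of the Pruefer equation. The eigenvalue problem has \<open>A = 1\<close>
  and \<open>B = \<mu> - c\<close>; general coefficients keep the class closed under
  \<open>pi - T\<close>, which negates \<open>A\<close> and \<open>B\<close>, and under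
  \<open>T + pi / 2\<close>, which swaps them and negates \<open>q\<close>.\<close>

definition fld :: "(real \<Rightarrow> real) \<Rightarrow> (real \<Rightarrow> real) \<Rightarrow> (real \<Rightarrow> real) \<Rightarrow> real \<Rightarrow> real \<Rightarrow> real" where
  "fld A B q x t = A x * (cos t)\<^sup>2 + q x * (sin t * cos t) + B x * (sin t)\<^sup>2"

definition angle_sol ::
  "(real \<Rightarrow> real) \<Rightarrow> (real \<Rightarrow> real) \<Rightarrow> (real \<Rightarrow> real) \<Rightarrow> (real \<Rightarrow> real) \<Rightarrow> real \<Rightarrow> real \<Rightarrow> bool" where
  "angle_sol A B q T u v \<longleftrightarrow>
     continuous_on {u..v} A \<and> continuous_on {u..v} B \<and> continuous_on {u..v} q \<and>
     (\<forall>x\<in>{u..v}. (T has_real_derivative fld A B q x (T x)) (at x within {u..v}))"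

lemma angle_sol_subset:
  assumes "angle_sol A B q T u v" "u \<le> u'" "v' \<le> v"
  shows "angle_sol A B q T u' v'"
proof -
  have "{u'..v'} \<subseteq> {u..v}" using assms by auto
  thus ?thesis using assms(1) unfolding angle_sol_def
    by (meson DERIV_subset continuous_on_subset subsetD)
qed

lemma angle_sol_reflect:
  assumes "angle_sol A B q T u v"
  shows "angle_sol (\<lambda>x. - A x) (\<lambda>x. - B x) q (\<lambda>x. pi - T x) u v"
  using assms unfolding angle_sol_def fld_def
  by (auto intro!: continuous_intros derivative_eq_intros simp: sin_diff cos_diff)

lemma angle_sol_shift:
  assumes "angle_sol A B q T u v"
  shows "angle_sol B A (\<lambda>x. - q x) (\<lambda>x. T x + pi / 2) u v"
  using assms unfolding angle_sol_def fld_def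
  by (auto intro!: continuous_intros derivative_eq_intros simp: sin_add cos_add)

lemma angle_sol_minus_pi:
  assumes "angle_sol A B q T u v"
  shows "angle_sol A B q (\<lambda>x. T x - pi) u v"
  using assms unfolding angle_sol_def fld_def
  by (auto intro!: continuous_intros derivative_eq_intros simp: sin_diff cos_diff)

lemma angle_sol_continuous: "angle_sol A B q T u v \<Longrightarrow> continuous_on {u..v} T"
  unfolding angle_sol_def by (meson DERIV_continuous continuous_on_eq_continuous_within)

lemma abs_sin_diff_le: "\<bar>sin s - sin t\<bar> \<le> \<bar>s - t\<bar>" for s t :: real
proof -
  have "\<bar>sin s - sin t\<bar> = 2 * \<bar>sin ((s - t) / 2)\<bar> * \<bar>cos ((s + t) / 2)\<bar>"
    by (simp add: sin_diff_sin abs_mult)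
  also have "\<dots> \<le> 2 * \<bar>(s - t) / 2\<bar> * 1"
    by (intro mult_mono abs_sin_x_le_abs_x) auto
  finally show ?thesis by simp
qed

lemma abs_cos_diff_le: "\<bar>cos s - cos t\<bar> \<le> \<bar>s - t\<bar>" for s t :: real
  using abs_sin_diff_le[of "s + pi/2" "t + pi/2"] by (simp add: sin_add)

lemma fld_lipschitz:
  "\<bar>fld A B q x s - fld A B q x t\<bar> \<le> 2 * (\<bar>A x\<bar> + \<bar>q x\<bar> + \<bar>B x\<bar>) * \<bar>s - t\<bar>"
proof -
  have prod: "\<bar>a * b - a' * b'\<bar> \<le> 2 * d"
    if "\<bar>a - a'\<bar> \<le> d" "\<bar>b - b'\<bar> \<le> d" "\<bar>b\<bar> \<le> 1" "\<bar>a'\<bar> \<le> 1" for a b a' b' d :: real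
  proof -
    have "a * b - a' * b' = (a - a') * b + a' * (b - b')" by (simp add: algebra_simps)
    hence "\<bar>a * b - a' * b'\<bar> \<le> \<bar>a - a'\<bar> * \<bar>b\<bar> + \<bar>a'\<bar> * \<bar>b - b'\<bar>"
      using abs_triangle_ineq by (simp add: abs_mult flip: abs_mult)
    also have "\<dots> \<le> d * 1 + 1 * d" using that by (intro add_mono mult_mono) auto
    finally show ?thesis by simp
  qed
  have 1: "\<bar>cos s * cos s - cos t * cos t\<bar> \<le> 2 * \<bar>s - t\<bar>"
    and 2: "\<bar>sin s * cos s - sin t * cos t\<bar> \<le> 2 * \<bar>s - t\<bar>"
    and 3: "\<bar>sin s * sin s - sin t * sin t\<bar> \<le> 2 * \<bar>s - t\<bar>"
    by (intro prod abs_sin_diff_le abs_cos_diff_le; simp)+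
  have "\<bar>fld A B q x s - fld A B q x t\<bar> = \<bar>A x * (cos s * cos s - cos t * cos t)
      + q x * (sin s * cos s - sin t * cos t) + B x * (sin s * sin s - sin t * sin t)\<bar>"
    by (simp add: fld_def power2_eq_square algebra_simps)
  also have "\<dots> \<le> \<bar>A x\<bar> * \<bar>cos s * cos s - cos t * cos t\<bar>
      + \<bar>q x\<bar> * \<bar>sin s * cos s - sin t * cos t\<bar> + \<bar>B x\<bar> * \<bar>sin s * sin s - sin t * sin t\<bar>"
    unfolding abs_mult[symmetric] by linarith
  also have "\<dots> \<le> \<bar>A x\<bar> * (2 * \<bar>s - t\<bar>) + \<bar>q x\<bar> * (2 * \<bar>s - t\<bar>) + \<bar>B x\<bar> * (2 * \<bar>s - t\<bar>)"
    using 1 2 3 by (intro add_mono mult_left_mono) auto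
  finally show ?thesis by (simp add: algebra_simps)
qed

lemma continuous_on_Icc_abs_bound:
  fixes f :: "real \<Rightarrow> real"
  assumes "continuous_on {u..v} f"
  obtains K where "K > 0" "\<And>x. x \<in> {u..v} \<Longrightarrow> \<bar>f x\<bar> \<le> K"
proof -
  have "bounded (f ` {u..v})"
    using assms compact_continuous_image compact_imp_bounded by blast
  then obtain K where "K > 0" "\<forall>y\<in>f ` {u..v}. norm y \<le> K" using bounded_pos by blast
  thus thesis using that by auto
qed

lemma fld_uniformly_lipschitz:
  assumes "continuous_on {u..v} A" "continuous_on {u..v} B" "continuous_on {u..v} q"
  obtains L where "L > 0" "\<And>x s t. x \<in> {u..v} \<Longrightarrow> \<bar>fld A B q x s - fld A B q x t\<bar> \<le> L * \<bar>s - t\<bar>"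
proof -
  obtain KA where KA: "KA > 0" "\<And>x. x \<in> {u..v} \<Longrightarrow> \<bar>A x\<bar> \<le> KA"
    using continuous_on_Icc_abs_bound[OF assms(1)] by blast
  obtain KB where KB: "KB > 0" "\<And>x. x \<in> {u..v} \<Longrightarrow> \<bar>B x\<bar> \<le> KB"
    using continuous_on_Icc_abs_bound[OF assms(2)] by blast
  obtain Kq where Kq: "Kq > 0" "\<And>x. x \<in> {u..v} \<Longrightarrow> \<bar>q x\<bar> \<le> Kq"
    using continuous_on_Icc_abs_bound[OF assms(3)] by blast
  show thesis
  proof (rule that[of "2 * (KA + Kq + KB)"])
    fix x s t assume x: "x \<in> {u..v}"
    have "2 * (\<bar>A x\<bar> + \<bar>q x\<bar> + \<bar>B x\<bar>) * \<bar>s - t\<bar> \<le> 2 * (KA + Kq + KB) * \<bar>s - t\<bar>"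
      using KA KB Kq x by (intro mult_right_mono add_mono mult_left_mono) auto
    thus "\<bar>fld A B q x s - fld A B q x t\<bar> \<le> 2 * (KA + Kq + KB) * \<bar>s - t\<bar>"
      using fld_lipschitz order_trans by blast
  qed (use KA KB Kq in auto)
qed

text \<open>Comparison principle: where \<open>T > V\<close>, the derivative of \<open>T - V\<close>
  is at most the Lipschitz constant times \<open>T - V\<close>, so the Gronwall argument applies.
  The barriers below enter as \<open>V\<close>.\<close>

lemma angle_le:
  assumes sol: "angle_sol A B q T u v"
    and V: "\<And>x. x \<in> {u..v} \<Longrightarrow> (V has_real_derivative V' x) (at x within {u..v})"
    and super: "\<And>x. x \<in> {u..v} \<Longrightarrow> fld A B q x (V x) \<le> V' x"
    and init: "T u \<le> V u"
    and x: "x \<in> {u..v}"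
  shows "T x \<le> V x"
proof -
  obtain L where L: "L > 0" "\<And>x s t. x \<in> {u..v} \<Longrightarrow> \<bar>fld A B q x s - fld A B q x t\<bar> \<le> L * \<bar>s - t\<bar>"
    using fld_uniformly_lipschitz sol unfolding angle_sol_def by metis
  have "T x - V x \<le> 0"
  proof (rule deriv_le_linear_imp_nonpos[where a=u and b=x and d="\<lambda>x. T x - V x" and L=L
        and d'="\<lambda>x. fld A B q x (T x) - V' x"])
    fix y assume y: "y \<in> {u..x}"
    hence y': "y \<in> {u..v}" using x by auto
    have "((\<lambda>x. T x - V x) has_real_derivative fld A B q y (T y) - V' y) (at y within {u..v})"
      using sol V[OF y'] y' unfolding angle_sol_def by (auto intro!: derivative_intros)
    thus "((\<lambda>x. T x - V x) has_real_derivative fld A B q y (T y) - V' y) (at y within {u..x})"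
      using x by (auto elim: DERIV_subset)
    assume "T y - V y > 0"
    thus "fld A B q y (T y) - V' y \<le> L * (T y - V y)"
      using L(2)[OF y', of "T y" "V y"] super[OF y'] by auto
  qed (use x init in auto)
  thus ?thesis by simp
qed

lemma angle_ge:
  assumes sol: "angle_sol A B q T u v"
    and V: "\<And>x. x \<in> {u..v} \<Longrightarrow> (V has_real_derivative V' x) (at x within {u..v})"
    and sub: "\<And>x. x \<in> {u..v} \<Longrightarrow> V' x \<le> fld A B q x (V x)"
    and init: "V u \<le> T u"
    and x: "x \<in> {u..v}"
  shows "V x \<le> T x"
proof -
  have "pi - T x \<le> pi - V x"
  proof (rule angle_le[OF angle_sol_reflect[OF sol], where V'="\<lambda>x. - V' x"])
    fix y assume y: "y \<in> {u..v}"
    show "((\<lambda>x. pi - V x) has_real_derivative - V' y) (at y within {u..v})"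
      using V[OF y] by (auto intro!: derivative_eq_intros)
    show "fld (\<lambda>x. - A x) (\<lambda>x. - B x) q y (pi - V y) \<le> - V' y"
      using sub[OF y] by (simp add: fld_def sin_diff cos_diff)
  qed (use init x in auto)
  thus ?thesis by simp
qed

lemma angle_sol_exists:
  assumes "u \<le> v" "continuous_on {u..v} A" "continuous_on {u..v} B" "continuous_on {u..v} q"
  obtains T where "T u = t0" "angle_sol A B q T u v"
proof -
  obtain L where L: "L > 0" "\<And>x s t. x \<in> {u..v} \<Longrightarrow> \<bar>fld A B q x s - fld A B q x t\<bar> \<le> L * \<bar>s - t\<bar>"
    using fld_uniformly_lipschitz assms by metis
  have "continuous_on {u..v} (\<lambda>x. fld A B q x (g x))" if "continuous_on {u..v} g" for g
    unfolding fld_def using assms that by (intro continuous_intros)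
  then obtain T where "T u = t0"
      "\<And>x. x \<in> {u..v} \<Longrightarrow> (T has_real_derivative fld A B q x (T x)) (at x within {u..v})"
    using lipschitz_ode_exists[of u v "fld A B q" L t0] L assms(1) by metis
  thus thesis using that assms by (auto simp: angle_sol_def)
qed

text \<open>The barriers are \<open>V\<close> shifted up and down by
  \<open>D * exp ((L + 1) * (x - u))\<close>: the rate \<open>L\<close> covers the displaced angle
  and the extra 1 the change of \<open>B\<close>, since the shift is always at least
  \<open>D\<close>. The constant \<open>C\<close> is independent of the two solutions and of
  \<open>D\<close>.\<close>

lemma angle_perturbation:
  assumes uv: "u \<le> v" and cont: "continuous_on {u..v} A" "continuous_on {u..v} B" "continuous_on {u..v} q"
  obtains C where "C > 0"
    "\<And>T V B' D. \<lbrakk>angle_sol A B q T u v; angle_sol A B' q V u v;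
        \<And>x. x \<in> {u..v} \<Longrightarrow> \<bar>B' x - B x\<bar> \<le> D; \<bar>T u - V u\<bar> \<le> D\<rbrakk> \<Longrightarrow> \<bar>T v - V v\<bar> \<le> C * D"
proof -
  obtain L where L: "L > 0" "\<And>x s t. x \<in> {u..v} \<Longrightarrow> \<bar>fld A B q x s - fld A B q x t\<bar> \<le> L * \<bar>s - t\<bar>"
    using fld_uniformly_lipschitz cont by metis
  show thesis
  proof (rule that[of "exp ((L + 1) * (v - u))"])
    fix T V B' D
    assume T: "angle_sol A B q T u v" and V: "angle_sol A B' q V u v"
      and D: "\<And>x. x \<in> {u..v} \<Longrightarrow> \<bar>B' x - B x\<bar> \<le> D" and init: "\<bar>T u - V u\<bar> \<le> D"
    define E where "E x = D * exp ((L + 1) * (x - u))" for x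
    have D0: "D \<ge> 0" using init by simp
    have E: "E x \<ge> D" if "x \<ge> u" for x
    proof -
      have "D * 1 \<le> D * exp ((L + 1) * (x - u))" using that L D0 by (intro mult_left_mono) auto
      thus ?thesis by (simp add: E_def)
    qed
    have BB: "\<bar>fld A B' q x t - fld A B q x t\<bar> \<le> D" if "x \<in> {u..v}" for x t
    proof -
      have "fld A B' q x t - fld A B q x t = (B' x - B x) * (sin t)\<^sup>2"
        by (simp add: fld_def algebra_simps)
      hence "\<bar>fld A B' q x t - fld A B q x t\<bar> = \<bar>B' x - B x\<bar> * (sin t)\<^sup>2" by (simp add: abs_mult)
      also have "\<dots> \<le> D * 1" using D[OF that] D0
        by (intro mult_mono) (auto simp: abs_square_le_1)
      finally show ?thesis by simp
    qed
    have dE: "(E has_real_derivative (L + 1) * E x) (at x within X)" for x X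
      unfolding E_def by (auto intro!: derivative_eq_intros)
    have dV: "(V has_real_derivative fld A B' q x (V x)) (at x within {u..v})" if "x \<in> {u..v}" for x
      using V that by (auto simp: angle_sol_def)
    have "T v \<le> V v + E v"
    proof (rule angle_le[OF T, where V'="\<lambda>x. fld A B' q x (V x) + (L + 1) * E x"])
      fix x assume x: "x \<in> {u..v}"
      show "((\<lambda>x. V x + E x) has_real_derivative fld A B' q x (V x) + (L + 1) * E x) (at x within {u..v})"
        by (intro DERIV_add dV dE x)
      show "fld A B q x (V x + E x) \<le> fld A B' q x (V x) + (L + 1) * E x"
        using BB[OF x, of "V x"] L(2)[OF x, of "V x + E x" "V x"] E[of x] x D0 by (auto simp: algebra_simps)
    qed (use init uv E_def in auto)
    moreover have "V v - E v \<le> T v"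
    proof (rule angle_ge[OF T, where V'="\<lambda>x. fld A B' q x (V x) - (L + 1) * E x"])
      fix x assume x: "x \<in> {u..v}"
      show "((\<lambda>x. V x - E x) has_real_derivative fld A B' q x (V x) - (L + 1) * E x) (at x within {u..v})"
        by (intro DERIV_diff dV dE x)
      show "fld A B' q x (V x) - (L + 1) * E x \<le> fld A B q x (V x - E x)"
        using BB[OF x, of "V x"] L(2)[OF x, of "V x - E x" "V x"] E[of x] x D0 by (auto simp: algebra_simps)
    qed (use init uv E_def in auto)
    ultimately show "\<bar>T v - V v\<bar> \<le> exp ((L + 1) * (v - u)) * D" by (auto simp: E_def mult_ac)
  qed auto
qed

text \<open>At angle 0 the slope is \<open>A x > 0\<close>. The angle stays nonnegative by
  comparison with 0, and a zero at a later point would force negative values just before it.\<close>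

lemma angle_pos:
  assumes sol: "angle_sol A B q T u v" and A: "\<And>x. x \<in> {u..v} \<Longrightarrow> A x > 0"
    and init: "T u \<ge> 0" and x: "u < x" "x \<le> v"
  shows "T x > 0"
proof (rule ccontr)
  assume neg: "\<not> T x > 0"
  have ge: "0 \<le> T y" if "y \<in> {u..v}" for y
    using angle_ge[OF sol, of "\<lambda>_. 0" "\<lambda>_. 0" y] A init that by (auto simp: fld_def less_imp_le)
  hence 0: "T x = 0" using neg x by (simp add: order_antisym)
  have "(T has_real_derivative fld A B q x (T x)) (at x within {u..v})"
    using sol x by (auto simp: angle_sol_def)
  hence d: "(T has_real_derivative A x) (at x within {u..v})" by (simp add: 0 fld_def)
  obtain d where d: "d > 0" "\<And>h. h > 0 \<Longrightarrow> x - h \<in> {u..v} \<Longrightarrow> h < d \<Longrightarrow> T (x - h) < T x"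
    using has_real_derivative_pos_inc_left[OF d] A x by auto
  define h where "h = min (d/2) (x - u)"
  have "T (x - h) < T x" using d(1) x by (intro d(2)) (auto simp: h_def)
  moreover have "T (x - h) \<ge> 0" using d(1) x by (intro ge) (auto simp: h_def)
  ultimately show False using 0 by simp
qed

lemma angle_gt_pi:
  assumes sol: "angle_sol A B q T u v" and A: "\<And>x. x \<in> {u..v} \<Longrightarrow> A x > 0"
    and init: "T u \<ge> pi" and x: "u < x" "x \<le> v"
  shows "T x > pi"
  using angle_pos[OF angle_sol_minus_pi[OF sol] A, of x] init x by simp

subsection \<open>Principal eigenvalues in terms of the angle\<close>

text \<open>The angle in [0, pi/2] with tangent h/l, from -h \<phi>' + l \<phi> = 0 at the left
  endpoint; at the right endpoint the outward derivative has the other sign and the angle becomes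
  \<open>pi - bdry_angle R\<close>. Neumann is a separate case because division by 0 would yield the
  angle 0.\<close>

definition bdry_angle :: "bdry_cond \<Rightarrow> real" where
  "bdry_angle L = (if snd L = 0 then pi / 2 else arctan (fst L / snd L))"

definition admissible_bc :: "bdry_cond \<Rightarrow> bool" where
  "admissible_bc L \<longleftrightarrow> fst L \<ge> 0 \<and> snd L \<ge> 0 \<and> fst L + snd L > 0"

lemma admissible_Neumann [simp]: "admissible_bc Neumann"
  and admissible_Dirichlet [simp]: "admissible_bc Dirichlet"
  by (auto simp: admissible_bc_def Neumann_def Dirichlet_def)

lemma bdry_angle_Neumann [simp]: "bdry_angle Neumann = pi / 2"
  and bdry_angle_Dirichlet [simp]: "bdry_angle Dirichlet = 0"
  by (auto simp: bdry_angle_def Neumann_def Dirichlet_def)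

lemma bdry_angle_bounds:
  assumes "admissible_bc L"
  shows "0 \<le> bdry_angle L" "bdry_angle L \<le> pi / 2" "snd L \<noteq> 0 \<Longrightarrow> bdry_angle L < pi / 2"
  using assms arctan_ubound[of "fst L / snd L"]
  by (auto simp: bdry_angle_def admissible_bc_def zero_le_arctan_iff)

lemma bdry_angle_eq:
  assumes "admissible_bc L"
  shows "fst L * cos (bdry_angle L) = snd L * sin (bdry_angle L)"
proof (cases "snd L = 0")
  case False
  have "sin (arctan (fst L / snd L)) = cos (arctan (fst L / snd L)) * (fst L / snd L)"
    by (simp add: sin_arctan cos_arctan)
  thus ?thesis using False by (simp add: bdry_angle_def field_simps)
qed (auto simp: bdry_angle_def)

text \<open>The eigenfunction is r sin T with derivative r cos T. It is positive inside: T leaves 0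
  upwards, and if it reached pi before \<open>b\<close> it would exceed pi at \<open>b\<close>,
  above the prescribed value.\<close>

lemma angle_imp_positive_eigenfunction:
  assumes ab: "a < b" and L: "admissible_bc L" and R: "admissible_bc R"
    and T: "angle_sol (\<lambda>_. 1) (\<lambda>x. \<mu> - c x) p T a b"
    and Ta: "T a = bdry_angle L" and Tb: "T b = pi - bdry_angle R"
  shows "\<exists>\<phi>. positive_eigenfunction p c L R a b \<mu> \<phi>"
proof -
  have cp: "continuous_on {a..b} p" and cB: "continuous_on {a..b} (\<lambda>x. \<mu> - c x)"
    using T by (auto simp: angle_sol_def)
  have cc: "continuous_on {a..b} c"
    using continuous_on_diff[OF continuous_on_const[of _ \<mu>] cB] by simp
  have cT: "continuous_on {a..b} T" using T by (rule angle_sol_continuous)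
  have dT: "(T has_real_derivative fld (\<lambda>_. 1) (\<lambda>x. \<mu> - c x) p x (T x)) (at x within {a..b})"
    if "x \<in> {a..b}" for x using T that by (auto simp: angle_sol_def)
  \<comment> \<open>Logarithmic derivative of the amplitude, chosen such that (r sin T)' = r cos
    T.\<close>
  define \<rho> where "\<rho> x = sin (T x) * cos (T x) * (1 + c x - \<mu>) - p x * (cos (T x))\<^sup>2" for x
  have c\<rho>: "continuous_on {a..b} \<rho>" unfolding \<rho>_def by (intro continuous_intros cT cp cc)
  define r where "r x = exp (integral {a..x} \<rho>)" for x
  have dr: "(r has_real_derivative r x * \<rho> x) (at x within {a..b})" if "x \<in> {a..b}" for x
    unfolding r_def using integral_has_real_derivative[OF c\<rho> that]
    by (auto intro!: derivative_eq_intros)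
  have r: "r x > 0" for x by (simp add: r_def)
  define \<phi> where "\<phi> x = r x * sin (T x)" for x
  define \<phi>' where "\<phi>' x = r x * cos (T x)" for x
  define \<phi>'' where "\<phi>'' x = - p x * \<phi>' x + (c x - \<mu>) * \<phi> x" for x
  have d1: "(\<phi> has_real_derivative \<phi>' x) (at x within {a..b})" if x: "x \<in> {a..b}" for x
  proof -
    let ?s = "sin (T x)" and ?k = "cos (T x)" and ?f = "fld (\<lambda>_. 1) (\<lambda>x. \<mu> - c x) p x (T x)"
    have "(\<phi> has_real_derivative r x * \<rho> x * ?s + r x * (?k * ?f)) (at x within {a..b})"
      unfolding \<phi>_def using dr[OF x] dT[OF x] by (auto intro!: derivative_eq_intros)
    moreover have "\<rho> x * ?s + ?k * ?f = ?k * ((sin (T x))\<^sup>2 + (cos (T x))\<^sup>2)"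
      unfolding \<rho>_def fld_def by algebra
    hence "\<rho> x * ?s + ?k * ?f = ?k" by simp
    hence "r x * \<rho> x * ?s + r x * (?k * ?f) = \<phi>' x"
      unfolding \<phi>'_def by (metis distrib_left mult.assoc)
    ultimately show ?thesis by simp
  qed
  have d2: "(\<phi>' has_real_derivative \<phi>'' x) (at x within {a..b})" if x: "x \<in> {a..b}" for x
  proof -
    let ?s = "sin (T x)" and ?k = "cos (T x)" and ?f = "fld (\<lambda>_. 1) (\<lambda>x. \<mu> - c x) p x (T x)"
    have "(\<phi>' has_real_derivative r x * \<rho> x * ?k + r x * (- ?s * ?f)) (at x within {a..b})"
      unfolding \<phi>'_def using dr[OF x] dT[OF x] by (auto intro!: derivative_eq_intros)
    moreover have "\<rho> x * ?k + (- ?s * ?f) = (- p x * ?k + (c x - \<mu>) * ?s) * ((sin (T x))\<^sup>2 + (cos (T x))\<^sup>2)"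
      unfolding \<rho>_def fld_def by algebra
    hence "\<rho> x * ?k + (- ?s * ?f) = - p x * ?k + (c x - \<mu>) * ?s" by simp
    hence "r x * \<rho> x * ?k + r x * (- ?s * ?f) = r x * (- p x * ?k + (c x - \<mu>) * ?s)"
      by (metis distrib_left mult.assoc)
    hence "r x * \<rho> x * ?k + r x * (- ?s * ?f) = \<phi>'' x"
      by (simp only: \<phi>''_def \<phi>'_def \<phi>_def) (simp add: algebra_simps)
    ultimately show ?thesis by simp
  qed
  have c1: "continuous_on {a..b} \<phi>" and c2: "continuous_on {a..b} \<phi>'"
    using d1 d2 by (meson DERIV_continuous continuous_on_eq_continuous_within)+
  have C2: "C2_on a b \<phi> \<phi>' \<phi>''"
    unfolding C2_on_def using d1 d2 c1 c2 cp cc by (auto simp: \<phi>''_def[abs_def] intro!: continuous_intros)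
  have pos: "\<phi> x > 0" if x: "x \<in> {a<..<b}" for x
  proof -
    have 1: "T x > 0"
      using angle_pos[OF T] bdry_angle_bounds[OF L] Ta x by auto
    have "T x < pi"
    proof (rule ccontr)
      assume "\<not> T x < pi"
      moreover have "angle_sol (\<lambda>_. 1) (\<lambda>x. \<mu> - c x) p T x b" using T x by (auto intro: angle_sol_subset)
      ultimately have "T b > pi" using angle_gt_pi x by force
      thus False using Tb bdry_angle_bounds[OF R] by simp
    qed
    with 1 show ?thesis by (simp add: \<phi>_def r sin_gt_zero)
  qed
  have "- fst L * \<phi>' a + snd L * \<phi> a = r a * (- (fst L * cos (bdry_angle L)) + snd L * sin (bdry_angle L))"
    by (simp add: \<phi>_def \<phi>'_def Ta algebra_simps)
  also have "\<dots> = 0" using bdry_angle_eq[OF L] by simp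
  finally have bL: "- fst L * \<phi>' a + snd L * \<phi> a = 0" .
  have "fst R * \<phi>' b + snd R * \<phi> b = r b * (- (fst R * cos (bdry_angle R)) + snd R * sin (bdry_angle R))"
    by (simp add: \<phi>_def \<phi>'_def Tb cos_diff sin_diff algebra_simps)
  also have "\<dots> = 0" using bdry_angle_eq[OF R] by simp
  finally have bR: "fst R * \<phi>' b + snd R * \<phi> b = 0" .
  have "positive_eigenfunction p c L R a b \<mu> \<phi>"
    unfolding positive_eigenfunction_def
    using C2 pos bL bR by (intro exI[of _ \<phi>'] exI[of _ \<phi>'']) (auto simp: \<phi>''_def algebra_simps)
  thus ?thesis by blast
qed

text \<open>The weighted Wronskian of two positive eigenfunctions vanishes at both endpoints, but it
  is strictly increasing when their eigenvalues differ.\<close>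

lemma positive_eigenvalue_not_less:
  assumes ab: "a < b" and L: "admissible_bc L" and R: "admissible_bc R"
    and cp: "continuous_on {a..b} p"
    and e1: "positive_eigenfunction p c L R a b \<mu> \<phi>"
    and e2: "positive_eigenfunction p c L R a b \<nu> \<psi>"
  shows "\<not> \<mu> < \<nu>"
proof
  assume less: "\<mu> < \<nu>"
  obtain \<phi>' \<phi>'' where 1: "C2_on a b \<phi> \<phi>' \<phi>''" "\<And>x. x \<in> {a<..<b} \<Longrightarrow> \<phi> x > 0"
    "\<And>x. x \<in> {a<..<b} \<Longrightarrow> - \<phi>'' x - p x * \<phi>' x + c x * \<phi> x = \<mu> * \<phi> x"
    "- fst L * \<phi>' a + snd L * \<phi> a = 0" "fst R * \<phi>' b + snd R * \<phi> b = 0"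
    using e1 unfolding positive_eigenfunction_def by blast
  obtain \<psi>' \<psi>'' where 2: "C2_on a b \<psi> \<psi>' \<psi>''" "\<And>x. x \<in> {a<..<b} \<Longrightarrow> \<psi> x > 0"
    "\<And>x. x \<in> {a<..<b} \<Longrightarrow> - \<psi>'' x - p x * \<psi>' x + c x * \<psi> x = \<nu> * \<psi> x"
    "- fst L * \<psi>' a + snd L * \<psi> a = 0" "fst R * \<psi>' b + snd R * \<psi> b = 0"
    using e2 unfolding positive_eigenfunction_def by blast
  define w where "w x = \<phi>' x * \<psi> x - \<phi> x * \<psi>' x" for x
  define W where "W x = exp (integral {a..x} p) * w x" for x
  have dP: "((\<lambda>x. integral {a..x} p) has_real_derivative p x) (at x within {a..b})" if "x \<in> {a..b}" for x
    by (rule integral_has_real_derivative[OF cp that])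
  have dW: "(W has_real_derivative exp (integral {a..x} p) *
       (p x * w x + (\<phi>'' x * \<psi> x - \<phi> x * \<psi>'' x))) (at x within {a..b})" if "x \<in> {a..b}" for x
    unfolding W_def w_def using 1(1) 2(1) that dP[OF that] unfolding C2_on_def
    by (auto intro!: derivative_eq_intros simp: algebra_simps)
  have "W a < W b"
  proof (rule DERIV_pos_imp_increasing_open[OF ab])
    show "continuous_on {a..b} W" using dW by (meson DERIV_continuous continuous_on_eq_continuous_within)
    fix x assume x: "a < x" "x < b"
    let ?d = "exp (integral {a..x} p) * (p x * w x + (\<phi>'' x * \<psi> x - \<phi> x * \<psi>'' x))"
    have "(W has_real_derivative ?d) (at x)"
      using dW[of x] x at_within_Icc_at[of a x b] by auto
    moreover have "p x * w x + (\<phi>'' x * \<psi> x - \<phi> x * \<psi>'' x) = (\<nu> - \<mu>) * (\<phi> x * \<psi> x)"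
    proof -
      have "\<phi>'' x = - p x * \<phi>' x + c x * \<phi> x - \<mu> * \<phi> x" "\<psi>'' x = - p x * \<psi>' x + c x * \<psi> x - \<nu> * \<psi> x"
        using 1(3)[of x] 2(3)[of x] x by auto
      thus ?thesis unfolding w_def by algebra
    qed
    moreover have "(\<nu> - \<mu>) * (\<phi> x * \<psi> x) > 0"
      using less 1(2)[of x] 2(2)[of x] x by auto
    ultimately show "\<exists>y. (W has_real_derivative y) (at x) \<and> 0 < y" by (metis exp_gt_zero mult_pos_pos)
  qed
  \<comment> \<open>Both pairs of value and derivative satisfy the same nonzero linear relation, so
    their determinant vanishes.\<close>
  moreover have "w a = 0"
  proof (cases "fst L = 0")
    case True
    hence "snd L \<noteq> 0" using L by (auto simp: admissible_bc_def)
    thus ?thesis using 1(4) 2(4) True by (simp add: w_def)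
  next
    case False
    have "fst L * w a = 0" using 1(4) 2(4) unfolding w_def by algebra
    thus ?thesis using False by simp
  qed
  moreover have "w b = 0"
  proof (cases "fst R = 0")
    case True
    hence "snd R \<noteq> 0" using R by (auto simp: admissible_bc_def)
    thus ?thesis using 1(5) 2(5) True by (simp add: w_def)
  next
    case False
    have "fst R * w b = 0" using 1(5) 2(5) unfolding w_def by algebra
    thus ?thesis using False by simp
  qed
  ultimately show False by (simp add: W_def)
qed

section \<open>Explicit barriers and extreme values of the spectral parameter\<close>

lemma sin_cos_small:
  fixes v e :: real
  assumes "\<bar>v\<bar> \<le> e" "e \<le> 1"
  shows "\<bar>sin v * cos v\<bar> \<le> e" "(cos v)\<^sup>2 \<ge> 1 - e" "(sin v)\<^sup>2 \<le> e\<^sup>2"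
proof -
  have s: "\<bar>sin v\<bar> \<le> e" using abs_sin_x_le_abs_x[of v] assms by simp
  have "\<bar>sin v\<bar> * \<bar>cos v\<bar> \<le> e * 1" using s by (intro mult_mono) auto
  thus "\<bar>sin v * cos v\<bar> \<le> e" by (simp add: abs_mult)
  show 2: "(sin v)\<^sup>2 \<le> e\<^sup>2" using s by (simp add: abs_le_square_iff[symmetric])
  have "e\<^sup>2 \<le> e" using assms s by (simp add: power2_eq_square mult_left_le)
  thus "(cos v)\<^sup>2 \<ge> 1 - e" using 2 by (simp add: cos_squared_eq)
qed

lemma abs_sin_cos_le_one: "\<bar>sin v * cos v\<bar> \<le> 1" for v :: real
proof -
  have "\<bar>sin v\<bar> * \<bar>cos v\<bar> \<le> 1 * 1" by (intro mult_mono) auto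
  thus ?thesis by (simp add: abs_mult)
qed

lemma angle_linear_ge:
  assumes T: "angle_sol A B q T u v" and uv: "u \<le> v"
    and init: "t0 \<le> T u"
    and fld: "\<And>x. x \<in> {u..v} \<Longrightarrow> k \<le> fld A B q x (t0 + k * (x - u))"
  shows "t0 + k * (v - u) \<le> T v"
  by (rule angle_ge[OF T, where V'="\<lambda>_. k"])
     (use assms in \<open>auto intro!: derivative_eq_intros\<close>)

lemma angle_linear_le:
  assumes T: "angle_sol A B q T u v" and uv: "u \<le> v"
    and init: "T u \<le> t0"
    and fld: "\<And>x. x \<in> {u..v} \<Longrightarrow> fld A B q x (t0 + k * (x - u)) \<le> k"
  shows "T v \<le> t0 + k * (v - u)"
  by (rule angle_le[OF T, where V'="\<lambda>_. k"])
     (use assms in \<open>auto intro!: derivative_eq_intros\<close>)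

text \<open>[a,b] is cut into three pieces of length h. On the outer two the cos^2 term carries the
  angle across the e-neighbourhoods of 0 and pi, at a speed that needs no large \<mu>; on the middle
  one sin^2 is at least \<open>(sin e)\<^sup>2\<close>, so a large \<mu> carries the angle from e to
  pi - e.\<close>

lemma angle_large_spectral_parameter:
  assumes ab: "a < b" and cp: "continuous_on {a..b} p" and cc: "continuous_on {a..b} c"
  obtains \<mu> where "\<And>T. angle_sol (\<lambda>_. 1) (\<lambda>x. \<mu> - c x) p T a b \<Longrightarrow> T a \<ge> 0 \<Longrightarrow> T b \<ge> pi"
proof -
  obtain K1 where K1: "K1 > 0" "\<And>x. x \<in> {a..b} \<Longrightarrow> \<bar>p x\<bar> \<le> K1"
    using continuous_on_Icc_abs_bound[OF cp] by blast
  obtain K2 where K2: "K2 > 0" "\<And>x. x \<in> {a..b} \<Longrightarrow> \<bar>c x\<bar> \<le> K2"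
    using continuous_on_Icc_abs_bound[OF cc] by blast
  define K where "K = max K1 K2"
  have K: "K > 0" "\<And>x. x \<in> {a..b} \<Longrightarrow> \<bar>p x\<bar> \<le> K" "\<And>x. x \<in> {a..b} \<Longrightarrow> \<bar>c x\<bar> \<le> K"
    using K1 K2 by (fastforce simp: K_def)+
  define h where "h = (b - a) / 3"
  have h: "h > 0" "b = a + 3 * h" using ab by (auto simp: h_def field_simps)
  \<comment> \<open>The solution of \<open>e / h = 1 - e - K * e\<close>: the slope needed to cover
    e over a length h equals the slope guaranteed near 0 and pi.\<close>
  define e where "e = 1 / (1 / h + 1 + K)"
  have den: "1 / h + 1 + K > 1" using h K by (simp add: add_pos_pos)
  have e: "e > 0" "e \<le> 1" using den by (auto simp: e_def)
  have "e * (1 / h + 1 + K) = 1" unfolding e_def using den by simp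
  hence e2: "e / h = 1 - e - K * e" by (simp add: algebra_simps)
  have e3: "e < pi / 2" using e pi_gt3 by simp
  have sine: "sin e > 0" using e e3 by (intro sin_gt_zero) auto
  \<comment> \<open>Makes \<open>(\<mu> - K) * (sin e)\<^sup>2 = K + pi / h\<close>, which pays for
    the drift and for a climb of at most pi over a length h.\<close>
  define \<mu> where "\<mu> = K + (K + pi / h) / (sin e)\<^sup>2"
  have \<mu>K: "\<mu> \<ge> K" using K h sine by (simp add: \<mu>_def)
  have near: "e / h \<le> fld (\<lambda>_. 1) (\<lambda>x. \<mu> - c x) p x v" if x: "x \<in> {a..b}" and v: "\<bar>v\<bar> \<le> e" for x v
  proof -
    have "\<bar>p x * (sin v * cos v)\<bar> \<le> K * e"
      unfolding abs_mult[of "p x"] using K(1,2) x sin_cos_small[OF v e(2)] by (intro mult_mono) auto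
    moreover have "(\<mu> - c x) * (sin v)\<^sup>2 \<ge> 0" using \<mu>K K(3)[OF x] by (intro mult_nonneg_nonneg) auto
    ultimately show ?thesis using sin_cos_small(2)[OF v e(2)] e2 unfolding fld_def by linarith
  qed
  have near': "e / h \<le> fld (\<lambda>_. 1) (\<lambda>x. \<mu> - c x) p x v" if x: "x \<in> {a..b}" and v: "\<bar>v - pi\<bar> \<le> e" for x v
  proof -
    have "fld (\<lambda>_. 1) (\<lambda>x. \<mu> - c x) p x v = fld (\<lambda>_. 1) (\<lambda>x. \<mu> - c x) p x (v - pi)"
      by (simp add: fld_def sin_diff cos_diff)
    thus ?thesis using near[OF x v] by simp
  qed
  have mid: "(pi - 2 * e) / h \<le> fld (\<lambda>_. 1) (\<lambda>x. \<mu> - c x) p x v"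
    if x: "x \<in> {a..b}" and v: "e \<le> v" "v \<le> pi - e" for x v
  proof -
    have "sin v \<ge> sin e"
    proof (cases "v \<le> pi / 2")
      case True
      thus ?thesis using v e by (intro sin_monotone_2pi_le) auto
    next
      case False
      have "sin e \<le> sin (pi - v)" using False v e by (intro sin_monotone_2pi_le) auto
      thus ?thesis by simp
    qed
    hence "(sin v)\<^sup>2 \<ge> (sin e)\<^sup>2" using sine by (intro power_mono) auto
    hence "(\<mu> - c x) * (sin v)\<^sup>2 \<ge> (\<mu> - K) * (sin e)\<^sup>2"
      using \<mu>K K(3)[OF x] by (intro mult_mono) auto
    also have "(\<mu> - K) * (sin e)\<^sup>2 = K + pi / h" using sine by (simp add: \<mu>_def)
    finally have 1: "(\<mu> - c x) * (sin v)\<^sup>2 \<ge> K + pi / h" .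
    have "\<bar>p x * (sin v * cos v)\<bar> \<le> K * 1"
      unfolding abs_mult[of "p x"] using K(1,2) x abs_sin_cos_le_one[of v] by (intro mult_mono) auto
    moreover have "(pi - 2 * e) / h \<le> pi / h" using e h by (intro divide_right_mono) auto
    moreover have "(cos v)\<^sup>2 \<ge> 0" by simp
    ultimately show ?thesis using 1 unfolding fld_def by linarith
  qed
  have slope: "k / h * (x - y) \<in> {0..k}" if "x \<in> {y..y+h}" "k \<ge> 0" for k x y
  proof -
    have "k / h * (x - y) \<le> k / h * h" using that h by (intro mult_left_mono) auto
    thus ?thesis using that h by auto
  qed
  show thesis
  proof (rule that[of \<mu>])
    fix T assume T: "angle_sol (\<lambda>_. 1) (\<lambda>x. \<mu> - c x) p T a b" and Ta: "T a \<ge> 0"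
    have "0 + e / h * (a + h - a) \<le> T (a + h)"
    proof (rule angle_linear_ge[OF angle_sol_subset[OF T] _ Ta])
      fix x assume "x \<in> {a..a + h}"
      thus "e / h \<le> fld (\<lambda>_. 1) (\<lambda>x. \<mu> - c x) p x (0 + e / h * (x - a))"
        using slope[of x a e] e h by (intro near) auto
    qed (use h in auto)
    hence 1: "e \<le> T (a + h)" using h by simp
    have "e + (pi - 2 * e) / h * (a + 2 * h - (a + h)) \<le> T (a + 2 * h)"
    proof (rule angle_linear_ge[OF angle_sol_subset[OF T] _ 1])
      fix x assume "x \<in> {a + h..a + 2 * h}"
      thus "(pi - 2 * e) / h \<le> fld (\<lambda>_. 1) (\<lambda>x. \<mu> - c x) p x (e + (pi - 2 * e) / h * (x - (a + h)))"
        using slope[of x "a + h" "pi - 2 * e"] e e3 h by (intro mid) auto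
    qed (use h in auto)
    hence 2: "pi - e \<le> T (a + 2 * h)" using h by simp
    have "pi - e + e / h * (b - (a + 2 * h)) \<le> T b"
    proof (rule angle_linear_ge[OF angle_sol_subset[OF T] _ 2])
      fix x assume "x \<in> {a + 2 * h..b}"
      thus "e / h \<le> fld (\<lambda>_. 1) (\<lambda>x. \<mu> - c x) p x (pi - e + e / h * (x - (a + 2 * h)))"
        using slope[of x "a + 2 * h" e] e h by (intro near') auto
    qed (use h in auto)
    moreover have "e / h * (b - (a + 2 * h)) = e" using h by simp
    ultimately show "T b \<ge> pi" by simp
  qed
qed

text \<open>A line falling from pi/2 to pi/4 is a supersolution once \<mu> is negative enough,
  because sin^2 is at least 1/2 along it.\<close>

lemma angle_small_spectral_parameter:
  assumes ab: "a < b" and cp: "continuous_on {a..b} p" and cc: "continuous_on {a..b} c"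
  obtains \<mu> where "\<And>T. angle_sol (\<lambda>_. 1) (\<lambda>x. \<mu> - c x) p T a b \<Longrightarrow> T a \<le> pi / 2 \<Longrightarrow> T b \<le> pi / 2"
proof -
  obtain K1 where K1: "K1 > 0" "\<And>x. x \<in> {a..b} \<Longrightarrow> \<bar>p x\<bar> \<le> K1"
    using continuous_on_Icc_abs_bound[OF cp] by blast
  obtain K2 where K2: "K2 > 0" "\<And>x. x \<in> {a..b} \<Longrightarrow> \<bar>c x\<bar> \<le> K2"
    using continuous_on_Icc_abs_bound[OF cc] by blast
  define k where "k = pi / 4 / (b - a)"
  have k: "k > 0" using ab by (simp add: k_def)
  \<comment> \<open>With sin^2 at least 1/2 this leaves \<open>- (1 + K1 + k)\<close>, where 1 pays
    for cos^2, \<open>K1\<close> for the drift and \<open>k\<close> for the slope of the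
    line.\<close>
  define \<mu> where "\<mu> = - K2 - 2 * (1 + K1 + k)"
  show thesis
  proof (rule that[of \<mu>])
    fix T assume T: "angle_sol (\<lambda>_. 1) (\<lambda>x. \<mu> - c x) p T a b" and Ta: "T a \<le> pi / 2"
    have "T b \<le> pi / 2 + (- k) * (b - a)"
    proof (rule angle_linear_le[OF T _ Ta])
      fix x assume x: "x \<in> {a..b}"
      define v where "v = pi / 2 + (- k) * (x - a)"
      have "k * (x - a) \<le> k * (b - a)" using x k by (intro mult_left_mono) auto
      also have "k * (b - a) = pi / 4"
        using ab nonzero_eq_divide_eq[of "b - a" k "pi / 4"] by (simp only: k_def) auto
      finally have v: "pi / 4 \<le> v" "v \<le> pi / 2" using x k by (auto simp: v_def)
      have "sin (pi / 4) \<le> sin v" using v by (intro sin_monotone_2pi_le) auto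
      hence "(sin (pi / 4))\<^sup>2 \<le> (sin v)\<^sup>2" by (intro power_mono) (auto simp: sin_45)
      hence s: "1 / 2 \<le> (sin v)\<^sup>2" by (simp add: sin_45 power_divide)
      have "\<mu> - c x \<le> - 2 * (1 + K1 + k)" using K2(2)[OF x] by (auto simp: \<mu>_def)
      hence "(\<mu> - c x) * (sin v)\<^sup>2 \<le> - 2 * (1 + K1 + k) * (sin v)\<^sup>2" by (intro mult_right_mono) auto
      also have "\<dots> \<le> - 2 * (1 + K1 + k) * (1 / 2)" using s k K1 by (intro mult_left_mono_neg) auto
      finally have 1: "(\<mu> - c x) * (sin v)\<^sup>2 \<le> - (1 + K1 + k)" by simp
      have "\<bar>p x * (sin v * cos v)\<bar> \<le> K1 * 1"
        unfolding abs_mult[of "p x"] using K1 x abs_sin_cos_le_one[of v] by (intro mult_mono) auto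
      moreover have "(cos v)\<^sup>2 \<le> 1" by (simp add: abs_square_le_1)
      ultimately show "fld (\<lambda>_. 1) (\<lambda>x. \<mu> - c x) p x (pi / 2 + (- k) * (x - a)) \<le> - k"
        using 1 unfolding fld_def v_def[symmetric] by simp
    qed (use ab in auto)
    also have "\<dots> \<le> pi / 2" using k ab by simp
    finally show "T b \<le> pi / 2" .
  qed
qed

section \<open>Shooting for the principal eigenvalue\<close>

lemma angle_mono_spectral_parameter:
  assumes T: "angle_sol A B q T u v" and T': "angle_sol A B' q T' u v"
    and le: "\<And>x. x \<in> {u..v} \<Longrightarrow> B x \<le> B' x" and init: "T u \<le> T' u" and x: "x \<in> {u..v}"
  shows "T x \<le> T' x"
proof (rule angle_le[OF T, where V=T' and V'="\<lambda>x. fld A B' q x (T' x)"])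
  fix y assume y: "y \<in> {u..v}"
  show "(T' has_real_derivative fld A B' q y (T' y)) (at y within {u..v})"
    using T' y by (auto simp: angle_sol_def)
  show "fld A B q y (T' y) \<le> fld A B' q y (T' y)"
    unfolding fld_def using le[OF y] by (intro add_left_mono mult_right_mono) auto
qed (use init x in auto)

text \<open>The terminal angle depends continuously on the spectral parameter and passes from at
  most pi/2 to at least pi, so it hits the target, which lies in [pi/2, pi]. The Wronskian argument
  then resolves the definite description.\<close>

lemma principal_eigenvalue_via_angle:
  assumes ab: "a < b" and L: "admissible_bc L" and R: "admissible_bc R"
    and cp: "continuous_on {a..b} p" and cc: "continuous_on {a..b} c"
  obtains \<mu> T where "principal_eigenvalue p c L R a b = \<mu>"
    "angle_sol (\<lambda>_. 1) (\<lambda>x. \<mu> - c x) p T a b" "T a = bdry_angle L" "T b = pi - bdry_angle R"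
proof -
  have cB: "continuous_on {a..b} (\<lambda>x. \<mu> - c x)" for \<mu> by (intro continuous_intros cc)
  have "\<exists>T. T a = bdry_angle L \<and> angle_sol (\<lambda>_. 1) (\<lambda>x. \<mu> - c x) p T a b" for \<mu>
    using angle_sol_exists[OF less_imp_le[OF ab] continuous_on_const[of _ 1] cB cp] by metis
  then obtain S where Sa: "\<And>\<mu>. S \<mu> a = bdry_angle L"
    and S: "\<And>\<mu>. angle_sol (\<lambda>_. 1) (\<lambda>x. \<mu> - c x) p (S \<mu>) a b" by metis
  obtain \<mu>1 where \<mu>1: "S \<mu>1 b \<ge> pi"
    using angle_large_spectral_parameter[OF ab cp cc] S Sa bdry_angle_bounds[OF L] by metis
  obtain \<mu>0 where \<mu>0: "S \<mu>0 b \<le> pi / 2"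
    using angle_small_spectral_parameter[OF ab cp cc] S Sa bdry_angle_bounds[OF L] by metis
  have mono: "S \<mu> b \<le> S \<nu> b" if "\<mu> \<le> \<nu>" for \<mu> \<nu>
    using angle_mono_spectral_parameter[OF S[of \<mu>] S[of \<nu>], of b] that Sa ab by auto
  have "\<mu>0 \<le> \<mu>1"
  proof (rule ccontr)
    assume "\<not> \<mu>0 \<le> \<mu>1"
    hence "S \<mu>1 b \<le> S \<mu>0 b" by (intro mono) auto
    thus False using \<mu>0 \<mu>1 pi_gt_zero by linarith
  qed
  have "isCont (\<lambda>\<mu>. S \<mu> b) \<mu>" for \<mu>
  proof -
    obtain C where C: "C > 0"
      "\<And>T V B' D. \<lbrakk>angle_sol (\<lambda>_. 1) (\<lambda>x. \<mu> - c x) p T a b; angle_sol (\<lambda>_. 1) B' p V a b;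
        \<And>x. x \<in> {a..b} \<Longrightarrow> \<bar>B' x - (\<mu> - c x)\<bar> \<le> D; \<bar>T a - V a\<bar> \<le> D\<rbrakk> \<Longrightarrow> \<bar>T b - V b\<bar> \<le> C * D"
      using angle_perturbation[OF less_imp_le[OF ab] continuous_on_const[of _ 1] cB cp] by metis
    have le: "\<bar>S \<nu> b - S \<mu> b\<bar> \<le> C * \<bar>\<nu> - \<mu>\<bar>" for \<nu>
      using C(2)[OF S[of \<mu>] S[of \<nu>], of "\<bar>\<nu> - \<mu>\<bar>"] by (auto simp: Sa)
    have lim: "((\<lambda>\<nu>. C * \<bar>\<nu> - \<mu>\<bar>) \<longlongrightarrow> 0) (at \<mu>)"
      by (rule tendsto_eq_intros refl)+ simp
    have "((\<lambda>\<nu>. S \<nu> b - S \<mu> b) \<longlongrightarrow> 0) (at \<mu>)"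
      by (rule Lim_null_comparison[OF _ lim]) (use le in \<open>simp add: eventually_at_filter\<close>)
    thus ?thesis unfolding isCont_def by (rule LIM_zero_cancel)
  qed
  hence "continuous_on {\<mu>0..\<mu>1} (\<lambda>\<mu>. S \<mu> b)" by (simp add: continuous_at_imp_continuous_on)
  then obtain \<mu> where \<mu>: "S \<mu> b = pi - bdry_angle R"
    using IVT'[of "\<lambda>\<mu>. S \<mu> b" \<mu>0 "pi - bdry_angle R" \<mu>1] \<mu>0 \<mu>1 \<open>\<mu>0 \<le> \<mu>1\<close> bdry_angle_bounds[OF R] by auto
  obtain \<phi> where \<phi>: "positive_eigenfunction p c L R a b \<mu> \<phi>"
    using angle_imp_positive_eigenfunction[OF ab L R S Sa \<mu>] by blast
  have "principal_eigenvalue p c L R a b = \<mu>"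
    unfolding principal_eigenvalue_def
  proof (rule the_equality)
    fix \<nu> assume "\<exists>\<phi>. positive_eigenfunction p c L R a b \<nu> \<phi>"
    then obtain \<psi> where \<psi>: "positive_eigenfunction p c L R a b \<nu> \<psi>" ..
    show "\<nu> = \<mu>"
      using positive_eigenvalue_not_less[OF ab L R cp \<phi> \<psi>]
        positive_eigenvalue_not_less[OF ab L R cp \<psi> \<phi>] by simp
  qed (use \<phi> in blast)
  thus thesis using that[OF _ S Sa \<mu>] by blast
qed

text \<open>Comparison in the spectral parameter gives weak inequalities. They become strict because
  equal terminal angles would provide positive eigenfunctions for both values.\<close>

lemma principal_eigenvalue_less_iff:
  assumes ab: "a < b" and L: "admissible_bc L" and R: "admissible_bc R"
    and T: "angle_sol (\<lambda>_. 1) (\<lambda>x. \<nu> - c x) p T a b" and Ta: "T a = bdry_angle L"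
  shows "\<nu> < principal_eigenvalue p c L R a b \<longleftrightarrow> T b < pi - bdry_angle R"
    and "principal_eigenvalue p c L R a b < \<nu> \<longleftrightarrow> pi - bdry_angle R < T b"
proof -
  have cp: "continuous_on {a..b} p" and cB: "continuous_on {a..b} (\<lambda>x. \<nu> - c x)"
    using T by (auto simp: angle_sol_def)
  have cc: "continuous_on {a..b} c"
    using continuous_on_diff[OF continuous_on_const[of _ \<nu>] cB] by simp
  obtain \<mu> S where \<mu>: "principal_eigenvalue p c L R a b = \<mu>" and S: "angle_sol (\<lambda>_. 1) (\<lambda>x. \<mu> - c x) p S a b"
    and Sa: "S a = bdry_angle L" and Sb: "S b = pi - bdry_angle R"
    using principal_eigenvalue_via_angle[OF ab L R cp cc] by metis
  have le: "\<nu> \<le> \<mu> \<Longrightarrow> T b \<le> S b"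
    using angle_mono_spectral_parameter[OF T S, of b] Ta Sa ab by auto
  have ge: "\<mu> \<le> \<nu> \<Longrightarrow> S b \<le> T b"
    using angle_mono_spectral_parameter[OF S T, of b] Ta Sa ab by auto
  have eq: "\<mu> = \<nu>" if Tb: "T b = S b"
  proof -
    obtain \<phi> where \<phi>: "positive_eigenfunction p c L R a b \<mu> \<phi>"
      using angle_imp_positive_eigenfunction[OF ab L R S Sa Sb] by blast
    obtain \<psi> where \<psi>: "positive_eigenfunction p c L R a b \<nu> \<psi>"
      using angle_imp_positive_eigenfunction[OF ab L R T Ta] Tb Sb by auto
    show ?thesis
      using positive_eigenvalue_not_less[OF ab L R cp \<phi> \<psi>]
        positive_eigenvalue_not_less[OF ab L R cp \<psi> \<phi>] by simp
  qed
  show "\<nu> < principal_eigenvalue p c L R a b \<longleftrightarrow> T b < pi - bdry_angle R"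
    and "principal_eigenvalue p c L R a b < \<nu> \<longleftrightarrow> pi - bdry_angle R < T b"
    unfolding \<mu> Sb[symmetric] using le ge eq by (smt (verit))+
qed

subsection \<open>Families of angles as the advection grows\<close>

definition gradient_on01 :: "(real \<Rightarrow> real) \<Rightarrow> (real \<Rightarrow> real) \<Rightarrow> bool" where
  "gradient_on01 m m' \<longleftrightarrow>
     (\<forall>x\<in>{0..1}. (m has_real_derivative m' x) (at x within {0..1})) \<and> continuous_on {0..1} m'"

text \<open>\<open>K\<close> bounds the coefficients that do not grow with s; it measures every
  error in the limit estimates.\<close>

definition angle_family ::
  "(real \<Rightarrow> real) \<Rightarrow> (real \<Rightarrow> real) \<Rightarrow> (real \<Rightarrow> real) \<Rightarrow> real \<Rightarrow> (real \<Rightarrow> real \<Rightarrow> real) \<Rightarrow> bool" where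
  "angle_family A B m' K T \<longleftrightarrow>
     (\<forall>s. angle_sol A B (\<lambda>x. 2 * s * m' x) (T s) 0 1) \<and>
     (\<forall>x\<in>{0..1}. \<bar>A x\<bar> \<le> K \<and> \<bar>B x\<bar> \<le> K) \<and> K > 0"

text \<open>An upper bound for the limes superior as s tends to infinity, free of extended reals and
  of boundedness conditions.\<close>

definition limsup_le :: "(real \<Rightarrow> real \<Rightarrow> real) \<Rightarrow> real \<Rightarrow> real \<Rightarrow> bool" where
  "limsup_le T x \<alpha> \<longleftrightarrow> (\<forall>e>0. \<forall>\<^sub>F s in at_top. T s x \<le> \<alpha> + e)"

definition liminf_ge :: "(real \<Rightarrow> real \<Rightarrow> real) \<Rightarrow> real \<Rightarrow> real \<Rightarrow> bool" where
  "liminf_ge T x \<alpha> \<longleftrightarrow> (\<forall>e>0. \<forall>\<^sub>F s in at_top. \<alpha> - e \<le> T s x)"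

lemma gradient_on01_uminus: "gradient_on01 m m' \<Longrightarrow> gradient_on01 (\<lambda>x. - m x) (\<lambda>x. - m' x)"
  unfolding gradient_on01_def by (auto intro!: continuous_intros derivative_eq_intros)

lemma gradient_subset:
  assumes "gradient_on01 m m'" "0 \<le> a" "b \<le> 1" "x \<in> {a..b}"
  shows "(m has_real_derivative m' x) (at x within {a..b})"
proof -
  have "{a..b} \<subseteq> {0..1}" "x \<in> {0..1}" using assms by auto
  thus ?thesis using assms(1) unfolding gradient_on01_def by (meson DERIV_subset)
qed

lemma gradient_at:
  assumes "gradient_on01 m m'" "0 < x" "x < 1"
  shows "(m has_real_derivative m' x) (at x)"
  using gradient_subset[OF assms(1), of 0 1 x] at_within_Icc_at[of 0 x 1] assms by auto

lemma gradient_continuous: "gradient_on01 m m' \<Longrightarrow> continuous_on {0..1} m"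
  unfolding gradient_on01_def by (meson DERIV_continuous continuous_on_eq_continuous_within)

lemma gradient_nonneg_imp_le:
  assumes m: "gradient_on01 m m'" and "0 \<le> a" "a \<le> b" "b \<le> 1"
    and nn: "\<And>x. x \<in> {a..b} \<Longrightarrow> m' x \<ge> 0"
  shows "m a \<le> m b"
proof (rule DERIV_nonneg_imp_increasing_open[OF \<open>a \<le> b\<close>])
  show "continuous_on {a..b} m"
    using gradient_continuous[OF m] assms by (auto intro: continuous_on_subset)
  fix x assume "a < x" "x < b"
  thus "\<exists>y. (m has_real_derivative y) (at x) \<and> 0 \<le> y"
    using gradient_at[OF m, of x] nn[of x] assms by auto
qed

lemma angle_familyD:
  assumes "angle_family A B m' K T"
  shows "angle_sol A B (\<lambda>x. 2 * s * m' x) (T s) 0 1" "K > 0"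
    "x \<in> {0..1} \<Longrightarrow> \<bar>A x\<bar> \<le> K" "x \<in> {0..1} \<Longrightarrow> \<bar>B x\<bar> \<le> K"
  using assms by (auto simp: angle_family_def)

lemma angle_family_reflect:
  assumes "angle_family A B m' K T"
  shows "angle_family (\<lambda>x. - A x) (\<lambda>x. - B x) m' K (\<lambda>s x. pi - T s x)"
  using assms angle_sol_reflect unfolding angle_family_def by auto

lemma angle_family_shift:
  assumes "angle_family A B m' K T"
  shows "angle_family B A (\<lambda>x. - m' x) K (\<lambda>s x. T s x + pi / 2)"
  using assms angle_sol_shift[of A B "\<lambda>x. 2 * _ * m' x"] unfolding angle_family_def by auto

lemma limsup_le_reflect: "limsup_le (\<lambda>s x. pi - T s x) x (pi - \<alpha>) \<longleftrightarrow> liminf_ge T x \<alpha>"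
  unfolding limsup_le_def liminf_ge_def by (simp add: algebra_simps)

lemma limsup_le_shift: "limsup_le (\<lambda>s x. T s x + d) x (\<alpha> + d) \<longleftrightarrow> limsup_le T x \<alpha>"
  unfolding limsup_le_def by (simp add: algebra_simps)

lemma limsup_leD: "limsup_le T x \<alpha> \<Longrightarrow> \<alpha> < \<beta> \<Longrightarrow> \<forall>\<^sub>F s in at_top. T s x \<le> \<beta>"
  unfolding limsup_le_def by (metis diff_gt_0_iff_gt add_diff_cancel_left' add.commute diff_add_cancel)

lemma liminf_geD: "liminf_ge T x \<alpha> \<Longrightarrow> \<beta> < \<alpha> \<Longrightarrow> \<forall>\<^sub>F s in at_top. \<beta> \<le> T s x"
  unfolding liminf_ge_def by (metis diff_gt_0_iff_gt diff_diff_eq2 add_diff_cancel_left')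

lemma limsup_leI: "(\<And>\<beta>. \<alpha> < \<beta> \<Longrightarrow> \<forall>\<^sub>F s in at_top. T s x \<le> \<beta>) \<Longrightarrow> limsup_le T x \<alpha>"
  unfolding limsup_le_def by simp

lemma liminf_geI: "(\<And>\<beta>. \<beta> < \<alpha> \<Longrightarrow> \<forall>\<^sub>F s in at_top. \<beta> \<le> T s x) \<Longrightarrow> liminf_ge T x \<alpha>"
  unfolding liminf_ge_def by simp

lemma limsup_le_mono: "limsup_le T x \<alpha> \<Longrightarrow> \<alpha> \<le> \<beta> \<Longrightarrow> limsup_le T x \<beta>"
  by (rule limsup_leI) (use limsup_leD in force)

lemma liminf_ge_mono: "liminf_ge T x \<alpha> \<Longrightarrow> \<beta> \<le> \<alpha> \<Longrightarrow> liminf_ge T x \<beta>"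
  by (rule liminf_geI) (use liminf_geD in force)

section \<open>Attraction under monotone drift\<close>

lemma times_cos_le_sin:
  fixes v :: real
  assumes "0 \<le> v" "v \<le> pi"
  shows "v * cos v \<le> sin v"
proof -
  have "sin 0 - 0 * cos 0 \<le> sin v - v * cos v"
  proof (rule DERIV_nonneg_imp_nondecreasing[of 0 v "\<lambda>x. sin x - x * cos x"])
    fix x assume x: "0 \<le> x" "x \<le> v"
    have "((\<lambda>x. sin x - x * cos x) has_real_derivative x * sin x) (at x)"
      by (auto intro!: derivative_eq_intros)
    moreover have "x * sin x \<ge> 0" using x assms by (simp add: sin_ge_zero)
    ultimately show "\<exists>y. ((\<lambda>x. sin x - x * cos x) has_real_derivative y) (at x) \<and> 0 \<le> y" by blast
  qed fact
  thus ?thesis by simp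
qed

lemma fld_near_half_pi:
  "fld A B q x (pi / 2 + v) = A x * (sin v)\<^sup>2 - q x * (sin v * cos v) + B x * (cos v)\<^sup>2"
  by (simp add: fld_def sin_add cos_add)

lemma convex_comb_le:
  fixes a b K v :: real
  assumes "\<bar>a\<bar> \<le> K" "\<bar>b\<bar> \<le> K"
  shows "a * (sin v)\<^sup>2 + b * (cos v)\<^sup>2 \<le> K"
proof -
  have "a * (sin v)\<^sup>2 + b * (cos v)\<^sup>2 \<le> K * (sin v)\<^sup>2 + K * (cos v)\<^sup>2"
    using assms by (intro add_mono mult_right_mono) auto
  also have "\<dots> = K" by (simp flip: distrib_left)
  finally show ?thesis .
qed

text \<open>With \<open>\<theta> = \<pi>/2 + v\<close> and \<open>sin v cos v \<ge> v sin\<^sup>2 d\<close> for \<open>0 \<le> v \<le> \<pi>/2 - d\<close>, the barrier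
  is a supersolution of the linear equation \<open>v' = K - q v sin\<^sup>2 d\<close>.\<close>

lemma angle_attracted:
  assumes T: "angle_sol A B q T y x" and yx: "y \<le> x"
    and Q: "\<And>t. t \<in> {y..x} \<Longrightarrow> (Q has_real_derivative q t) (at t within {y..x})"
    and q: "\<And>t. t \<in> {y..x} \<Longrightarrow> q t \<ge> 0"
    and K: "\<And>t. t \<in> {y..x} \<Longrightarrow> \<bar>A t\<bar> \<le> K \<and> \<bar>B t\<bar> \<le> K" "K \<ge> 0"
    and w: "0 \<le> w" "w + K * (x - y) \<le> pi / 2 - d" and d: "0 < d"
    and init: "T y \<le> pi / 2 + w"
  shows "T x \<le> pi / 2 + w * exp (- (sin d)\<^sup>2 * (Q x - Q y)) + K * (x - y)"
proof -
  have d2: "d \<le> pi / 2" using w K(2) yx mult_nonneg_nonneg[of K "x - y"] by linarith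
  have Qmono: "Q y \<le> Q t" if t: "t \<in> {y..x}" for t
  proof (rule DERIV_nonneg_imp_increasing_open[where f=Q])
    show "y \<le> t" using t by simp
    have "continuous_on {y..x} Q"
      using Q by (meson DERIV_continuous continuous_on_eq_continuous_within)
    thus "continuous_on {y..t} Q" by (rule continuous_on_subset) (use t in auto)
    fix u assume "y < u" "u < t"
    thus "\<exists>l. (Q has_real_derivative l) (at u) \<and> 0 \<le> l"
      using Q[of u] q[of u] t at_within_Icc_at[of y u x] by auto
  qed
  define \<kappa> where "\<kappa> = (sin d)\<^sup>2"
  define E where "E t = w * exp (- \<kappa> * (Q t - Q y))" for t
  have E: "0 \<le> E t" "E t \<le> w" if "t \<in> {y..x}" for t
  proof -
    show "0 \<le> E t" using w by (simp add: E_def)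
    have "exp (- \<kappa> * (Q t - Q y)) \<le> 1" using Qmono[OF that] by (simp add: \<kappa>_def)
    hence "w * exp (- \<kappa> * (Q t - Q y)) \<le> w * 1" using w by (intro mult_left_mono) auto
    thus "E t \<le> w" by (simp add: E_def)
  qed
  have "T x \<le> pi / 2 + (E x + K * (x - y))"
  proof (rule angle_le[OF T, where V'="\<lambda>t. - \<kappa> * q t * E t + K"])
    fix t assume t: "t \<in> {y..x}"
    show "((\<lambda>t. pi / 2 + (E t + K * (t - y))) has_real_derivative - \<kappa> * q t * E t + K) (at t within {y..x})"
      unfolding E_def using Q[OF t] by (auto intro!: derivative_eq_intros)
    define v where "v = E t + K * (t - y)"
    have "K * (t - y) \<le> K * (x - y)" using t K by (intro mult_left_mono) auto
    hence v: "E t \<le> v" "0 \<le> v" "v \<le> pi / 2 - d"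
      using E[OF t] w t K by (auto simp: v_def)
    have "sin d \<le> cos v"
      using v d d2 cos_monotone_0_pi_le[of v "pi / 2 - d"] by (simp add: cos_diff)
    moreover have "sin d \<ge> 0" using d d2 by (intro sin_ge_zero) auto
    ultimately have "\<kappa> \<le> (cos v)\<^sup>2" unfolding \<kappa>_def by (intro power_mono) auto
    hence "\<kappa> * v \<le> (cos v)\<^sup>2 * v" using v by (intro mult_right_mono) auto
    also have "\<dots> = v * cos v * cos v" by (simp add: power2_eq_square)
    also have "\<dots> \<le> sin v * cos v"
      using times_cos_le_sin[of v] v d cos_ge_zero[of v] by (intro mult_right_mono) auto
    finally have "\<kappa> * E t \<le> sin v * cos v"
      using mult_left_mono[OF v(1), of \<kappa>] by (auto simp: \<kappa>_def)
    hence "q t * (\<kappa> * E t) \<le> q t * (sin v * cos v)" using q[OF t] by (intro mult_left_mono)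
    moreover have "A t * (sin v)\<^sup>2 + B t * (cos v)\<^sup>2 \<le> K" using K(1)[OF t] by (intro convex_comb_le) auto
    ultimately show "fld A B q t (pi / 2 + (E t + K * (t - y))) \<le> - \<kappa> * q t * E t + K"
      unfolding v_def[symmetric] fld_near_half_pi by (simp add: mult_ac)
  qed (use init yx in \<open>auto simp: E_def\<close>)
  thus ?thesis by (simp add: E_def \<kappa>_def)
qed

text \<open>The drift never pushes an angle in [pi/2, pi) further up, so the bound grows by at most
  \<open>K * (x - y)\<close> along the stretch. If m really increases, the initial excess over pi/2
  is moreover damped by a factor exponentially small in s.\<close>

lemma limsup_le_drift_up:
  assumes fam: "angle_family A B m' K T" and m: "gradient_on01 m m'"
    and yx: "0 \<le> y" "y \<le> x" "x \<le> 1" and nn: "\<And>t. t \<in> {y..x} \<Longrightarrow> m' t \<ge> 0"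
    and ub: "limsup_le T y \<alpha>" and \<alpha>: "pi / 2 \<le> \<alpha>" "\<alpha> + K * (x - y) < pi"
  shows "limsup_le T x (\<alpha> + K * (x - y))"
    and "m y < m x \<Longrightarrow> limsup_le T x (pi / 2 + K * (x - y))"
proof -
  \<comment> \<open>The argument of sin is the distance from pi to the highest point of the barrier;
    it is positive by the choice of \<open>e\<close>.\<close>
  have core: "\<forall>\<^sub>F s in at_top. s \<ge> 0 \<and>
      T s x \<le> pi / 2 + (\<alpha> + e - pi / 2) * exp (- (sin (pi - (\<alpha> + e) - K * (x - y)))\<^sup>2 * (2 * s * (m x - m y))) + K * (x - y)"
    if e: "0 < e" "\<alpha> + e + K * (x - y) < pi" for e
  proof -
    have "\<forall>\<^sub>F s in at_top. T s y \<le> \<alpha> + e" using e by (intro limsup_leD[OF ub]) simp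
    with eventually_ge_at_top[of 0] show ?thesis
    proof eventually_elim
      case (elim s)
      have "T s x \<le> pi / 2 + (\<alpha> + e - pi / 2) * exp (- (sin (pi - (\<alpha> + e) - K * (x - y)))\<^sup>2 * (2 * s * m x - 2 * s * m y)) + K * (x - y)"
      proof (rule angle_attracted[OF angle_sol_subset[OF angle_familyD(1)[OF fam]]])
        fix t assume t: "t \<in> {y..x}"
        show "((\<lambda>x. 2 * s * m x) has_real_derivative 2 * s * m' t) (at t within {y..x})"
          using gradient_subset[OF m _ _ t] yx by (auto intro!: derivative_eq_intros)
        show "0 \<le> 2 * s * m' t" using elim nn[OF t] by simp
        show "\<bar>A t\<bar> \<le> K \<and> \<bar>B t\<bar> \<le> K" using angle_familyD[OF fam] t yx by auto
      qed (use yx e elim \<alpha> angle_familyD(2)[OF fam] in auto)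
      thus ?case using elim by (simp add: algebra_simps)
    qed
  qed
  have mle: "m y \<le> m x" using gradient_nonneg_imp_le[OF m yx nn] .
  show "limsup_le T x (\<alpha> + K * (x - y))"
  proof (rule limsup_leI)
    fix \<beta> assume \<beta>: "\<alpha> + K * (x - y) < \<beta>"
    define e where "e = min (\<beta> - (\<alpha> + K * (x - y))) ((pi - (\<alpha> + K * (x - y))) / 2)"
    have e: "0 < e" "\<alpha> + e + K * (x - y) < pi" "\<alpha> + e + K * (x - y) \<le> \<beta>"
      using \<beta> \<alpha> unfolding e_def by (auto simp: min_def field_simps)
    show "\<forall>\<^sub>F s in at_top. T s x \<le> \<beta>"
      using core[OF e(1,2)]
    proof eventually_elim
      case (elim s)
      let ?x = "exp (- (sin (pi - (\<alpha> + e) - K * (x - y)))\<^sup>2 * (2 * s * (m x - m y)))"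
      have "?x \<le> 1" using elim mle by simp
      hence "(\<alpha> + e - pi / 2) * ?x \<le> (\<alpha> + e - pi / 2) * 1"
        using e \<alpha> by (intro mult_left_mono) auto
      thus ?case using elim e by simp
    qed
  qed
  assume less: "m y < m x"
  show "limsup_le T x (pi / 2 + K * (x - y))"
  proof (rule limsup_leI)
    fix \<beta> assume \<beta>: "pi / 2 + K * (x - y) < \<beta>"
    define e where "e = (pi - (\<alpha> + K * (x - y))) / 2"
    have e: "0 < e" "\<alpha> + e + K * (x - y) < pi" using \<alpha> unfolding e_def by (auto simp: field_simps)
    define k where "k = (sin (pi - (\<alpha> + e) - K * (x - y)))\<^sup>2 * (2 * (m x - m y))"
    have "K * (x - y) \<ge> 0" using angle_familyD(2)[OF fam] yx by simp
    hence "sin (pi - (\<alpha> + e) - K * (x - y)) > 0"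
      using e \<alpha> by (intro sin_gt_zero) linarith+
    hence k: "k > 0" using less by (simp add: k_def)
    have "filterlim (\<lambda>s. - k * s) at_bot at_top"
      using k filterlim_tendsto_neg_mult_at_bot[OF tendsto_const _ filterlim_ident, of "-k"] by simp
    hence "((\<lambda>s. (\<alpha> + e - pi / 2) * exp (- k * s)) \<longlongrightarrow> (\<alpha> + e - pi / 2) * 0) at_top"
      by (intro tendsto_mult tendsto_const filterlim_compose[OF exp_at_bot])
    hence "\<forall>\<^sub>F s in at_top. (\<alpha> + e - pi / 2) * exp (- k * s) < \<beta> - (pi / 2 + K * (x - y))"
      using \<beta> by (intro order_tendstoD(2)[of _ 0]) auto
    with core[OF e] show "\<forall>\<^sub>F s in at_top. T s x \<le> \<beta>"
    proof eventually_elim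
      case (elim s)
      have eq: "- (sin (pi - (\<alpha> + e) - K * (x - y)))\<^sup>2 * (2 * s * (m x - m y)) = - k * s"
        by (simp add: k_def)
      show ?case using elim(1)[unfolded eq] elim(2) by linarith
    qed
  qed
qed

text \<open>Restart at a \<open>y\<close> so close to \<open>x\<close> that
  \<open>K * (x - y)\<close> is small. Strict increase of m up to \<open>x\<close> still gives the
  full damping between \<open>y\<close> and \<open>x\<close>.\<close>

lemma limsup_le_increase:
  assumes fam: "angle_family A B m' K T" and m: "gradient_on01 m m'"
    and zx: "0 \<le> z" "z < x" "x \<le> 1" and nn: "\<And>t. t \<in> {z..x} \<Longrightarrow> m' t \<ge> 0"
    and strict: "\<And>t. t \<in> {z..<x} \<Longrightarrow> m t < m x"
    and ub: "limsup_le T z \<alpha>" and \<alpha>: "pi / 2 \<le> \<alpha>" "\<alpha> + K * (x - z) < pi"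
  shows "limsup_le T x (pi / 2)"
proof (rule limsup_leI)
  fix \<beta> assume \<beta>: "pi / 2 < \<beta>"
  have K: "K > 0" by (rule angle_familyD(2)[OF fam])
  define y where "y = max z (x - (\<beta> - pi / 2) / (2 * K))"
  have "(\<beta> - pi / 2) / (2 * K) > 0" using \<beta> K by simp
  hence y: "z \<le> y" "y < x" "x - y \<le> (\<beta> - pi / 2) / (2 * K)" using zx by (auto simp: y_def)
  have "K * (x - y) \<le> K * ((\<beta> - pi / 2) / (2 * K))" using y K by (intro mult_left_mono) auto
  hence Ky: "K * (x - y) \<le> (\<beta> - pi / 2) / 2" using K by simp
  have "K * (y - z) \<le> K * (x - z)" using K y by (intro mult_left_mono) auto
  hence "limsup_le T y (\<alpha> + K * (y - z))"
    using zx y \<alpha> nn by (intro limsup_le_drift_up(1)[OF fam m _ _ _ _ ub]) auto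
  moreover have "\<alpha> + K * (y - z) + K * (x - y) < pi" using \<alpha> by (simp add: algebra_simps)
  moreover have "pi / 2 \<le> \<alpha> + K * (y - z)" using \<alpha> K y by (simp add: add_increasing2)
  ultimately have "limsup_le T x (pi / 2 + K * (x - y))"
    using zx y nn strict[of y] by (intro limsup_le_drift_up(2)[OF fam m, of y]) auto
  thus "\<forall>\<^sub>F s in at_top. T s x \<le> \<beta>" using limsup_leD \<beta> Ky by (auto simp: field_simps)
qed

text \<open>The shift by pi/2 maps the window [0, pi/2) with falling m onto the window [pi/2, pi)
  with rising -m.\<close>

lemma limsup_le_drift_down:
  assumes fam: "angle_family A B m' K T" and m: "gradient_on01 m m'"
    and yx: "0 \<le> y" "y \<le> x" "x \<le> 1" and nn: "\<And>t. t \<in> {y..x} \<Longrightarrow> m' t \<le> 0"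
    and ub: "limsup_le T y \<alpha>" and \<alpha>: "0 \<le> \<alpha>" "\<alpha> + K * (x - y) < pi / 2"
  shows "limsup_le T x (\<alpha> + K * (x - y))"
  using limsup_le_drift_up(1)[OF angle_family_shift[OF fam] gradient_on01_uminus[OF m] yx,
      of "\<alpha> + pi / 2"] nn ub \<alpha> limsup_le_shift[of T "pi / 2" x "\<alpha> + K * (x - y)"]
  by (simp add: limsup_le_shift algebra_simps)

lemma limsup_le_decrease:
  assumes fam: "angle_family A B m' K T" and m: "gradient_on01 m m'"
    and zx: "0 \<le> z" "z < x" "x \<le> 1" and nn: "\<And>t. t \<in> {z..x} \<Longrightarrow> m' t \<le> 0"
    and strict: "\<And>t. t \<in> {z..<x} \<Longrightarrow> m x < m t"
    and ub: "limsup_le T z \<alpha>" and \<alpha>: "0 \<le> \<alpha>" "\<alpha> + K * (x - z) < pi / 2"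
  shows "limsup_le T x 0"
  using limsup_le_increase[OF angle_family_shift[OF fam] gradient_on01_uminus[OF m] zx,
      of "\<alpha> + pi / 2"] nn strict ub \<alpha> limsup_le_shift[of T "pi / 2" x 0]
  by (simp add: limsup_le_shift algebra_simps)

lemma liminf_ge_increase:
  assumes fam: "angle_family A B m' K T" and m: "gradient_on01 m m'"
    and zx: "0 \<le> z" "z < x" "x \<le> 1" and nn: "\<And>t. t \<in> {z..x} \<Longrightarrow> m' t \<ge> 0"
    and strict: "\<And>t. t \<in> {z..<x} \<Longrightarrow> m t < m x"
    and lb: "liminf_ge T z \<alpha>" and \<alpha>: "\<alpha> \<le> pi / 2" "K * (x - z) < \<alpha>"
  shows "liminf_ge T x (pi / 2)"
  using limsup_le_increase[OF angle_family_reflect[OF fam] m zx nn strict, of "pi - \<alpha>"] lb \<alpha>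
    limsup_le_reflect[of T x "pi / 2"] by (simp add: limsup_le_reflect)

lemma liminf_ge_decrease:
  assumes fam: "angle_family A B m' K T" and m: "gradient_on01 m m'"
    and zx: "0 \<le> z" "z < x" "x \<le> 1" and nn: "\<And>t. t \<in> {z..x} \<Longrightarrow> m' t \<le> 0"
    and strict: "\<And>t. t \<in> {z..<x} \<Longrightarrow> m x < m t"
    and lb: "liminf_ge T z \<alpha>" and \<alpha>: "\<alpha> \<le> pi" "pi / 2 + K * (x - z) < \<alpha>"
  shows "liminf_ge T x pi"
  using limsup_le_decrease[OF angle_family_reflect[OF fam] m zx nn strict, of "pi - \<alpha>"] lb \<alpha>
    limsup_le_reflect[of T x pi] by (simp add: limsup_le_reflect)

section \<open>Angles near pi/2 around an isolated maximum\<close>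

lemma times_sin_cos_nonneg:
  fixes q v :: real
  assumes "q * v \<ge> 0" "\<bar>v\<bar> \<le> 1"
  shows "q * (sin v * cos v) \<ge> 0"
proof (cases "v = 0")
  case False
  have c: "cos v \<ge> 0" using assms pi_gt3 by (intro cos_ge_zero) auto
  have sv: "sin v * v \<ge> 0"
    using assms pi_gt3 sin_ge_zero[of v] sin_ge_zero[of "- v"]
    by (cases "v \<ge> 0") (auto simp: zero_le_mult_iff mult_nonpos_nonpos)
  have "q * v * (sin v * v) * cos v \<ge> 0"
    using mult_nonneg_nonneg[OF mult_nonneg_nonneg[OF assms(1) sv] c] .
  hence "(q * (sin v * cos v)) * (v * v) \<ge> 0" by (simp add: mult_ac)
  moreover have "v * v > 0" using False by (simp add: zero_less_mult_iff) linarith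
  ultimately show ?thesis by (simp add: zero_le_mult_iff)
qed simp

text \<open>The hypothesis \<open>q x * v \<ge> 0\<close> gives the drift the helpful sign whatever
  its size, so the estimate is uniform in s. What remains is at most
  \<open>K * e - g * (1 - e)\<close>, and the last condition on \<open>e\<close> brings this below
  \<open>- (k * e)\<close>.\<close>

lemma fld_near_half_pi_le:
  assumes "\<bar>A x\<bar> \<le> K" "B x \<le> - g" "0 \<le> g" "\<bar>v\<bar> \<le> e" "e \<le> 1" "q x * v \<ge> 0"
    and e: "e * (k + K + g) \<le> g"
  shows "fld A B q x (pi / 2 + v) \<le> - (k * e)"
proof -
  have e0: "0 \<le> e" using assms by linarith
  have sq: "(sin v)\<^sup>2 \<le> e * e"
    using sin_cos_small(3)[of v e] assms by (simp add: power2_eq_square)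
  have ee: "e * e \<le> e * 1" using e0 assms by (intro mult_left_mono) auto
  have "A x * (sin v)\<^sup>2 \<le> K * (e * 1)" using assms sq ee by (intro mult_mono) auto
  moreover have "B x * (cos v)\<^sup>2 \<le> - g * (1 - e)"
  proof -
    have "B x * (cos v)\<^sup>2 \<le> - g * (cos v)\<^sup>2" using assms by (intro mult_right_mono) auto
    also have "\<dots> \<le> - g * (1 - e)"
      using sin_cos_small(2)[of v e] assms by (intro mult_left_mono_neg) auto
    finally show ?thesis .
  qed
  moreover have "q x * (sin v * cos v) \<ge> 0" using assms by (intro times_sin_cos_nonneg) auto
  ultimately show ?thesis using e unfolding fld_near_half_pi by (simp add: algebra_simps)
qed

text \<open>Past a maximum the drift repels from pi/2, and below pi/2 this helps the descent. The
  line of slope \<open>- e\<close> with \<open>e = g / (1 + K + g)\<close> is thus a supersolution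
  for all \<open>s \<ge> 0\<close>, and a gap below pi/2 independent of s opens up.\<close>

lemma eventually_le_past_maximum:
  assumes fam: "angle_family A B m' K T"
    and xy: "0 \<le> x" "x \<le> y" "y \<le> 1" and nn: "\<And>t. t \<in> {x..y} \<Longrightarrow> m' t \<le> 0"
    and B: "\<And>t. t \<in> {x..y} \<Longrightarrow> B t \<le> - g" and g: "g > 0"
    and init: "\<forall>\<^sub>F s in at_top. T s x \<le> pi / 2"
  shows "\<forall>\<^sub>F s in at_top. T s y \<le> pi / 2 - g / (1 + K + g) * (y - x)"
  using eventually_ge_at_top[of 0] init
proof eventually_elim
  case (elim s)
  define e where "e = g / (1 + K + g)"
  have K: "K > 0" by (rule angle_familyD(2)[OF fam])
  have e: "0 < e" "e \<le> 1" "e * (1 + K + g) = g" using K g by (auto simp: e_def field_simps)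
  have "T s y \<le> pi / 2 + (- e) * (y - x)"
  proof (rule angle_linear_le[OF angle_sol_subset[OF angle_familyD(1)[OF fam]] _ elim(2)])
    fix t assume t: "t \<in> {x..y}"
    have "e * (t - x) \<le> e * 1" using e t xy by (intro mult_left_mono) auto
    moreover have "2 * s * m' t * (- e * (t - x)) \<ge> 0"
      using elim nn[OF t] e t by (simp add: mult_nonneg_nonpos mult_nonpos_nonpos zero_le_mult_iff mult_le_0_iff)
    ultimately have "fld A B (\<lambda>x. 2 * s * m' x) t (pi / 2 + (- e) * (t - x)) \<le> - (1 * e)"
      using angle_familyD(3)[OF fam, of t] t xy B[OF t] g e
      by (intro fld_near_half_pi_le[where K=K and g=g]) (auto simp: abs_mult)
    thus "fld A B (\<lambda>x. 2 * s * m' x) t (pi / 2 + (- e) * (t - x)) \<le> - e" by simp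
  qed (use xy in auto)
  thus ?case by (simp add: e_def)
qed

text \<open>Turns an asymptotic bound at \<open>y\<close> into an exact one at \<open>x\<close>: the
  barrier starts at pi/2 + e and comes down precisely to pi/2 at \<open>x\<close>. It stays above
  pi/2, where the drift attracts and does no harm.\<close>

lemma eventually_le_before_maximum:
  assumes fam: "angle_family A B m' K T"
    and yx: "0 \<le> y" "y < x" "x \<le> 1" and nn: "\<And>t. t \<in> {y..x} \<Longrightarrow> m' t \<ge> 0"
    and B: "\<And>t. t \<in> {y..x} \<Longrightarrow> B t \<le> - g" and g: "g > 0"
    and ub: "limsup_le T y (pi / 2)"
  shows "\<forall>\<^sub>F s in at_top. T s x \<le> pi / 2"
proof -
  \<comment> \<open>The slope is \<open>- (k * e)\<close>, so that the height e is used up over the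
    length \<open>x - y\<close>.\<close>
  define k where "k = 1 / (x - y)"
  have k: "k > 0" "k * (x - y) = 1" using yx by (auto simp: k_def)
  have K: "K > 0" by (rule angle_familyD(2)[OF fam])
  define e where "e = g / (1 + k + K + g)"
  have e: "0 < e" "e \<le> 1" "e * (1 + k + K + g) = g" using K g k by (auto simp: e_def field_simps)
  have e': "e * (k + K + g) \<le> g" using e by (simp add: algebra_simps)
  have "\<forall>\<^sub>F s in at_top. T s y \<le> pi / 2 + e" using e by (intro limsup_leD[OF ub]) simp
  with eventually_ge_at_top[of 0] show ?thesis
  proof eventually_elim
    case (elim s)
    have "T s x \<le> (pi / 2 + e) + (- (k * e)) * (x - y)"
    proof (rule angle_linear_le[OF angle_sol_subset[OF angle_familyD(1)[OF fam]] _ elim(2)])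
      fix t assume t: "t \<in> {y..x}"
      have "k * (t - y) \<le> k * (x - y)" using t k by (intro mult_left_mono) auto
      hence kt: "0 \<le> 1 - k * (t - y)" "1 - k * (t - y) \<le> 1" using k t by auto
      define v where "v = e * (1 - k * (t - y))"
      have v: "0 \<le> v" "v \<le> e" using kt e mult_left_mono[OF kt(2), of e] by (auto simp: v_def)
      have "fld A B (\<lambda>x. 2 * s * m' x) t (pi / 2 + v) \<le> - (k * e)"
        using angle_familyD(3)[OF fam, of t] t yx B[OF t] g e e' v elim nn[OF t]
        by (intro fld_near_half_pi_le[where K=K and g=g]) auto
      moreover have "pi / 2 + v = (pi / 2 + e) + (- (k * e)) * (t - y)" by (simp add: v_def algebra_simps)
      ultimately show "fld A B (\<lambda>x. 2 * s * m' x) t (pi / 2 + e + - (k * e) * (t - y)) \<le> - (k * e)" by simp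
    qed (use yx in auto)
    also have "\<dots> = pi / 2" using k(2) by (simp add: algebra_simps)
    finally show ?case .
  qed
qed

lemma eventually_ge_past_maximum:
  assumes fam: "angle_family A B m' K T"
    and xy: "0 \<le> x" "x \<le> y" "y \<le> 1" and nn: "\<And>t. t \<in> {x..y} \<Longrightarrow> m' t \<le> 0"
    and B: "\<And>t. t \<in> {x..y} \<Longrightarrow> B t \<ge> g" and g: "g > 0"
    and init: "\<forall>\<^sub>F s in at_top. T s x \<ge> pi / 2"
  shows "\<forall>\<^sub>F s in at_top. T s y \<ge> pi / 2 + g / (1 + K + g) * (y - x)"
proof -
  have "\<forall>\<^sub>F s in at_top. pi - T s y \<le> pi / 2 - g / (1 + K + g) * (y - x)"
    using init by (intro eventually_le_past_maximum[OF angle_family_reflect[OF fam] xy nn _ g])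
      (auto simp: B elim!: eventually_mono)
  thus ?thesis by eventually_elim simp
qed

lemma eventually_ge_before_maximum:
  assumes fam: "angle_family A B m' K T"
    and yx: "0 \<le> y" "y < x" "x \<le> 1" and nn: "\<And>t. t \<in> {y..x} \<Longrightarrow> m' t \<ge> 0"
    and B: "\<And>t. t \<in> {y..x} \<Longrightarrow> B t \<ge> g" and g: "g > 0"
    and lb: "liminf_ge T y (pi / 2)"
  shows "\<forall>\<^sub>F s in at_top. T s x \<ge> pi / 2"
proof -
  have "\<forall>\<^sub>F s in at_top. pi - T s x \<le> pi / 2"
    using lb limsup_le_reflect[of T y "pi / 2"]
    by (intro eventually_le_before_maximum[OF angle_family_reflect[OF fam] yx nn _ g]) (auto simp: B)
  thus ?thesis by eventually_elim simp
qed

text \<open>The equation on a flat stretch does not involve s. The angles are compared with a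
  solution \<omega> started slightly above \<psi>, which stays close to \<psi> by
  \<open>angle_perturbation\<close>.\<close>

lemma limsup_le_flat:
  assumes fam: "angle_family A B m' K T" and ax: "0 \<le> a" "a \<le> x" "x \<le> 1"
    and flat: "\<And>t. t \<in> {a..x} \<Longrightarrow> m' t = 0" and \<psi>: "angle_sol A B (\<lambda>_. 0) \<psi> a x"
    and ub: "limsup_le T a (\<psi> a)"
  shows "limsup_le T x (\<psi> x)"
proof -
  have c: "continuous_on {a..x} A" "continuous_on {a..x} B" using \<psi> by (auto simp: angle_sol_def)
  obtain C where C: "C > 0"
    "\<And>T V B' D. \<lbrakk>angle_sol A B (\<lambda>_. 0) T a x; angle_sol A B' (\<lambda>_. 0) V a x;
        \<And>t. t \<in> {a..x} \<Longrightarrow> \<bar>B' t - B t\<bar> \<le> D; \<bar>T a - V a\<bar> \<le> D\<rbrakk> \<Longrightarrow> \<bar>T x - V x\<bar> \<le> C * D"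
    using angle_perturbation[OF ax(2) c continuous_on_const[of _ 0]] by metis
  have T: "angle_sol A B (\<lambda>_. 0) (T s) a x" for s
    using angle_sol_subset[OF angle_familyD(1)[OF fam, of s] ax(1,3)] flat
    unfolding angle_sol_def fld_def by auto
  show ?thesis
  proof (rule limsup_leI)
    fix \<beta> assume \<beta>: "\<psi> x < \<beta>"
    define e where "e = (\<beta> - \<psi> x) / C"
    have e: "e > 0" using \<beta> C by (simp add: e_def)
    obtain \<omega> where \<omega>: "\<omega> a = \<psi> a + e" "angle_sol A B (\<lambda>_. 0) \<omega> a x"
      using angle_sol_exists[OF ax(2) c continuous_on_const[of _ 0]] by metis
    have "\<bar>\<psi> x - \<omega> x\<bar> \<le> C * e" using \<omega> e by (intro C(2)[OF \<psi> \<omega>(2)]) auto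
    hence \<omega>x: "\<omega> x \<le> \<beta>" using C by (simp add: e_def)
    have "\<forall>\<^sub>F s in at_top. T s a \<le> \<psi> a + e"
      by (rule limsup_leD[OF ub]) (use e in simp)
    thus "\<forall>\<^sub>F s in at_top. T s x \<le> \<beta>"
    proof eventually_elim
      case (elim s)
      have "T s x \<le> \<omega> x"
        by (rule angle_mono_spectral_parameter[OF T \<omega>(2)]) (use elim \<omega>(1) ax in auto)
      thus ?case using \<omega>x by simp
    qed
  qed
qed

lemma liminf_ge_flat:
  assumes fam: "angle_family A B m' K T" and ax: "0 \<le> a" "a \<le> x" "x \<le> 1"
    and flat: "\<And>t. t \<in> {a..x} \<Longrightarrow> m' t = 0" and \<psi>: "angle_sol A B (\<lambda>_. 0) \<psi> a x"
    and lb: "liminf_ge T a (\<psi> a)"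
  shows "liminf_ge T x (\<psi> x)"
  using limsup_le_flat[OF angle_family_reflect[OF fam] ax flat angle_sol_reflect[OF \<psi>]] lb
  by (simp add: limsup_le_reflect)

subsection \<open>Local behaviour of the potential\<close>

text \<open>Strictness is demanded only against \<open>x\<close> itself: m may be flat on infinitely
  many pieces accumulating at \<open>x\<close>. The bound \<open>e \<le> x\<close> keeps the
  interval in [0,1] and makes the property false at 0.\<close>

definition left_incr :: "(real \<Rightarrow> real) \<Rightarrow> (real \<Rightarrow> real) \<Rightarrow> real \<Rightarrow> bool" where
  "left_incr m m' x \<longleftrightarrow> (\<exists>e>0. e \<le> x \<and> (\<forall>t\<in>{x-e..x}. 0 \<le> m' t) \<and> (\<forall>t\<in>{x-e..<x}. m t < m x))"

definition right_incr :: "(real \<Rightarrow> real) \<Rightarrow> (real \<Rightarrow> real) \<Rightarrow> real \<Rightarrow> bool" where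
  "right_incr m m' x \<longleftrightarrow> (\<exists>e>0. x + e \<le> 1 \<and> (\<forall>t\<in>{x..x+e}. 0 \<le> m' t) \<and> (\<forall>t\<in>{x<..x+e}. m x < m t))"

definition left_decr :: "(real \<Rightarrow> real) \<Rightarrow> (real \<Rightarrow> real) \<Rightarrow> real \<Rightarrow> bool" where
  "left_decr m m' x \<longleftrightarrow> (\<exists>e>0. e \<le> x \<and> (\<forall>t\<in>{x-e..x}. m' t \<le> 0) \<and> (\<forall>t\<in>{x-e..<x}. m x < m t))"

definition right_decr :: "(real \<Rightarrow> real) \<Rightarrow> (real \<Rightarrow> real) \<Rightarrow> real \<Rightarrow> bool" where
  "right_decr m m' x \<longleftrightarrow> (\<exists>e>0. x + e \<le> 1 \<and> (\<forall>t\<in>{x..x+e}. m' t \<le> 0) \<and> (\<forall>t\<in>{x<..x+e}. m t < m x))"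

definition left_flat :: "(real \<Rightarrow> real) \<Rightarrow> real \<Rightarrow> bool" where
  "left_flat m x \<longleftrightarrow> (\<exists>e>0. e \<le> x \<and> m constant_on {x-e..x})"

definition right_flat :: "(real \<Rightarrow> real) \<Rightarrow> real \<Rightarrow> bool" where
  "right_flat m x \<longleftrightarrow> (\<exists>e>0. x + e \<le> 1 \<and> m constant_on {x..x+e})"

lemma constant_onD: "f constant_on S \<Longrightarrow> x \<in> S \<Longrightarrow> y \<in> S \<Longrightarrow> f x = f y"
  by (auto simp: constant_on_def)

lemma constant_onI: "(\<And>x. x \<in> S \<Longrightarrow> f x = k) \<Longrightarrow> f constant_on S"
  by (auto simp: constant_on_def)

lemma left_incrE:
  assumes "left_incr m m' x" "d > 0"
  obtains e where "0 < e" "e \<le> d" "e \<le> x" "\<And>t. t \<in> {x-e..x} \<Longrightarrow> 0 \<le> m' t" "\<And>t. t \<in> {x-e..<x} \<Longrightarrow> m t < m x"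
proof -
  obtain e where "0 < e" "e \<le> x" "\<forall>t\<in>{x-e..x}. 0 \<le> m' t" "\<forall>t\<in>{x-e..<x}. m t < m x"
    using assms(1) by (auto simp: left_incr_def)
  thus thesis using assms(2) by (intro that[of "min e d"]) auto
qed

lemma left_decrE:
  assumes "left_decr m m' x" "d > 0"
  obtains e where "0 < e" "e \<le> d" "e \<le> x" "\<And>t. t \<in> {x-e..x} \<Longrightarrow> m' t \<le> 0" "\<And>t. t \<in> {x-e..<x} \<Longrightarrow> m x < m t"
proof -
  obtain e where "0 < e" "e \<le> x" "\<forall>t\<in>{x-e..x}. m' t \<le> 0" "\<forall>t\<in>{x-e..<x}. m x < m t"
    using assms(1) by (auto simp: left_decr_def)
  thus thesis using assms(2) by (intro that[of "min e d"]) auto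
qed

lemma right_incrE:
  assumes "right_incr m m' x" "d > 0"
  obtains e where "0 < e" "e \<le> d" "x + e \<le> 1" "\<And>t. t \<in> {x..x+e} \<Longrightarrow> 0 \<le> m' t" "\<And>t. t \<in> {x<..x+e} \<Longrightarrow> m x < m t"
proof -
  obtain e where "0 < e" "x + e \<le> 1" "\<forall>t\<in>{x..x+e}. 0 \<le> m' t" "\<forall>t\<in>{x<..x+e}. m x < m t"
    using assms(1) by (auto simp: right_incr_def)
  thus thesis using assms(2) by (intro that[of "min e d"]) auto
qed

lemma right_decrE:
  assumes "right_decr m m' x" "d > 0"
  obtains e where "0 < e" "e \<le> d" "x + e \<le> 1" "\<And>t. t \<in> {x..x+e} \<Longrightarrow> m' t \<le> 0" "\<And>t. t \<in> {x<..x+e} \<Longrightarrow> m t < m x"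
proof -
  obtain e where "0 < e" "x + e \<le> 1" "\<forall>t\<in>{x..x+e}. m' t \<le> 0" "\<forall>t\<in>{x<..x+e}. m t < m x"
    using assms(1) by (auto simp: right_decr_def)
  thus thesis using assms(2) by (intro that[of "min e d"]) auto
qed

lemma left_types_exclusive:
  shows "left_incr m m' x \<Longrightarrow> \<not> left_decr m m' x"
    and "left_incr m m' x \<Longrightarrow> \<not> left_flat m x"
    and "left_decr m m' x \<Longrightarrow> \<not> left_flat m x"
proof -
  have *: "x - min e d \<in> {x-e..<x}" "x - min e d \<in> {x-d..<x}" "x - min e d \<in> {x-d..x}"
    if "e > 0" "d > 0" for e d :: real
    using that by auto
  show "\<not> left_decr m m' x" if i: "left_incr m m' x"
  proof
    assume "left_decr m m' x"
    then obtain d where d: "d > 0" "\<forall>t\<in>{x-d..<x}. m x < m t" by (auto simp: left_decr_def)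
    obtain e where e: "e > 0" "\<forall>t\<in>{x-e..<x}. m t < m x" using i by (auto simp: left_incr_def)
    show False using bspec[OF e(2) *(1)[OF e(1) d(1)]] bspec[OF d(2) *(2)[OF e(1) d(1)]] by simp
  qed
  show "\<not> left_flat m x" if i: "left_incr m m' x"
  proof
    assume "left_flat m x"
    then obtain d where d: "d > 0" "m constant_on {x-d..x}" by (auto simp: left_flat_def)
    obtain e where e: "e > 0" "\<forall>t\<in>{x-e..<x}. m t < m x" using i by (auto simp: left_incr_def)
    show False using bspec[OF e(2) *(1)[OF e(1) d(1)]] constant_onD[OF d(2) *(3)[OF e(1) d(1)], of x] d(1) by simp
  qed
  show "\<not> left_flat m x" if i: "left_decr m m' x"
  proof
    assume "left_flat m x"
    then obtain d where d: "d > 0" "m constant_on {x-d..x}" by (auto simp: left_flat_def)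
    obtain e where e: "e > 0" "\<forall>t\<in>{x-e..<x}. m x < m t" using i by (auto simp: left_decr_def)
    show False using bspec[OF e(2) *(1)[OF e(1) d(1)]] constant_onD[OF d(2) *(3)[OF e(1) d(1)], of x] d(1) by simp
  qed
qed

lemma right_types_exclusive:
  shows "right_incr m m' x \<Longrightarrow> \<not> right_decr m m' x"
    and "right_incr m m' x \<Longrightarrow> \<not> right_flat m x"
    and "right_decr m m' x \<Longrightarrow> \<not> right_flat m x"
proof -
  have *: "x + min e d \<in> {x<..x+e}" "x + min e d \<in> {x<..x+d}" "x + min e d \<in> {x..x+d}"
    if "e > 0" "d > 0" for e d :: real
    using that by auto
  show "\<not> right_decr m m' x" if i: "right_incr m m' x"
  proof
    assume "right_decr m m' x"
    then obtain d where d: "d > 0" "\<forall>t\<in>{x<..x+d}. m t < m x" by (auto simp: right_decr_def)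
    obtain e where e: "e > 0" "\<forall>t\<in>{x<..x+e}. m x < m t" using i by (auto simp: right_incr_def)
    show False using bspec[OF e(2) *(1)[OF e(1) d(1)]] bspec[OF d(2) *(2)[OF e(1) d(1)]] by simp
  qed
  show "\<not> right_flat m x" if i: "right_incr m m' x"
  proof
    assume "right_flat m x"
    then obtain d where d: "d > 0" "m constant_on {x..x+d}" by (auto simp: right_flat_def)
    obtain e where e: "e > 0" "\<forall>t\<in>{x<..x+e}. m x < m t" using i by (auto simp: right_incr_def)
    show False using bspec[OF e(2) *(1)[OF e(1) d(1)]] constant_onD[OF d(2) *(3)[OF e(1) d(1)], of x] d(1) by simp
  qed
  show "\<not> right_flat m x" if i: "right_decr m m' x"
  proof
    assume "right_flat m x"
    then obtain d where d: "d > 0" "m constant_on {x..x+d}" by (auto simp: right_flat_def)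
    obtain e where e: "e > 0" "\<forall>t\<in>{x<..x+e}. m t < m x" using i by (auto simp: right_decr_def)
    show False using bspec[OF e(2) *(1)[OF e(1) d(1)]] constant_onD[OF d(2) *(3)[OF e(1) d(1)], of x] d(1) by simp
  qed
qed

text \<open>The breakpoints are the endpoints of the covering intervals. An interval without
  breakpoints in its interior lies in the covering interval that contains its midpoint.\<close>

lemma sign_breakpoints:
  assumes "finitely_many_sign_changes g"
  obtains E where "finite E"
    "\<And>u v. \<lbrakk>0 \<le> u; u < v; v \<le> 1; {u<..<v} \<inter> E = {}\<rbrakk>
        \<Longrightarrow> (\<forall>t\<in>{u..v}. 0 \<le> g t) \<or> (\<forall>t\<in>{u..v}. g t \<le> 0)"
proof -
  obtain F where F0: "finite F \<and> \<Union>F = {0..1::real} \<and>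
      (\<forall>J\<in>F. (\<exists>a b. J = {a..b}) \<and> ((\<forall>x\<in>J. g x \<ge> 0) \<or> (\<forall>x\<in>J. g x \<le> 0)))"
    using assms unfolding finitely_many_sign_changes_def ..
  note F = F0[THEN conjunct1] F0[THEN conjunct2, THEN conjunct1] F0[THEN conjunct2, THEN conjunct2, rule_format]
  show thesis
  proof (rule that[of "Inf ` F \<union> Sup ` F"])
    fix u v :: real
    assume uv: "0 \<le> u" "u < v" "v \<le> 1" and E: "{u<..<v} \<inter> (Inf ` F \<union> Sup ` F) = {}"
    define y where "y = (u + v) / 2"
    have y: "u < y" "y < v" using uv by (auto simp: y_def)
    hence "y \<in> \<Union>F" using F(2) uv by auto
    then obtain J where J: "J \<in> F" "y \<in> J" by blast
    then obtain a b where ab: "J = {a..b}" using F(3) by blast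
    have "a \<le> y" "y \<le> b" using J ab by auto
    hence "Inf J = a" "Sup J = b" using ab by auto
    hence "a \<notin> {u<..<v}" "b \<notin> {u<..<v}" using E J(1) by (auto simp: disjoint_iff)
    hence "{u..v} \<subseteq> J" using y \<open>a \<le> y\<close> \<open>y \<le> b\<close> ab by auto
    thus "(\<forall>t\<in>{u..v}. 0 \<le> g t) \<or> (\<forall>t\<in>{u..v}. g t \<le> 0)" using F(3)[OF J(1)] by blast
  qed (use F in auto)
qed

section \<open>One-sided types of a potential with finitely many sign changes\<close>

locale potential =
  fixes m m' :: "real \<Rightarrow> real"
  assumes grad: "gradient_on01 m m'"
    and signs: "finitely_many_sign_changes m'"
begin

lemma right_sign:
  assumes x: "0 \<le> x" "x < 1"
  obtains e where "e > 0" "x + e \<le> 1" "(\<forall>t\<in>{x..x+e}. 0 \<le> m' t) \<or> (\<forall>t\<in>{x..x+e}. m' t \<le> 0)"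
proof -
  obtain E where E: "finite E" "\<And>u v. \<lbrakk>0 \<le> u; u < v; v \<le> 1; {u<..<v} \<inter> E = {}\<rbrakk>
        \<Longrightarrow> (\<forall>t\<in>{u..v}. 0 \<le> m' t) \<or> (\<forall>t\<in>{u..v}. m' t \<le> 0)"
    using sign_breakpoints[OF signs] by metis
  obtain d where d: "d > 0" "\<forall>y\<in>E. y \<noteq> x \<longrightarrow> d \<le> dist x y" using finite_set_avoid[OF E(1)] by blast
  have "{x<..<x + min d (1 - x)} \<inter> E = {}" using d(2) by (force simp: dist_real_def)
  thus thesis using E(2)[of x "x + min d (1 - x)"] d(1) x by (intro that[of "min d (1 - x)"]) auto
qed

lemma left_sign:
  assumes x: "0 < x" "x \<le> 1"
  obtains e where "e > 0" "e \<le> x" "(\<forall>t\<in>{x-e..x}. 0 \<le> m' t) \<or> (\<forall>t\<in>{x-e..x}. m' t \<le> 0)"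
proof -
  obtain E where E: "finite E" "\<And>u v. \<lbrakk>0 \<le> u; u < v; v \<le> 1; {u<..<v} \<inter> E = {}\<rbrakk>
        \<Longrightarrow> (\<forall>t\<in>{u..v}. 0 \<le> m' t) \<or> (\<forall>t\<in>{u..v}. m' t \<le> 0)"
    using sign_breakpoints[OF signs] by metis
  obtain d where d: "d > 0" "\<forall>y\<in>E. y \<noteq> x \<longrightarrow> d \<le> dist x y" using finite_set_avoid[OF E(1)] by blast
  have "{x - min d x<..<x} \<inter> E = {}" using d(2) by (force simp: dist_real_def)
  thus thesis using E(2)[of "x - min d x" x] d(1) x by (intro that[of "min d x"]) auto
qed

lemma incr_le:
  assumes "0 \<le> a" "a \<le> b" "b \<le> 1" "\<And>x. x \<in> {a..b} \<Longrightarrow> 0 \<le> m' x"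
  shows "m a \<le> m b"
  using gradient_nonneg_imp_le[OF grad assms] .

lemma decr_le:
  assumes "0 \<le> a" "a \<le> b" "b \<le> 1" "\<And>x. x \<in> {a..b} \<Longrightarrow> m' x \<le> 0"
  shows "m b \<le> m a"
  using gradient_nonneg_imp_le[OF gradient_on01_uminus[OF grad] assms(1-3)] assms(4) by simp

text \<open>On a one-sided neighbourhood where m' has one sign, m is monotone. If it takes the value
  \<open>m x\<close> again, it is constant from there to \<open>x\<close>; otherwise the comparison
  with \<open>m x\<close> is strict throughout.\<close>

lemma left_cases:
  assumes x: "0 < x" "x \<le> 1"
  shows "left_incr m m' x \<or> left_decr m m' x \<or> left_flat m x"
proof -
  obtain e where e: "e > 0" "e \<le> x" "(\<forall>t\<in>{x-e..x}. 0 \<le> m' t) \<or> (\<forall>t\<in>{x-e..x}. m' t \<le> 0)"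
    by (rule left_sign[OF x])
  show ?thesis
  proof (cases "\<exists>t\<in>{x-e..<x}. m t = m x")
    case True
    then obtain t where t: "t \<in> {x-e..<x}" "m t = m x" by blast
    have "m u = m x" if u: "u \<in> {t..x}" for u
      using e(3)
    proof
      assume nn: "\<forall>t\<in>{x-e..x}. 0 \<le> m' t"
      have "m t \<le> m u" "m u \<le> m x" by (rule incr_le; use nn t u e(1,2) x in auto)+
      thus ?thesis using t by simp
    next
      assume nn: "\<forall>t\<in>{x-e..x}. m' t \<le> 0"
      have "m u \<le> m t" "m x \<le> m u" by (rule decr_le; use nn t u e(1,2) x in auto)+
      thus ?thesis using t by simp
    qed
    hence "m constant_on {t..x}" by (rule constant_onI)
    thus ?thesis using t e(1,2) unfolding left_flat_def by (intro disjI2 exI[of _ "x - t"]) auto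
  next
    case False
    from e(3) show ?thesis
    proof
      assume nn: "\<forall>t\<in>{x-e..x}. 0 \<le> m' t"
      have "m t < m x" if "t \<in> {x-e..<x}" for t
      proof -
        have "m t \<le> m x" by (rule incr_le) (use nn that e(1,2) x in auto)
        moreover have "m t \<noteq> m x" using False that by blast
        ultimately show ?thesis by simp
      qed
      thus ?thesis using e(1,2) nn unfolding left_incr_def by blast
    next
      assume nn: "\<forall>t\<in>{x-e..x}. m' t \<le> 0"
      have "m x < m t" if "t \<in> {x-e..<x}" for t
      proof -
        have "m x \<le> m t" by (rule decr_le) (use nn that e(1,2) x in auto)
        moreover have "m t \<noteq> m x" using False that by blast
        ultimately show ?thesis by simp
      qed
      thus ?thesis using e(1,2) nn unfolding left_decr_def by blast
    qed
  qed
qed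

lemma right_cases:
  assumes x: "0 \<le> x" "x < 1"
  shows "right_incr m m' x \<or> right_decr m m' x \<or> right_flat m x"
proof -
  obtain e where e: "e > 0" "x + e \<le> 1" "(\<forall>t\<in>{x..x+e}. 0 \<le> m' t) \<or> (\<forall>t\<in>{x..x+e}. m' t \<le> 0)"
    by (rule right_sign[OF x])
  show ?thesis
  proof (cases "\<exists>t\<in>{x<..x+e}. m t = m x")
    case True
    then obtain t where t: "t \<in> {x<..x+e}" "m t = m x" by blast
    have "m u = m x" if u: "u \<in> {x..t}" for u
      using e(3)
    proof
      assume nn: "\<forall>t\<in>{x..x+e}. 0 \<le> m' t"
      have "m x \<le> m u" "m u \<le> m t" by (rule incr_le; use nn t u e(1,2) x in auto)+
      thus ?thesis using t by simp
    next
      assume nn: "\<forall>t\<in>{x..x+e}. m' t \<le> 0"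
      have "m u \<le> m x" "m t \<le> m u" by (rule decr_le; use nn t u e(1,2) x in auto)+
      thus ?thesis using t by simp
    qed
    hence "m constant_on {x..t}" by (rule constant_onI)
    thus ?thesis using t e(1,2) unfolding right_flat_def by (intro disjI2 exI[of _ "t - x"]) auto
  next
    case False
    from e(3) show ?thesis
    proof
      assume nn: "\<forall>t\<in>{x..x+e}. 0 \<le> m' t"
      have "m x < m t" if "t \<in> {x<..x+e}" for t
      proof -
        have "m x \<le> m t" by (rule incr_le) (use nn that e(1,2) x in auto)
        moreover have "m t \<noteq> m x" using False that by blast
        ultimately show ?thesis by simp
      qed
      thus ?thesis using e(1,2) nn unfolding right_incr_def by blast
    next
      assume nn: "\<forall>t\<in>{x..x+e}. m' t \<le> 0"
      have "m t < m x" if "t \<in> {x<..x+e}" for t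
      proof -
        have "m t \<le> m x" by (rule decr_le) (use nn that e(1,2) x in auto)
        moreover have "m t \<noteq> m x" using False that by blast
        ultimately show ?thesis by simp
      qed
      thus ?thesis using e(1,2) nn unfolding right_decr_def by blast
    qed
  qed
qed

text \<open>Endpoints are included because derivatives within a nondegenerate closed interval are
  unique.\<close>

lemma flat_imp_deriv_zero:
  assumes "0 \<le> a" "a < b" "b \<le> 1" "m constant_on {a..b}" and x: "x \<in> {a..b}"
  shows "m' x = 0"
proof -
  obtain k where k: "\<And>t. t \<in> {a..b} \<Longrightarrow> m t = k" using assms(4) by (auto simp: constant_on_def)
  have 1: "(m has_vector_derivative m' x) (at x within {a..b})"
    using gradient_subset[OF grad assms(1,3) x] by (simp add: has_real_derivative_iff_has_vector_derivative)
  have "((\<lambda>_. k) has_vector_derivative 0) (at x within {a..b})" by (rule derivative_intros)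
  hence 2: "(m has_vector_derivative 0) (at x within {a..b})"
    by (rule has_vector_derivative_transform[rotated 2]) (use k x in auto)
  show ?thesis
    using vector_derivative_unique_within_closed_interval[of a b x m "m' x" 0] assms(2) x 1 2
    by (simp add: cbox_interval)
qed

lemma deriv_zero_imp_flat:
  assumes "0 \<le> a" "a < b" "b \<le> 1" "\<And>t. t \<in> {a<..<b} \<Longrightarrow> m' t = 0" "t \<in> {a..b}"
  shows "m t = m a"
proof (rule DERIV_isconst2[OF assms(2)])
  show "continuous_on {a..b} m"
    by (rule continuous_on_subset[OF gradient_continuous[OF grad]]) (use assms in auto)
  fix x assume "a < x" "x < b"
  thus "(m has_real_derivative 0) (at x)" using gradient_at[OF grad, of x] assms by auto
qed (use assms in auto)

text \<open>Translates the condition on m' in the definition of a segment into one on m.\<close>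

lemma left_flat_iff:
  assumes a: "0 < a" "a \<le> 1"
  shows "\<not> left_flat m a \<longleftrightarrow> (\<forall>\<^sub>F e in at_right 0. \<exists>x\<in>{a-e<..<a}. m' x \<noteq> 0)"
proof
  assume nf: "\<not> left_flat m a"
  have "\<exists>x\<in>{a-e<..<a}. m' x \<noteq> 0" if e: "0 < e" "e < a" for e
  proof (rule ccontr)
    assume "\<not> (\<exists>x\<in>{a-e<..<a}. m' x \<noteq> 0)"
    hence "m t = m (a - e)" if "t \<in> {a-e..a}" for t
      using that e a by (intro deriv_zero_imp_flat[of "a - e" a]) auto
    hence "m constant_on {a-e..a}" by (rule constant_onI)
    thus False using nf e unfolding left_flat_def by auto
  qed
  thus "\<forall>\<^sub>F e in at_right 0. \<exists>x\<in>{a-e<..<a}. m' x \<noteq> 0"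
    using a by (auto simp: eventually_at_right[of 0 a] intro!: exI[of _ a])
next
  assume ev: "\<forall>\<^sub>F e in at_right 0. \<exists>x\<in>{a-e<..<a}. m' x \<noteq> 0"
  show "\<not> left_flat m a"
  proof
    assume "left_flat m a"
    then obtain e where e: "e > 0" "e \<le> a" "m constant_on {a-e..a}"
      unfolding left_flat_def by blast
    have 0: "m' t = 0" if "t \<in> {a-e..a}" for t
      by (rule flat_imp_deriv_zero[of "a - e" a]) (use e a that in auto)
    have "\<forall>\<^sub>F d in at_right 0. d \<in> {0<..<e}" using e(1) by (rule eventually_at_right_real)
    with ev have "\<forall>\<^sub>F d in at_right (0::real). False"
      by eventually_elim (use 0 in fastforce)
    thus False by (simp add: trivial_limit_at_right_real)
  qed
qed

lemma right_flat_iff: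
  assumes b: "0 \<le> b" "b < 1"
  shows "\<not> right_flat m b \<longleftrightarrow> (\<forall>\<^sub>F e in at_right 0. \<exists>x\<in>{b<..<b+e}. m' x \<noteq> 0)"
proof
  assume nf: "\<not> right_flat m b"
  have "\<exists>x\<in>{b<..<b+e}. m' x \<noteq> 0" if e: "0 < e" "e < 1 - b" for e
  proof (rule ccontr)
    assume "\<not> (\<exists>x\<in>{b<..<b+e}. m' x \<noteq> 0)"
    hence "m t = m b" if "t \<in> {b..b+e}" for t
      using that e b by (intro deriv_zero_imp_flat[of b "b + e"]) auto
    hence "m constant_on {b..b+e}" by (rule constant_onI)
    thus False using nf e unfolding right_flat_def by auto
  qed
  thus "\<forall>\<^sub>F e in at_right 0. \<exists>x\<in>{b<..<b+e}. m' x \<noteq> 0"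
    using b by (auto simp: eventually_at_right[of 0 "1 - b"] intro!: exI[of _ "1 - b"])
next
  assume ev: "\<forall>\<^sub>F e in at_right 0. \<exists>x\<in>{b<..<b+e}. m' x \<noteq> 0"
  show "\<not> right_flat m b"
  proof
    assume "right_flat m b"
    then obtain e where e: "e > 0" "b + e \<le> 1" "m constant_on {b..b+e}"
      unfolding right_flat_def by blast
    have 0: "m' t = 0" if "t \<in> {b..b+e}" for t
      by (rule flat_imp_deriv_zero[of b "b + e"]) (use e b that in auto)
    have "\<forall>\<^sub>F d in at_right 0. d \<in> {0<..<e}" using e(1) by (rule eventually_at_right_real)
    with ev have "\<forall>\<^sub>F d in at_right (0::real). False"
      by eventually_elim (use 0 in fastforce)
    thus False by (simp add: trivial_limit_at_right_real)
  qed
qed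

lemma left_I_iff:
  assumes a: "0 < a" "a \<le> 1" and nf: "\<not> left_flat m a"
  shows "left_I m a \<longleftrightarrow> left_incr m m' a" and "left_D m a \<longleftrightarrow> left_decr m m' a"
proof -
  have 1: "left_I m a" if i: "left_incr m m' a"
  proof -
    obtain e where e: "0 < e" "e \<le> a" "\<And>t. t \<in> {a-e..a} \<Longrightarrow> 0 \<le> m' t"
      using left_incrE[OF i, of 1] by (metis zero_less_one)
    have "mono_on ({a-e..a} \<inter> {0..1}) m"
      by (rule mono_onI, rule incr_le) (use e a in auto)
    thus ?thesis using e(1) unfolding left_I_def by blast
  qed
  have 2: "left_D m a" if i: "left_decr m m' a"
  proof -
    obtain e where e: "0 < e" "e \<le> a" "\<And>t. t \<in> {a-e..a} \<Longrightarrow> m' t \<le> 0"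
      using left_decrE[OF i, of 1] by (metis zero_less_one)
    have "antimono_on ({a-e..a} \<inter> {0..1}) m"
      by (rule monotone_onI, rule decr_le) (use e a in auto)
    thus ?thesis using e(1) unfolding left_D_def by blast
  qed
  have 3: "\<not> left_I m a" if i: "left_decr m m' a"
  proof
    assume "left_I m a"
    then obtain d where d: "d > 0" "mono_on ({a-d..a} \<inter> {0..1}) m" unfolding left_I_def by blast
    obtain e where e: "0 < e" "e \<le> d" "e \<le> a" "\<And>t. t \<in> {a-e..<a} \<Longrightarrow> m a < m t"
      using left_decrE[OF i d(1)] by metis
    have "m (a - e) \<le> m a" by (rule mono_onD[OF d(2)]) (use e a in auto)
    moreover have "m a < m (a - e)" using e by auto
    ultimately show False by simp
  qed
  have 4: "\<not> left_D m a" if i: "left_incr m m' a"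
  proof
    assume "left_D m a"
    then obtain d where d: "d > 0" "antimono_on ({a-d..a} \<inter> {0..1}) m" unfolding left_D_def by blast
    obtain e where e: "0 < e" "e \<le> d" "e \<le> a" "\<And>t. t \<in> {a-e..<a} \<Longrightarrow> m t < m a"
      using left_incrE[OF i d(1)] by metis
    have "m (a - e) \<ge> m a" by (rule monotone_onD[OF d(2)]) (use e a in auto)
    moreover have "m (a - e) < m a" using e by auto
    ultimately show False by simp
  qed
  show "left_I m a \<longleftrightarrow> left_incr m m' a" and "left_D m a \<longleftrightarrow> left_decr m m' a"
    using 1 2 3 4 left_cases[OF a] nf by blast+
qed

lemma right_I_iff:
  assumes b: "0 \<le> b" "b < 1" and nf: "\<not> right_flat m b"
  shows "right_I m b \<longleftrightarrow> right_incr m m' b" and "right_D m b \<longleftrightarrow> right_decr m m' b"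
proof -
  have 1: "right_I m b" if i: "right_incr m m' b"
  proof -
    obtain e where e: "0 < e" "b + e \<le> 1" "\<And>t. t \<in> {b..b+e} \<Longrightarrow> 0 \<le> m' t"
      using right_incrE[OF i, of 1] by (metis zero_less_one)
    have "mono_on ({b..b+e} \<inter> {0..1}) m"
      by (rule mono_onI, rule incr_le) (use e b in auto)
    thus ?thesis using e(1) unfolding right_I_def by blast
  qed
  have 2: "right_D m b" if i: "right_decr m m' b"
  proof -
    obtain e where e: "0 < e" "b + e \<le> 1" "\<And>t. t \<in> {b..b+e} \<Longrightarrow> m' t \<le> 0"
      using right_decrE[OF i, of 1] by (metis zero_less_one)
    have "antimono_on ({b..b+e} \<inter> {0..1}) m"
      by (rule monotone_onI, rule decr_le) (use e b in auto)
    thus ?thesis using e(1) unfolding right_D_def by blast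
  qed
  have 3: "\<not> right_I m b" if i: "right_decr m m' b"
  proof
    assume "right_I m b"
    then obtain d where d: "d > 0" "mono_on ({b..b+d} \<inter> {0..1}) m" unfolding right_I_def by blast
    obtain e where e: "0 < e" "e \<le> d" "b + e \<le> 1" "\<And>t. t \<in> {b<..b+e} \<Longrightarrow> m t < m b"
      using right_decrE[OF i d(1)] by metis
    have "m b \<le> m (b + e)" by (rule mono_onD[OF d(2)]) (use e b in auto)
    moreover have "m (b + e) < m b" using e by auto
    ultimately show False by simp
  qed
  have 4: "\<not> right_D m b" if i: "right_incr m m' b"
  proof
    assume "right_D m b"
    then obtain d where d: "d > 0" "antimono_on ({b..b+d} \<inter> {0..1}) m" unfolding right_D_def by blast
    obtain e where e: "0 < e" "e \<le> d" "b + e \<le> 1" "\<And>t. t \<in> {b<..b+e} \<Longrightarrow> m b < m t"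
      using right_incrE[OF i d(1)] by metis
    have "m b \<ge> m (b + e)" by (rule monotone_onD[OF d(2)]) (use e b in auto)
    moreover have "m b < m (b + e)" using e by auto
    ultimately show False by simp
  qed
  show "right_I m b \<longleftrightarrow> right_incr m m' b" and "right_D m b \<longleftrightarrow> right_decr m m' b"
    using 1 2 3 4 right_cases[OF b] nf by blast+
qed

section \<open>Segments and isolated maxima through one-sided types\<close>

abbreviation segment :: "real \<Rightarrow> real \<Rightarrow> bool" where
  "segment \<equiv> segment_of_local_max m m'"

text \<open>A segment thus becomes a maximal interval of constancy: not being flat beyond the ends
  is maximality, and the trichotomies supply the one-sided monotonicity.\<close>

lemma segment_iff:
  "segment a b \<longleftrightarrow> 0 \<le> a \<and> a < b \<and> b \<le> 1 \<and> m constant_on {a..b} \<and>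
     (a > 0 \<longrightarrow> \<not> left_flat m a) \<and> (b < 1 \<longrightarrow> \<not> right_flat m b)"
  (is "?L \<longleftrightarrow> ?R")
proof
  assume L: ?L
  thus ?R using left_flat_iff[of a] right_flat_iff[of b] unfolding segment_of_local_max_def by auto
next
  assume R: ?R
  have "\<exists>e>0. mono_on ({a-e..a} \<inter> {0..1}) m \<or> antimono_on ({a-e..a} \<inter> {0..1}) m"
  proof (cases "a = 0")
    case True
    have "mono_on ({a-1..a} \<inter> {0..1}) m" by (rule mono_onI) (use True in auto)
    thus ?thesis by (meson zero_less_one)
  next
    case False
    hence "left_I m a \<or> left_D m a" using left_I_iff[of a] left_cases[of a] R by auto
    thus ?thesis unfolding left_I_def left_D_def by blast
  qed
  then obtain d where d: "d > 0" "mono_on ({a-d..a} \<inter> {0..1}) m \<or> antimono_on ({a-d..a} \<inter> {0..1}) m" by blast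
  have "\<exists>e>0. mono_on ({b..b+e} \<inter> {0..1}) m \<or> antimono_on ({b..b+e} \<inter> {0..1}) m"
  proof (cases "b = 1")
    case True
    have "mono_on ({b..b+1} \<inter> {0..1}) m" by (rule mono_onI) (use True in auto)
    thus ?thesis by (meson zero_less_one)
  next
    case False
    hence "right_I m b \<or> right_D m b" using right_I_iff[of b] right_cases[of b] R by auto
    thus ?thesis unfolding right_I_def right_D_def by blast
  qed
  then obtain e where e: "e > 0" "mono_on ({b..b+e} \<inter> {0..1}) m \<or> antimono_on ({b..b+e} \<inter> {0..1}) m" by blast
  have "{a - min d e..a} \<inter> {0..1} \<subseteq> {a-d..a} \<inter> {0..1}" "{b..b + min d e} \<inter> {0..1} \<subseteq> {b..b+e} \<inter> {0..1}" by auto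
  hence "(mono_on ({a - min d e..a} \<inter> {0..1}) m \<or> antimono_on ({a - min d e..a} \<inter> {0..1}) m) \<and>
         (mono_on ({b..b + min d e} \<inter> {0..1}) m \<or> antimono_on ({b..b + min d e} \<inter> {0..1}) m)"
    using d(2) e(2) monotone_on_subset by blast
  moreover have "min d e > 0" using d e by simp
  ultimately have ex: "\<exists>e>0. (mono_on ({a-e..a} \<inter> {0..1}) m \<or> antimono_on ({a-e..a} \<inter> {0..1}) m) \<and>
      (mono_on ({b..b+e} \<inter> {0..1}) m \<or> antimono_on ({b..b+e} \<inter> {0..1}) m)" by blast
  have 1: "a > 0 \<longrightarrow> (\<forall>\<^sub>F e in at_right 0. \<exists>x\<in>{a-e<..<a}. m' x \<noteq> 0)"
    using R left_flat_iff[of a] by simp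
  have 2: "b < 1 \<longrightarrow> (\<forall>\<^sub>F e in at_right 0. \<exists>x\<in>{b<..<b+e}. m' x \<noteq> 0)"
    using R right_flat_iff[of b] by simp
  show ?L unfolding segment_of_local_max_def by (intro conjI ex 1 2) (use R in simp_all)
qed

lemma M_segments_iff:
  "(a, b) \<in> M2 m m' \<longleftrightarrow> segment a b \<and> 0 < a \<and> b < 1 \<and> left_incr m m' a \<and> right_incr m m' b"
  "(a, b) \<in> M3 m m' \<longleftrightarrow> segment a b \<and> 0 < a \<and> b < 1 \<and> left_incr m m' a \<and> right_decr m m' b"
  "(a, b) \<in> M4 m m' \<longleftrightarrow> segment a b \<and> 0 < a \<and> b < 1 \<and> left_decr m m' a \<and> right_incr m m' b"
  "(a, b) \<in> M5 m m' \<longleftrightarrow> segment a b \<and> 0 < a \<and> b < 1 \<and> left_decr m m' a \<and> right_decr m m' b"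
  "(a, b) \<in> M6 m m' \<longleftrightarrow> segment a b \<and> a = 0 \<and> b < 1 \<and> right_incr m m' b"
  "(a, b) \<in> M7 m m' \<longleftrightarrow> segment a b \<and> a = 0 \<and> b < 1 \<and> right_decr m m' b"
  "(a, b) \<in> M8 m m' \<longleftrightarrow> segment a b \<and> 0 < a \<and> b = 1 \<and> left_incr m m' a"
  "(a, b) \<in> M9 m m' \<longleftrightarrow> segment a b \<and> 0 < a \<and> b = 1 \<and> left_decr m m' a"
proof -
  have l: "(left_I m a \<longleftrightarrow> left_incr m m' a) \<and> (left_D m a \<longleftrightarrow> left_decr m m' a)" if "segment a b" "0 < a"
    using left_I_iff[of a] segment_iff[of a b] that by auto
  have r: "(right_I m b \<longleftrightarrow> right_incr m m' b) \<and> (right_D m b \<longleftrightarrow> right_decr m m' b)" if "segment a b" "b < 1"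
    using right_I_iff[of b] segment_iff[of a b] that by auto
  have ab: "a < b" if "segment a b" using segment_iff[of a b] that by auto
  show "(a, b) \<in> M2 m m' \<longleftrightarrow> segment a b \<and> 0 < a \<and> b < 1 \<and> left_incr m m' a \<and> right_incr m m' b"
    unfolding M2_def using l r by blast
  show "(a, b) \<in> M3 m m' \<longleftrightarrow> segment a b \<and> 0 < a \<and> b < 1 \<and> left_incr m m' a \<and> right_decr m m' b"
    unfolding M3_def using l r by blast
  show "(a, b) \<in> M4 m m' \<longleftrightarrow> segment a b \<and> 0 < a \<and> b < 1 \<and> left_decr m m' a \<and> right_incr m m' b"
    unfolding M4_def using l r by blast
  show "(a, b) \<in> M5 m m' \<longleftrightarrow> segment a b \<and> 0 < a \<and> b < 1 \<and> left_decr m m' a \<and> right_decr m m' b"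
    unfolding M5_def using l r by blast
  show "(a, b) \<in> M6 m m' \<longleftrightarrow> segment a b \<and> a = 0 \<and> b < 1 \<and> right_incr m m' b"
    unfolding M6_def using r by blast
  show "(a, b) \<in> M7 m m' \<longleftrightarrow> segment a b \<and> a = 0 \<and> b < 1 \<and> right_decr m m' b"
    unfolding M7_def using r by blast
  show "(a, b) \<in> M8 m m' \<longleftrightarrow> segment a b \<and> 0 < a \<and> b = 1 \<and> left_incr m m' a"
    unfolding M8_def using l by blast
  show "(a, b) \<in> M9 m m' \<longleftrightarrow> segment a b \<and> 0 < a \<and> b = 1 \<and> left_decr m m' a"
    unfolding M9_def using l by blast
qed

text \<open>By the trichotomies, a side of \<open>x\<close> that lacks the required strict type
  contains points arbitrarily close to \<open>x\<close> where m is at least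
  \<open>m x\<close>.\<close>

lemma M1_iff:
  "x \<in> M1 m \<longleftrightarrow> 0 \<le> x \<and> x \<le> 1 \<and> (0 < x \<longrightarrow> left_incr m m' x) \<and> (x < 1 \<longrightarrow> right_decr m m' x)"
  (is "?L \<longleftrightarrow> ?R")
proof
  assume ?L
  then obtain e where x: "0 \<le> x" "x \<le> 1" and e: "e > 0"
    and less: "\<And>t. t \<in> ({x-e<..<x+e} \<inter> {0..1}) - {x} \<Longrightarrow> m t < m x"
    unfolding M1_def by auto
  have "left_incr m m' x" if "0 < x"
  proof (rule ccontr)
    assume "\<not> left_incr m m' x"
    hence "\<exists>d>0. d \<le> x \<and> (\<forall>t\<in>{x-d..<x}. m x \<le> m t)"
      using left_cases[OF that x(2)] unfolding left_decr_def left_flat_def constant_on_def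
      by (metis atLeastLessThan_iff atLeastAtMost_iff less_imp_le order_refl diff_le_eq le_add_same_cancel1)
    then obtain d where d: "d > 0" "d \<le> x" "\<And>t. t \<in> {x-d..<x} \<Longrightarrow> m x \<le> m t" by blast
    have "m x \<le> m (x - min d (e/2))" using d e by (intro d(3)) auto
    moreover have "m (x - min d (e/2)) < m x" using d e x by (intro less) auto
    ultimately show False by simp
  qed
  moreover have "right_decr m m' x" if "x < 1"
  proof (rule ccontr)
    assume "\<not> right_decr m m' x"
    hence "\<exists>d>0. x + d \<le> 1 \<and> (\<forall>t\<in>{x<..x+d}. m x \<le> m t)"
      using right_cases[OF x(1) that] unfolding right_incr_def right_flat_def constant_on_def
      by (metis greaterThanAtMost_iff atLeastAtMost_iff less_imp_le order_refl le_add_same_cancel1)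
    then obtain d where d: "d > 0" "x + d \<le> 1" "\<And>t. t \<in> {x<..x+d} \<Longrightarrow> m x \<le> m t" by blast
    have "m x \<le> m (x + min d (e/2))" using d e by (intro d(3)) auto
    moreover have "m (x + min d (e/2)) < m x" using d e x by (intro less) auto
    ultimately show False by simp
  qed
  ultimately show ?R using x by blast
next
  assume R: ?R
  have "\<exists>d>0. \<forall>t. 0 \<le> t \<and> x - d < t \<and> t < x \<longrightarrow> m t < m x"
  proof (cases "0 < x")
    case True
    then obtain d where "d > 0" "\<And>t. t \<in> {x-d..<x} \<Longrightarrow> m t < m x"
      using R left_incrE[of m m' x 1] by (metis zero_less_one)
    thus ?thesis by (intro exI[of _ d]) auto
  qed (intro exI[of _ 1], use R in auto)
  then obtain d where d: "d > 0" "\<And>t. 0 \<le> t \<Longrightarrow> x - d < t \<Longrightarrow> t < x \<Longrightarrow> m t < m x" by blast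
  have "\<exists>d>0. \<forall>t. t \<le> 1 \<and> x < t \<and> t < x + d \<longrightarrow> m t < m x"
  proof (cases "x < 1")
    case True
    then obtain d where "d > 0" "\<And>t. t \<in> {x<..x+d} \<Longrightarrow> m t < m x"
      using R right_decrE[of m m' x 1] by (metis zero_less_one)
    thus ?thesis by (intro exI[of _ d]) auto
  qed (intro exI[of _ 1], use R in auto)
  then obtain e where e: "e > 0" "\<And>t. t \<le> 1 \<Longrightarrow> x < t \<Longrightarrow> t < x + e \<Longrightarrow> m t < m x" by blast
  have "m t < m x" if "t \<in> ({x - min d e<..<x + min d e} \<inter> {0..1}) - {x}" for t
    using d(2)[of t] e(2)[of t] that by (cases "t < x") auto
  moreover have "min d e > 0" using d e by simp
  ultimately have "\<exists>e>0. \<forall>t\<in>({x-e<..<x+e} \<inter> {0..1}) - {x}. m t < m x" by blast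
  thus ?L using R by (simp add: M1_def)
qed

section \<open>Disjointness and finiteness of segments\<close>

lemma segment_unique:
  assumes "segment a b" "segment a' b'" "x \<in> {a..b}" "x \<in> {a'..b'}"
  shows "a = a' \<and> b = b'"
proof -
  \<comment> \<open>If \<open>a\<close> lay to the left of \<open>a'\<close>, m would be constant on
    [a, a'], which would make \<open>a'\<close> left flat.\<close>
  have l: "a' \<le> a" if "segment a b" "segment a' b'" "x \<in> {a..b}" "x \<in> {a'..b'}" for a b a' b'
  proof (rule ccontr)
    assume "\<not> a' \<le> a"
    moreover from this have "left_flat m a'"
      unfolding left_flat_def using that
      by (intro exI[of _ "a' - a"]) (auto simp: segment_iff intro: constant_on_subset)
    ultimately show False using that by (auto simp: segment_iff)
  qed
  have r: "b \<le> b'" if "segment a b" "segment a' b'" "x \<in> {a..b}" "x \<in> {a'..b'}" for a b a' b'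
  proof (rule ccontr)
    assume "\<not> b \<le> b'"
    moreover from this have "right_flat m b'"
      unfolding right_flat_def using that
      by (intro exI[of _ "b - b'"]) (auto simp: segment_iff intro: constant_on_subset)
    ultimately show False using that by (auto simp: segment_iff)
  qed
  show ?thesis using l[OF assms] l[OF assms(2,1,4,3)] r[OF assms] r[OF assms(2,1,4,3)] by simp
qed

lemma finite_segments_meeting:
  assumes "finite E"
  shows "finite {(a, b). segment a b \<and> (\<exists>e\<in>E. a \<le> e \<and> e \<le> b)}"
proof -
  have "finite {(a, b). segment a b \<and> a \<le> e \<and> e \<le> b}" for e
  proof (cases "\<exists>a b. segment a b \<and> a \<le> e \<and> e \<le> b")
    case True
    then obtain a b where "segment a b" "a \<le> e" "e \<le> b" by blast
    hence "{(a, b). segment a b \<and> a \<le> e \<and> e \<le> b} \<subseteq> {(a, b)}"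
      using segment_unique[of _ _ a b e] by force
    thus ?thesis by (rule finite_subset) simp
  next
    case False
    hence "{(a, b). segment a b \<and> a \<le> e \<and> e \<le> b} \<subseteq> {}" by blast
    thus ?thesis by (rule finite_subset) simp
  qed
  hence "finite (\<Union>e\<in>E. {(a, b). segment a b \<and> a \<le> e \<and> e \<le> b})"
    by (intro finite_UN_I assms)
  thus ?thesis by (rule rev_finite_subset) blast
qed

text \<open>An interval of length at least \<open>h\<close> contains a multiple of \<open>h\<close>,
  and each of the finitely many multiples concerned lies in at most one segment.\<close>

lemma finite_long_segments:
  assumes h: "h > 0"
  shows "finite {(a, b). segment a b \<and> h \<le> b - a}"
proof -
  define E where "E = (\<lambda>k. real k * h) ` {..nat \<lceil>1 / h\<rceil>}"
  have "{(a, b). segment a b \<and> h \<le> b - a} \<subseteq> {(a, b). segment a b \<and> (\<exists>e\<in>E. a \<le> e \<and> e \<le> b)}"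
  proof clarify
    fix a b assume ab: "segment a b" "h \<le> b - a"
    hence a: "0 \<le> a" "a \<le> 1" by (auto simp: segment_iff)
    define k where "k = nat \<lceil>a / h\<rceil>"
    have "0 \<le> \<lceil>a / h\<rceil>" using a h by (simp add: order_less_le_trans[of "-1" 0])
    hence "real k = of_int \<lceil>a / h\<rceil>" by (simp add: k_def)
    hence k: "real k \<ge> a / h" "real k < a / h + 1" using ceiling_correct[of "a / h"] by linarith+
    have "a / h \<le> 1 / h" using a h by (simp add: divide_right_mono)
    hence "k \<le> nat \<lceil>1 / h\<rceil>" unfolding k_def by (intro nat_mono ceiling_mono)
    hence "real k * h \<in> E" by (auto simp: E_def)
    moreover have "a \<le> real k * h" "real k * h \<le> b" using k h ab(2) by (auto simp: field_simps)
    ultimately show "\<exists>e\<in>E. a \<le> e \<and> e \<le> b" by blast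
  qed
  moreover have "finite E" by (simp add: E_def)
  ultimately show ?thesis using finite_segments_meeting finite_subset by blast
qed

text \<open>On the two sides of such a segment or point m is monotone in opposite senses, so a
  breakpoint must lie in it. The families \<open>M2\<close> and \<open>M5\<close>, with equal
  senses, can be infinite.\<close>

lemma finite_M34: "finite (M3 m m')" "finite (M4 m m')"
  and finite_interior_M1: "finite (M1 m - {0, 1})"
proof -
  obtain E where E: "finite E" "\<And>u v. \<lbrakk>0 \<le> u; u < v; v \<le> 1; {u<..<v} \<inter> E = {}\<rbrakk>
        \<Longrightarrow> (\<forall>t\<in>{u..v}. 0 \<le> m' t) \<or> (\<forall>t\<in>{u..v}. m' t \<le> 0)"
    using sign_breakpoints[OF signs] by metis
  \<comment> \<open>The case \<open>a = b\<close> is allowed, which covers isolated maxima.\<close>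
  have meet: "\<exists>e\<in>E. a \<le> e \<and> e \<le> b"
    if ab: "0 < a" "a \<le> b" "b < 1" "left_incr m m' a \<and> right_decr m m' b \<or> left_decr m m' a \<and> right_incr m m' b" for a b
  proof (rule ccontr)
    assume no: "\<not> (\<exists>e\<in>E. a \<le> e \<and> e \<le> b)"
    obtain d where d: "d > 0" "\<forall>y\<in>E. y \<noteq> a \<longrightarrow> d \<le> dist a y" using finite_set_avoid[OF E(1)] by blast
    obtain d' where d': "d' > 0" "\<forall>y\<in>E. y \<noteq> b \<longrightarrow> d' \<le> dist b y" using finite_set_avoid[OF E(1)] by blast
    \<comment> \<open>The interval (u, v) reaches past [a, b] on both sides without meeting a
      further breakpoint.\<close>
    define u where "u = a - min d a"
    define v where "v = b + min d' (1 - b)"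
    have uv: "0 \<le> u" "u < a" "b < v" "v \<le> 1" using d d' ab by (auto simp: u_def v_def)
    have "y \<notin> E" if "u < y" "y < v" for y
    proof
      assume y: "y \<in> E"
      with no consider "y < a" | "b < y" by force
      thus False
        by cases (use y d d' that ab in \<open>auto simp: dist_real_def u_def v_def\<close>)
    qed
    hence "{u<..<v} \<inter> E = {}" by auto
    hence sgn: "(\<forall>t\<in>{u..v}. 0 \<le> m' t) \<or> (\<forall>t\<in>{u..v}. m' t \<le> 0)" using uv ab by (intro E(2)) auto
    have ua: "a - u > 0" and vb: "v - b > 0" using uv by auto
    from ab(4) show False
    proof
      assume *: "left_incr m m' a \<and> right_decr m m' b"
      obtain e where e: "0 < e" "e \<le> a - u" "m (a - e) < m a"
        using left_incrE[OF conjunct1[OF *] ua] by (metis atLeastLessThan_iff diff_less order_refl less_eq_real_def diff_gt_0_iff_gt diff_less_eq less_add_same_cancel1)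
      obtain e' where e': "0 < e'" "e' \<le> v - b" "m (b + e') < m b"
        using right_decrE[OF conjunct2[OF *] vb] by (metis greaterThanAtMost_iff less_add_same_cancel1 order_refl)
      show False using sgn incr_le[of b "b + e'"] decr_le[of "a - e" a] e e' uv ab by fastforce
    next
      assume *: "left_decr m m' a \<and> right_incr m m' b"
      obtain e where e: "0 < e" "e \<le> a - u" "m a < m (a - e)"
        using left_decrE[OF conjunct1[OF *] ua] by (metis atLeastLessThan_iff diff_less order_refl less_eq_real_def diff_gt_0_iff_gt diff_less_eq less_add_same_cancel1)
      obtain e' where e': "0 < e'" "e' \<le> v - b" "m b < m (b + e')"
        using right_incrE[OF conjunct2[OF *] vb] by (metis greaterThanAtMost_iff less_add_same_cancel1 order_refl)
      show False using sgn decr_le[of b "b + e'"] incr_le[of "a - e" a] e e' uv ab by fastforce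
    qed
  qed
  have "M3 m m' \<subseteq> {(a, b). segment a b \<and> (\<exists>e\<in>E. a \<le> e \<and> e \<le> b)}"
       "M4 m m' \<subseteq> {(a, b). segment a b \<and> (\<exists>e\<in>E. a \<le> e \<and> e \<le> b)}"
    using meet by (auto simp: M_segments_iff segment_iff)
  thus "finite (M3 m m')" "finite (M4 m m')"
    using finite_segments_meeting[OF E(1)] finite_subset by blast+
  have "M1 m - {0, 1} \<subseteq> E"
  proof
    fix x assume "x \<in> M1 m - {0, 1}"
    hence "\<exists>e\<in>E. x \<le> e \<and> e \<le> x" by (intro meet) (auto simp: M1_iff)
    thus "x \<in> E" by auto
  qed
  thus "finite (M1 m - {0, 1})" using E(1) finite_subset by blast
qed

end

subsection \<open>The limiting quantities\<close>

locale advection_problem = potential m m' for m m' :: "real \<Rightarrow> real" +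
  fixes c :: "real \<Rightarrow> real" and L R :: bdry_cond
  assumes c_cont: "continuous_on {0..1} c"
    and nonconst: "\<not> m constant_on {0..1}"
    and L: "admissible_bc L" and R: "admissible_bc R"
begin

definition eigenvalue :: "real \<Rightarrow> real" where
  "eigenvalue s = principal_eigenvalue (\<lambda>x. 2 * s * m' x) c L R 0 1"

text \<open>The conditions under which a segment contributes to the limit, for all of
  $\mathcal{M}_2,\dots,\mathcal{M}_9$ at once.\<close>

definition entry_bc :: "real \<Rightarrow> bdry_cond" where
  "entry_bc a = (if a = 0 then L else if left_incr m m' a then Neumann else Dirichlet)"

text \<open>The condition encodes which angle must be passed at \<open>b\<close>. If m increases
  beyond \<open>b\<close>, anything in (0, pi) is drawn back to pi/2, so only passing pi counts
  (Dirichlet); if m decreases, passing pi/2 is enough (Neumann).\<close>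

definition exit_bc :: "real \<Rightarrow> bdry_cond" where
  "exit_bc b = (if b = 1 then R else if right_incr m m' b then Dirichlet else Neumann)"

definition segment_quantities :: "real set" where
  "segment_quantities = {lambda1 c (entry_bc a) (exit_bc b) a b | a b. segment a b}"

text \<open>An isolated maximum at an endpoint counts only under a Neumann condition there;
  otherwise there is slack, the initial angle being below pi/2 or the target above it.\<close>

definition point_quantities :: "real set" where
  "point_quantities = {c x | x. x \<in> M1 m \<and> (x = 0 \<longrightarrow> snd L = 0) \<and> (x = 1 \<longrightarrow> snd R = 0)}"

definition quantities :: "real set" where
  "quantities = segment_quantities \<union> point_quantities"

lemma point_quantity_mem:
  "\<lbrakk>x \<in> M1 m; x = 0 \<Longrightarrow> snd L = 0; x = 1 \<Longrightarrow> snd R = 0\<rbrakk> \<Longrightarrow> c x \<in> quantities"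
  unfolding quantities_def point_quantities_def by blast

lemma segment_quantity_mem:
  "segment a b \<Longrightarrow> lambda1 c (entry_bc a) (exit_bc b) a b \<in> quantities"
  unfolding quantities_def segment_quantities_def by blast

lemma c_near:
  assumes x: "0 \<le> x" "x \<le> 1" and "d > 0"
  obtains h where "h > 0" "\<And>t. t \<in> {0..1} \<Longrightarrow> \<bar>t - x\<bar> \<le> h \<Longrightarrow> \<bar>c t - c x\<bar> < d"
proof -
  obtain h where h: "h > 0" "\<And>t. t \<in> {0..1} \<Longrightarrow> dist t x < h \<Longrightarrow> dist (c t) (c x) < d"
    using c_cont x \<open>d > 0\<close> unfolding continuous_on_iff by (metis atLeastAtMost_iff)
  show thesis by (rule that[of "h / 2"]) (use h in \<open>auto simp: dist_real_def\<close>)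
qed

lemma admissible_entry_exit [simp]: "admissible_bc (entry_bc a)" "admissible_bc (exit_bc b)"
  using L R by (auto simp: entry_bc_def exit_bc_def)

lemma angle_family_exists:
  obtains K T where "angle_family (\<lambda>_. 1) (\<lambda>x. \<nu> - c x) m' K T" "\<And>s. T s 0 = bdry_angle L"
proof -
  have cB: "continuous_on {0..1} (\<lambda>x. \<nu> - c x)" by (intro continuous_intros c_cont)
  have cq: "continuous_on {0..1} (\<lambda>x. 2 * s * m' x)" for s
    using grad by (intro continuous_intros) (auto simp: gradient_on01_def)
  obtain K0 where K0: "K0 > 0" "\<And>x. x \<in> {0..1} \<Longrightarrow> \<bar>\<nu> - c x\<bar> \<le> K0"
    using continuous_on_Icc_abs_bound[OF cB] by metis
  have "\<exists>T. T 0 = bdry_angle L \<and> angle_sol (\<lambda>_. 1) (\<lambda>x. \<nu> - c x) (\<lambda>x. 2 * s * m' x) T 0 1" for s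
    using angle_sol_exists[OF zero_le_one continuous_on_const[of _ 1] cB cq] by metis
  then obtain T where "\<And>s. T s 0 = bdry_angle L"
    "\<And>s. angle_sol (\<lambda>_. 1) (\<lambda>x. \<nu> - c x) (\<lambda>x. 2 * s * m' x) (T s) 0 1" by metis
  moreover have "\<bar>\<nu> - c x\<bar> \<le> max 1 K0" if "x \<in> {0..1}" for x using K0(2)[OF that] by simp
  ultimately have "angle_family (\<lambda>_. 1) (\<lambda>x. \<nu> - c x) m' (max 1 K0) T" "\<And>s. T s 0 = bdry_angle L"
    by (simp_all add: angle_family_def)
  thus thesis using that by metis
qed

lemma eigenvalue_iff:
  assumes fam: "angle_family (\<lambda>_. 1) (\<lambda>x. \<nu> - c x) m' K T" and T0: "T s 0 = bdry_angle L"
  shows "\<nu> \<le> eigenvalue s \<longleftrightarrow> T s 1 \<le> pi - bdry_angle R"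
    and "eigenvalue s \<le> \<nu> \<longleftrightarrow> pi - bdry_angle R \<le> T s 1"
  using principal_eigenvalue_less_iff[OF zero_less_one L R angle_familyD(1)[OF fam] T0]
  unfolding eigenvalue_def by (auto simp flip: not_less)

lemma segment_angle:
  assumes ab: "segment a b"
  obtains \<psi> where "angle_sol (\<lambda>_. 1) (\<lambda>x. \<nu> - c x) (\<lambda>_. 0) \<psi> a b" "\<psi> a = bdry_angle (entry_bc a)"
    "\<nu> < lambda1 c (entry_bc a) (exit_bc b) a b \<longleftrightarrow> \<psi> b < pi - bdry_angle (exit_bc b)"
    "lambda1 c (entry_bc a) (exit_bc b) a b < \<nu> \<longleftrightarrow> pi - bdry_angle (exit_bc b) < \<psi> b"
proof -
  have ab': "0 \<le> a" "a < b" "b \<le> 1" using ab by (auto simp: segment_iff)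
  have "continuous_on {a..b} (\<lambda>x. \<nu> - c x)"
    by (rule continuous_on_subset[of "{0..1}"]) (use ab' c_cont in \<open>auto intro!: continuous_intros\<close>)
  then obtain \<psi> where \<psi>: "\<psi> a = bdry_angle (entry_bc a)" "angle_sol (\<lambda>_. 1) (\<lambda>x. \<nu> - c x) (\<lambda>_. 0) \<psi> a b"
    using angle_sol_exists[OF less_imp_le[OF ab'(2)] continuous_on_const[of _ 1] _ continuous_on_const[of _ 0]] by metis
  show thesis
    by (rule that[OF \<psi>(2,1)])
       (use principal_eigenvalue_less_iff[OF ab'(2) _ _ \<psi>(2,1)] in auto)
qed

lemma segment_deriv_zero: "segment a b \<Longrightarrow> t \<in> {a..b} \<Longrightarrow> m' t = 0"
  using flat_imp_deriv_zero[of a b t] by (auto simp: segment_iff)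

end

section \<open>Strict points and starts of flat stretches\<close>

context potential
begin

lemma potential_uminus: "potential (\<lambda>x. - m x) (\<lambda>x. - m' x)"
proof
  show "gradient_on01 (\<lambda>x. - m x) (\<lambda>x. - m' x)" using grad by (rule gradient_on01_uminus)
  show "finitely_many_sign_changes (\<lambda>x. - m' x)"
    using signs unfolding finitely_many_sign_changes_def by (simp add: disj_commute)
qed

text \<open>Any point \<open>w\<close> inside with \<open>m' w \<noteq> 0\<close> will do: an equal
  value at an earlier point would make m constant up to \<open>w\<close>, and then
  \<open>m' w = 0\<close>.\<close>

lemma increase_strict_point:
  assumes zx: "0 \<le> z" "z < x" "x \<le> 1" and nn: "\<And>t. t \<in> {z..x} \<Longrightarrow> 0 \<le> m' t" and less: "m z < m x"
  obtains w where "z < w" "w < x" "\<And>t. t \<in> {z..<w} \<Longrightarrow> m t < m w"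
proof -
  have "\<exists>w\<in>{z<..<x}. m' w \<noteq> 0"
  proof (rule ccontr)
    assume "\<not> (\<exists>w\<in>{z<..<x}. m' w \<noteq> 0)"
    hence "m x = m z" using zx by (intro deriv_zero_imp_flat[of z x]) auto
    thus False using less by simp
  qed
  then obtain w where w: "z < w" "w < x" "m' w \<noteq> 0" by auto
  have "m t < m w" if t: "t \<in> {z..<w}" for t
  proof (rule ccontr)
    assume n: "\<not> m t < m w"
    have le: "m u \<le> m v" if "t \<le> u" "u \<le> v" "v \<le> w" for u v
      by (rule incr_le) (use that t w zx nn in auto)
    have "m constant_on {t..w}"
    proof (rule constant_onI)
      fix u assume u: "u \<in> {t..w}"
      show "m u = m w" using le[of t u] le[of u w] n u by auto
    qed
    hence "m' w = 0" by (rule flat_imp_deriv_zero[rotated 3]) (use t w zx in auto)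
    thus False using w by simp
  qed
  thus thesis using that w by blast
qed

lemma decrease_strict_point:
  assumes zx: "0 \<le> z" "z < x" "x \<le> 1" and nn: "\<And>t. t \<in> {z..x} \<Longrightarrow> m' t \<le> 0" and less: "m x < m z"
  obtains w where "z < w" "w < x" "\<And>t. t \<in> {z..<w} \<Longrightarrow> m w < m t"
proof -
  obtain w where "z < w" "w < x" "\<And>t. t \<in> {z..<w} \<Longrightarrow> - m t < - m w"
    by (rule potential.increase_strict_point[OF potential_uminus zx]) (use nn less in auto)
  thus thesis using that by simp
qed

text \<open>Provides, close to \<open>x\<close>, earlier points of the same strict type. There a
  bound by pi/2 is already at hand, and the estimates up to \<open>x\<close> are started from
  them.\<close>

lemma left_incr_accumulates:
  assumes x: "left_incr m m' x" "x \<le> 1" and d: "d > 0"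
  obtains w where "x - d < w" "0 < w" "w < x" "left_incr m m' w"
    "\<And>t. t \<in> {w..x} \<Longrightarrow> 0 \<le> m' t" "\<And>t. t \<in> {w..<x} \<Longrightarrow> m t < m x"
proof -
  obtain e where e: "0 < e" "e \<le> d" "e \<le> x" "\<And>t. t \<in> {x-e..x} \<Longrightarrow> 0 \<le> m' t"
    "\<And>t. t \<in> {x-e..<x} \<Longrightarrow> m t < m x"
    using left_incrE[OF x(1) d] by metis
  obtain w where w: "x - e < w" "w < x" "\<And>t. t \<in> {x-e..<w} \<Longrightarrow> m t < m w"
    by (rule increase_strict_point[of "x - e" x]) (use e x in auto)
  have "left_incr m m' w"
    unfolding left_incr_def by (intro exI[of _ "w - (x - e)"]) (use w e(1,3,4) in auto)
  thus thesis by (intro that[of w]) (use w e in auto)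
qed

lemma left_decr_accumulates:
  assumes x: "left_decr m m' x" "x \<le> 1" and d: "d > 0"
  obtains w where "x - d < w" "0 < w" "w < x" "left_decr m m' w"
    "\<And>t. t \<in> {w..x} \<Longrightarrow> m' t \<le> 0" "\<And>t. t \<in> {w..<x} \<Longrightarrow> m x < m t"
proof -
  have eq: "left_incr (\<lambda>x. - m x) (\<lambda>x. - m' x) y = left_decr m m' y" for y
    by (simp add: left_incr_def left_decr_def)
  show thesis
    using potential.left_incr_accumulates[OF potential_uminus, unfolded eq, OF x d] that by auto
qed

text \<open>Take the infimum of the points from which m is constant up to \<open>x\<close>;
  constancy passes to it by continuity. It is the left endpoint of the segment through
  \<open>x\<close>.\<close>

lemma flat_start:
  assumes x: "left_flat m x" "x \<le> 1"
  obtains a where "0 \<le> a" "a < x" "m constant_on {a..x}" "0 < a \<longrightarrow> \<not> left_flat m a"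
proof -
  define S where "S = {y. 0 \<le> y \<and> y \<le> x \<and> m constant_on {y..x}}"
  obtain e where e: "e > 0" "e \<le> x" "m constant_on {x-e..x}" using x(1) by (auto simp: left_flat_def)
  have bdd: "bdd_below S" unfolding S_def by (intro bdd_belowI[of _ 0]) auto
  have eS: "x - e \<in> S" using e by (auto simp: S_def)
  define a where "a = Inf S"
  have a0: "0 \<le> a" unfolding a_def
  proof (rule cInf_greatest)
    show "S \<noteq> {}" using eS by blast
  qed (simp add: S_def)
  have ax: "a < x" using cInf_lower[OF eS bdd] e(1) by (simp add: a_def)
  have c1: "m t = m x" if t: "a < t" "t \<le> x" for t
  proof -
    have "S \<noteq> {}" using eS by blast
    then obtain y where y: "y \<in> S" "y < t" using t(1) cInf_less_iff[OF _ bdd, of t] unfolding a_def by blast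
    thus ?thesis using constant_onD[of m "{y..x}" t x] t by (auto simp: S_def)
  qed
  have "m a = m x"
  proof (rule ccontr)
    assume ne: "m a \<noteq> m x"
    have "continuous_on {a..x} m"
      by (rule continuous_on_subset[OF gradient_continuous[OF grad]]) (use a0 x(2) in auto)
    hence "((m \<longlongrightarrow> m a) (at a within {a..x}))" using ax by (auto simp: continuous_on_def)
    hence "((m \<longlongrightarrow> m a) (at_right a))" using ax by (simp add: at_within_Icc_at_right)
    moreover have "\<forall>\<^sub>F t in at_right a. m t = m x"
      using eventually_at_right_real[OF ax] by (rule eventually_mono) (rule c1; simp)
    hence "((m \<longlongrightarrow> m x) (at_right a))" by (rule tendsto_eventually)
    ultimately show False using ne tendsto_unique[OF trivial_limit_at_right_real] by blast
  qed
  hence "m t = m x" if "t \<in> {a..x}" for t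
    using c1[of t] that by (cases "t = a") (simp, force)
  hence const: "m constant_on {a..x}" by (rule constant_onI)
  have "\<not> left_flat m a"
  proof
    assume "left_flat m a"
    then obtain d where d: "d > 0" "d \<le> a" "m constant_on {a-d..a}" by (auto simp: left_flat_def)
    have "m constant_on {a-d..x}"
    proof (rule constant_onI)
      fix t assume t: "t \<in> {a-d..x}"
      show "m t = m a"
      proof (cases "t \<le> a")
        case True
        show ?thesis by (rule constant_onD[OF d(3)]) (use t True d in auto)
      next
        case False
        show ?thesis by (rule constant_onD[OF const]) (use t False ax in auto)
      qed
    qed
    hence "a - d \<in> S" using d a0 ax by (auto simp: S_def)
    from cInf_lower[OF this bdd] show False using d(1) by (simp add: a_def)
  qed
  thus thesis using that a0 ax const by blast
qed

end

subsection \<open>Lower bound\<close>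

text \<open>The infimum of the counterexamples satisfies \<open>P\<close> by \<open>zero\<close> or
  the left step, and then the right step pushes the infimum further right.\<close>

lemma real_induct_01:
  fixes P :: "real \<Rightarrow> bool"
  assumes zero: "P 0"
    and right: "\<And>x. 0 \<le> x \<Longrightarrow> x < 1 \<Longrightarrow> P x \<Longrightarrow> \<exists>z>x. \<forall>y\<in>{x<..<z}. P y"
    and left: "\<And>x. 0 < x \<Longrightarrow> x \<le> 1 \<Longrightarrow> (\<And>y. 0 \<le> y \<Longrightarrow> y < x \<Longrightarrow> P y) \<Longrightarrow> P x"
    and x: "0 \<le> x" "x \<le> 1"
  shows "P x"
proof (rule ccontr)
  assume nP: "\<not> P x"
  define S where "S = {y. 0 \<le> y \<and> y \<le> 1 \<and> \<not> P y}"
  have xS: "x \<in> S" using x nP by (simp add: S_def)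
  have bdd: "bdd_below S" unfolding S_def by (intro bdd_belowI[of _ 0]) auto
  define i where "i = Inf S"
  have i0: "0 \<le> i" unfolding i_def
  proof (rule cInf_greatest)
    show "S \<noteq> {}" using xS by blast
  qed (simp add: S_def)
  have ix: "i \<le> x" unfolding i_def by (rule cInf_lower[OF xS bdd])
  note i = i0 ix
  have below: "P y" if "0 \<le> y" "y < i" for y
  proof (rule ccontr)
    assume "\<not> P y"
    hence "y \<in> S" using that i x by (simp add: S_def)
    from cInf_lower[OF this bdd] show False using that by (simp add: i_def)
  qed
  have Pi: "P i"
  proof (cases "i = 0")
    case False
    show ?thesis by (rule left) (use False i x below in auto)
  qed (use zero in simp)
  have "i < 1" using Pi nP i x by (cases "i = x") auto
  then obtain z where z: "z > i" "\<forall>y\<in>{i<..<z}. P y" using right[OF i(1) _ Pi] by blast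
  have "z \<le> i" unfolding i_def
  proof (rule cInf_greatest)
    show "S \<noteq> {}" using xS by blast
    fix y assume y: "y \<in> S"
    have "i \<le> y" unfolding i_def using cInf_lower[OF y bdd] .
    moreover have "i \<noteq> y" using Pi y by (auto simp: S_def)
    ultimately show "z \<le> y" using z(2) y by (force simp: S_def)
  qed
  thus False using z(1) by simp
qed

context advection_problem
begin

text \<open>To the right of an isolated maximum \<open>\<pi>/2\<close> repels with a rate growing with \<open>s\<close>, so that a bound
  \<open>limsup \<le> \<pi>/2\<close> would not propagate: the angles must be at most \<open>\<pi>/2\<close> exactly.\<close>

definition controlled :: "real \<Rightarrow> (real \<Rightarrow> real \<Rightarrow> real) \<Rightarrow> real \<Rightarrow> bool" where
  "controlled \<nu> T x \<longleftrightarrow>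
     (left_incr m m' x \<longrightarrow> limsup_le T x (pi / 2)) \<and>
     (left_decr m m' x \<longrightarrow> limsup_le T x 0) \<and>
     (right_incr m m' x \<longrightarrow> (\<exists>\<alpha><pi. limsup_le T x \<alpha>)) \<and>
     (right_decr m m' x \<longrightarrow> (\<exists>\<alpha><pi / 2. limsup_le T x \<alpha>) \<or>
        (\<nu> < c x \<and> (\<forall>\<^sub>F s in at_top. T s x \<le> pi / 2)))"

section \<open>Propagation of upper bounds for the angle\<close>

context
  fixes \<nu> K T
  assumes fam: "angle_family (\<lambda>_. 1) (\<lambda>x. \<nu> - c x) m' K T" and T0: "\<And>s. T s 0 = bdry_angle L"
begin

lemma K_pos: "K > 0"
  by (rule angle_familyD(2)[OF fam])

lemma short_step:
  assumes "d > 0"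
  obtains h where "h > 0" "\<And>r. r \<le> h \<Longrightarrow> K * r < d"
proof (rule that[of "d / (2 * K)"])
  show "d / (2 * K) > 0" using assms K_pos by simp
  fix r assume "r \<le> d / (2 * K)"
  hence "K * r \<le> K * (d / (2 * K))" using K_pos by (intro mult_left_mono) auto
  thus "K * r < d" using K_pos assms by simp
qed

text \<open>Inside an increasing stretch \<open>y\<close> has no decreasing type; the stretch
  continues to \<open>z\<close> in order to exclude it on the right as well. A strict left type at
  \<open>y\<close> makes \<open>m y\<close> exceed all values back to \<open>x\<close>, as the
  damping from \<open>x\<close> requires.\<close>

lemma controlled_in_increase:
  assumes x: "0 \<le> x" "x < y" "y < z" "z \<le> 1" and nn: "\<And>t. t \<in> {x..z} \<Longrightarrow> 0 \<le> m' t"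
    and ub: "limsup_le T x \<alpha>" and \<alpha>: "pi / 2 \<le> \<alpha>" "\<alpha> + K * (z - x) < pi"
  shows "controlled \<nu> T y"
proof -
  have "K * (y - x) \<le> K * (z - x)" using K_pos x by (intro mult_left_mono) auto
  hence lt: "\<alpha> + K * (y - x) < pi" using \<alpha> by simp
  have le: "m u \<le> m v" if "x \<le> u" "u \<le> v" "v \<le> z" for u v
    by (rule incr_le) (use that x nn in auto)
  have 1: "limsup_le T y (pi / 2)" if i: "left_incr m m' y"
  proof (rule limsup_le_increase[OF fam grad _ _ _ _ _ ub \<alpha>(1) lt])
    fix t assume t: "t \<in> {x..<y}"
    have yt: "y - t > 0" using t by simp
    obtain e where e: "0 < e" "e \<le> y - t" "\<And>t. t \<in> {y-e..<y} \<Longrightarrow> m t < m y"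
      using left_incrE[OF i yt] by metis
    have "m t \<le> m (y - e)" by (rule le) (use e x t in auto)
    also have "\<dots> < m y" using e by auto
    finally show "m t < m y" .
  qed (use x nn in auto)
  have 2: "\<not> left_decr m m' y"
  proof
    assume i: "left_decr m m' y"
    have yt: "y - x > 0" using x by simp
    obtain e where e: "0 < e" "e \<le> y - x" "\<And>t. t \<in> {y-e..<y} \<Longrightarrow> m y < m t"
      using left_decrE[OF i yt] by metis
    have "m (y - e) \<le> m y" by (rule le) (use e x in auto)
    thus False using e(1) e(3)[of "y - e"] by simp
  qed
  have 3: "\<not> right_decr m m' y"
  proof
    assume i: "right_decr m m' y"
    have yt: "z - y > 0" using x by simp
    obtain e where e: "0 < e" "e \<le> z - y" "\<And>t. t \<in> {y<..y+e} \<Longrightarrow> m t < m y"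
      using right_decrE[OF i yt] by metis
    have "m y \<le> m (y + e)" by (rule le) (use e x in auto)
    thus False using e(1) e(3)[of "y + e"] by simp
  qed
  have "limsup_le T y (\<alpha> + K * (y - x))"
    by (rule limsup_le_drift_up(1)[OF fam grad _ _ _ _ ub \<alpha>(1) lt]) (use x nn in auto)
  with lt show ?thesis unfolding controlled_def using 1 2 3 by blast
qed

lemma controlled_in_decrease:
  assumes x: "0 \<le> x" "x < y" "y < z" "z \<le> 1" and nn: "\<And>t. t \<in> {x..z} \<Longrightarrow> m' t \<le> 0"
    and ub: "limsup_le T x \<alpha>" and \<alpha>: "0 \<le> \<alpha>" "\<alpha> + K * (z - x) < pi / 2"
  shows "controlled \<nu> T y"
proof -
  have "K * (y - x) \<le> K * (z - x)" using K_pos x by (intro mult_left_mono) auto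
  hence lt: "\<alpha> + K * (y - x) < pi / 2" using \<alpha> by simp
  have le: "m v \<le> m u" if "x \<le> u" "u \<le> v" "v \<le> z" for u v
    by (rule decr_le) (use that x nn in auto)
  have 1: "limsup_le T y 0" if i: "left_decr m m' y"
  proof (rule limsup_le_decrease[OF fam grad _ _ _ _ _ ub \<alpha>(1) lt])
    fix t assume t: "t \<in> {x..<y}"
    have yt: "y - t > 0" using t by simp
    obtain e where e: "0 < e" "e \<le> y - t" "\<And>t. t \<in> {y-e..<y} \<Longrightarrow> m y < m t"
      using left_decrE[OF i yt] by metis
    have "m y < m (y - e)" using e by auto
    also have "\<dots> \<le> m t" by (rule le) (use e x t in auto)
    finally show "m y < m t" .
  qed (use x nn in auto)
  have 2: "\<not> left_incr m m' y"
  proof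
    assume i: "left_incr m m' y"
    have yt: "y - x > 0" using x by simp
    obtain e where e: "0 < e" "e \<le> y - x" "\<And>t. t \<in> {y-e..<y} \<Longrightarrow> m t < m y"
      using left_incrE[OF i yt] by metis
    have "m y \<le> m (y - e)" by (rule le) (use e x in auto)
    thus False using e(1) e(3)[of "y - e"] by simp
  qed
  have 3: "\<not> right_incr m m' y"
  proof
    assume i: "right_incr m m' y"
    have yt: "z - y > 0" using x by simp
    obtain e where e: "0 < e" "e \<le> z - y" "\<And>t. t \<in> {y<..y+e} \<Longrightarrow> m y < m t"
      using right_incrE[OF i yt] by metis
    have "m (y + e) \<le> m y" by (rule le) (use e x in auto)
    thus False using e(1) e(3)[of "y + e"] by simp
  qed
  have "limsup_le T y (\<alpha> + K * (y - x))"
    by (rule limsup_le_drift_down[OF fam grad _ _ _ _ ub \<alpha>(1) lt]) (use x nn in auto)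
  with lt show ?thesis unfolding controlled_def using 1 2 3 by blast
qed

text \<open>For each right type \<open>controlled\<close> contains the bound from which the matching
  barrier can start at \<open>x\<close>. The delicate case is an isolated maximum, where a gap below
  pi/2 has to be gained first.\<close>

lemma controlled_right:
  assumes x: "0 \<le> x" "x < 1" and ctrl: "controlled \<nu> T x"
  shows "\<exists>z>x. \<forall>y\<in>{x<..<z}. controlled \<nu> T y"
proof -
  consider "right_incr m m' x" | "right_decr m m' x" | "right_flat m x" using right_cases[OF x] by blast
  thus ?thesis
  proof cases
    case 1
    then obtain \<beta> where \<beta>: "\<beta> < pi" "limsup_le T x \<beta>" using ctrl by (auto simp: controlled_def)
    define \<alpha> where "\<alpha> = max \<beta> (pi / 2)"
    have \<alpha>: "limsup_le T x \<alpha>" "pi / 2 \<le> \<alpha>" "pi - \<alpha> > 0"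
      using limsup_le_mono[OF \<beta>(2)] \<beta>(1) by (auto simp: \<alpha>_def)
    obtain h where h: "h > 0" "\<And>r. r \<le> h \<Longrightarrow> K * r < pi - \<alpha>" using short_step[OF \<alpha>(3)] by metis
    obtain e where e: "0 < e" "e \<le> h" "x + e \<le> 1" "\<And>t. t \<in> {x..x+e} \<Longrightarrow> 0 \<le> m' t"
      using right_incrE[OF 1 h(1)] by metis
    have "controlled \<nu> T y" if y: "y \<in> {x<..<x+e}" for y
    proof (rule controlled_in_increase[OF x(1) _ _ e(3,4) \<alpha>(1,2)])
      show "\<alpha> + K * (x + e - x) < pi" using h(2)[OF e(2)] by simp
    qed (use y in auto)
    thus ?thesis using e(1) by (intro exI[of _ "x + e"]) auto
  next
    case 2
    show ?thesis
    proof (cases "\<exists>\<beta><pi / 2. limsup_le T x \<beta>")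
      case True
      then obtain \<beta> where \<beta>: "\<beta> < pi / 2" "limsup_le T x \<beta>" by blast
      define \<alpha> where "\<alpha> = max \<beta> 0"
      have \<alpha>: "limsup_le T x \<alpha>" "0 \<le> \<alpha>" "pi / 2 - \<alpha> > 0"
        using limsup_le_mono[OF \<beta>(2)] \<beta>(1) pi_gt_zero by (auto simp: \<alpha>_def max_def)
      obtain h where h: "h > 0" "\<And>r. r \<le> h \<Longrightarrow> K * r < pi / 2 - \<alpha>" using short_step[OF \<alpha>(3)] by metis
      obtain e where e: "0 < e" "e \<le> h" "x + e \<le> 1" "\<And>t. t \<in> {x..x+e} \<Longrightarrow> m' t \<le> 0"
        using right_decrE[OF 2 h(1)] by metis
      have "controlled \<nu> T y" if y: "y \<in> {x<..<x+e}" for y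
      proof (rule controlled_in_decrease[OF x(1) _ _ e(3,4) \<alpha>(1,2)])
        show "\<alpha> + K * (x + e - x) < pi / 2" using h(2)[OF e(2)] by simp
      qed (use y in auto)
      thus ?thesis using e(1) by (intro exI[of _ "x + e"]) auto
    next
      case False
      hence c: "\<nu> < c x" and half: "\<forall>\<^sub>F s in at_top. T s x \<le> pi / 2"
        using ctrl 2 by (auto simp: controlled_def)
      \<comment> \<open>Half the margin at \<open>x\<close>; the other half absorbs the variation of
        c nearby.\<close>
      define g where "g = (c x - \<nu>) / 2"
      have g: "g > 0" using c by (simp add: g_def)
      obtain h where h: "h > 0" "\<And>t. t \<in> {0..1} \<Longrightarrow> \<bar>t - x\<bar> \<le> h \<Longrightarrow> \<bar>c t - c x\<bar> < g"
        using c_near[OF x(1) less_imp_le[OF x(2)] g] by metis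
      obtain e where e: "0 < e" "e \<le> h" "x + e \<le> 1" "\<And>t. t \<in> {x..x+e} \<Longrightarrow> m' t \<le> 0"
        using right_decrE[OF 2 h(1)] by metis
      define k where "k = g / (1 + K + g)"
      have k: "0 < k" "k \<le> 1" using g K_pos by (auto simp: k_def)
      have below: "limsup_le T y (pi / 2 - k * (y - x))" if y: "x \<le> y" "y \<le> x + e" for y
      proof -
        have "\<forall>\<^sub>F s in at_top. T s y \<le> pi / 2 - g / (1 + K + g) * (y - x)"
        proof (rule eventually_le_past_maximum[OF fam x(1) y(1) _ _ _ g half])
          fix t assume t: "t \<in> {x..y}"
          have "\<bar>c t - c x\<bar> < g" by (rule h(2)) (use t y e x in auto)
          thus "\<nu> - c t \<le> - g" unfolding g_def by (simp add: abs_if field_simps split: if_splits)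
        qed (use y e in auto)
        thus ?thesis unfolding limsup_le_def k_def by (auto elim!: eventually_mono)
      qed
      have "controlled \<nu> T y" if y: "y \<in> {x<..<x+e}" for y
      proof -
        have ky: "k * (y - x) > 0" using k y by simp
        \<comment> \<open>From the midpoint of \<open>x\<close> and \<open>y\<close> on, the gap
          below pi/2 is at least \<open>q\<close>. The restarting point \<open>w\<close> lies past
          the midpoint and so close to \<open>y\<close> that the error up to \<open>z\<close> stays
          below \<open>q\<close>.\<close>
        define q where "q = k * (y - x) / 2"
        have q: "q > 0" using ky by (simp add: q_def)
        obtain r where r: "r > 0" "\<And>t. t \<le> r \<Longrightarrow> K * t < q" using short_step[OF q] by metis
        define w where "w = max ((x + y) / 2) (y - r / 2)"
        have w: "x < w" "w < y" "(x + y) / 2 \<le> w" "y - w \<le> r / 2" using y r(1) by (auto simp: w_def max_def field_simps)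
        define z where "z = min (x + e) (w + r)"
        have z: "y < z" "z \<le> x + e" "z - w \<le> r" using y w r(1) by (auto simp: z_def)
        have "k * ((y - x) / 2) \<le> k * (w - x)" using k w by (intro mult_left_mono) (auto simp: field_simps)
        hence qw: "q \<le> k * (w - x)" by (simp add: q_def)
        have "k * (w - x) \<le> 1 * 1" using k w y e x by (intro mult_mono) auto
        hence kw: "0 \<le> pi / 2 - k * (w - x)" using pi_gt3 by simp
        have lt: "pi / 2 - k * (w - x) + K * (z - w) < pi / 2" using r(2)[OF z(3)] qw by simp
        have uw: "limsup_le T w (pi / 2 - k * (w - x))" by (rule below) (use w y in auto)
        show ?thesis
          by (rule controlled_in_decrease[OF _ w(2) z(1) _ _ uw kw lt]) (use w x z e in auto)
      qed
      thus ?thesis using e(1) by (intro exI[of _ "x + e"]) auto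
    qed
  next
    case 3
    \<comment> \<open>Interior points of a flat stretch have no strict type on either side, so
      \<open>controlled\<close> holds vacuously there.\<close>
    then obtain e where e: "0 < e" "x + e \<le> 1" "m constant_on {x..x+e}" by (auto simp: right_flat_def)
    have "controlled \<nu> T y" if y: "y \<in> {x<..<x+e}" for y
    proof -
      have "m constant_on {y - (y - x)..y}" "m constant_on {y..y + (x + e - y)}"
        using y by (auto intro!: constant_on_subset[OF e(3)])
      hence "left_flat m y" "right_flat m y"
        unfolding left_flat_def right_flat_def using y e(2) x
        by (intro exI[of _ "y - x"]; simp; fail) (intro exI[of _ "x + e - y"]; use \<open>m constant_on {y..y + (x + e - y)}\<close> y e(2) in simp)
      thus ?thesis using left_types_exclusive[of m m' y] right_types_exclusive[of m m' y]
        unfolding controlled_def by blast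
    qed
    thus ?thesis using e(1) by (intro exI[of _ "x + e"]) auto
  qed
qed

lemma limsup_le_entry:
  assumes ab: "segment a b" and ctrl: "controlled \<nu> T a"
  shows "limsup_le T a (bdry_angle (entry_bc a))"
proof (cases "a = 0")
  case True
  thus ?thesis using T0 by (auto simp: entry_bc_def limsup_le_def)
next
  case False
  hence "left_incr m m' a \<or> left_decr m m' a" using left_cases[of a] ab by (auto simp: segment_iff)
  thus ?thesis using False ctrl left_types_exclusive(1)[of m m' a] by (auto simp: entry_bc_def controlled_def)
qed

lemma limsup_le_exit:
  assumes ab: "segment a b" and ctrl: "controlled \<nu> T a"
    and less: "\<nu> < lambda1 c (entry_bc a) (exit_bc b) a b"
  obtains \<beta> where "\<beta> < pi - bdry_angle (exit_bc b)" "limsup_le T b \<beta>"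
proof -
  have ab': "0 \<le> a" "a \<le> b" "b \<le> 1" using ab by (auto simp: segment_iff)
  obtain \<psi> where \<psi>: "angle_sol (\<lambda>_. 1) (\<lambda>x. \<nu> - c x) (\<lambda>_. 0) \<psi> a b" "\<psi> a = bdry_angle (entry_bc a)"
    "\<psi> b < pi - bdry_angle (exit_bc b)"
    using segment_angle[OF ab, of \<nu>] less by metis
  have "limsup_le T b (\<psi> b)"
    by (rule limsup_le_flat[OF fam ab' segment_deriv_zero[OF ab] \<psi>(1)])
       (use limsup_le_entry[OF ab ctrl] \<psi>(2) in auto)
  thus thesis using that \<psi>(3) by blast
qed

text \<open>Choose \<open>w\<close> so close to \<open>x\<close> that \<nu> stays below c on [w, x].
  The asymptotic bound at \<open>w\<close> is then sharpened to an exact one at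
  \<open>x\<close>.\<close>

lemma eventually_le_at_maximum:
  assumes x: "0 < x" "x \<le> 1" and incr: "left_incr m m' x" and less: "\<nu> < c x"
    and ctrl: "\<And>y. 0 \<le> y \<Longrightarrow> y < x \<Longrightarrow> controlled \<nu> T y"
  shows "\<forall>\<^sub>F s in at_top. T s x \<le> pi / 2"
proof -
  define g where "g = (c x - \<nu>) / 2"
  have g: "g > 0" using less by (simp add: g_def)
  obtain h where h: "h > 0" "\<And>t. t \<in> {0..1} \<Longrightarrow> \<bar>t - x\<bar> \<le> h \<Longrightarrow> \<bar>c t - c x\<bar> < g"
    using c_near[OF less_imp_le[OF x(1)] x(2) g] by metis
  obtain w where w: "x - h < w" "0 < w" "w < x" "left_incr m m' w" "\<And>t. t \<in> {w..x} \<Longrightarrow> 0 \<le> m' t"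
    using left_incr_accumulates[OF incr x(2) h(1)] by metis
  show ?thesis
  proof (rule eventually_le_before_maximum[OF fam _ w(3) x(2) w(5) _ g])
    fix t assume t: "t \<in> {w..x}"
    have "\<bar>c t - c x\<bar> < g" by (rule h(2)) (use t w x in auto)
    thus "\<nu> - c t \<le> - g" unfolding g_def by (simp add: abs_if field_simps split: if_splits)
  next
    show "limsup_le T w (pi / 2)" using ctrl[of w] w by (simp add: controlled_def)
  qed (use w in auto)
qed

lemma limsup_le_from_left:
  assumes x: "0 < x" "x \<le> 1" and ctrl: "\<And>y. 0 \<le> y \<Longrightarrow> y < x \<Longrightarrow> controlled \<nu> T y"
  shows "left_incr m m' x \<Longrightarrow> limsup_le T x (pi / 2)" and "left_decr m m' x \<Longrightarrow> limsup_le T x 0"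
proof -
  have p2: "pi / 2 > 0" by simp
  obtain h where h: "h > 0" "\<And>r. r \<le> h \<Longrightarrow> K * r < pi / 2" using short_step[OF p2] by metis
  show "limsup_le T x (pi / 2)" if i: "left_incr m m' x"
  proof -
    obtain w where w: "x - h < w" "0 < w" "w < x" "left_incr m m' w"
      "\<And>t. t \<in> {w..x} \<Longrightarrow> 0 \<le> m' t" "\<And>t. t \<in> {w..<x} \<Longrightarrow> m t < m x"
      using left_incr_accumulates[OF i x(2) h(1)] by metis
    have uw: "limsup_le T w (pi / 2)" using ctrl[of w] w by (simp add: controlled_def)
    show ?thesis
      by (rule limsup_le_increase[OF fam grad _ w(3) x(2) w(5,6) uw]) (use w h(2)[of "x - w"] in auto)
  qed
  show "limsup_le T x 0" if i: "left_decr m m' x"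
  proof -
    obtain w where w: "x - h < w" "0 < w" "w < x" "left_decr m m' w"
      "\<And>t. t \<in> {w..x} \<Longrightarrow> m' t \<le> 0" "\<And>t. t \<in> {w..<x} \<Longrightarrow> m x < m t"
      using left_decr_accumulates[OF i x(2) h(1)] by metis
    have uw: "limsup_le T w 0" using ctrl[of w] w by (simp add: controlled_def)
    show ?thesis
      by (rule limsup_le_decrease[OF fam grad _ w(3) x(2) w(5,6) uw]) (use w h(2)[of "x - w"] in auto)
  qed
qed

text \<open>That \<nu> is below the limiting quantities enters in two places: when \<open>x\<close>
  is an isolated maximum and when a segment ends at \<open>x\<close>. The other types follow from
  the drift alone.\<close>

lemma controlled_left:
  assumes below: "\<And>q. q \<in> quantities \<Longrightarrow> \<nu> < q"
    and x: "0 < x" "x \<le> 1" and ctrl: "\<And>y. 0 \<le> y \<Longrightarrow> y < x \<Longrightarrow> controlled \<nu> T y"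
  shows "controlled \<nu> T x"
proof -
  have lt1: "x < 1" if "right_incr m m' x \<or> right_decr m m' x"
    using that by (auto simp: right_incr_def right_decr_def)
  consider "left_incr m m' x" | "left_decr m m' x" | "left_flat m x" using left_cases[OF x] by blast
  thus ?thesis
  proof cases
    case 1
    have ub: "limsup_le T x (pi / 2)" by (rule limsup_le_from_left(1)[OF x ctrl 1])
    have "\<nu> < c x \<and> (\<forall>\<^sub>F s in at_top. T s x \<le> pi / 2)" if d: "right_decr m m' x"
    proof -
      have "x \<in> M1 m" using 1 d x by (simp add: M1_iff)
      hence "\<nu> < c x" using x lt1 d by (intro below point_quantity_mem) auto
      thus ?thesis using eventually_le_at_maximum[OF x 1 _ ctrl] by blast
    qed
    moreover have "pi / 2 < pi" by simp
    ultimately show ?thesis unfolding controlled_def using ub left_types_exclusive(1)[OF 1] by blast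
  next
    case 2
    have ub: "limsup_le T x 0" by (rule limsup_le_from_left(2)[OF x ctrl 2])
    moreover have "0 < pi" "0 < pi / 2" by simp_all
    ultimately show ?thesis unfolding controlled_def using left_types_exclusive(1)[of m m' x] 2 by blast
  next
    case 3
    show ?thesis
    proof (cases "right_flat m x")
      case True
      thus ?thesis using 3 left_types_exclusive[of m m' x] right_types_exclusive[of m m' x]
        unfolding controlled_def by blast
    next
      case False
      obtain a where a: "0 \<le> a" "a < x" "m constant_on {a..x}" "0 < a \<longrightarrow> \<not> left_flat m a"
        using flat_start[OF 3 x(2)] by metis
      have seg: "segment a x" using a x False by (simp add: segment_iff)
      obtain \<beta> where \<beta>: "\<beta> < pi - bdry_angle (exit_bc x)" "limsup_le T x \<beta>"
        by (rule limsup_le_exit[OF seg ctrl[OF a(1,2)] below[OF segment_quantity_mem[OF seg]]])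
      have "\<beta> < pi" using \<beta>(1) bdry_angle_bounds(1)[of "exit_bc x"] by simp
      \<comment> \<open>Here \<open>exit_bc x\<close> is Neumann, so the value not to be reached is
        pi/2.\<close>
      moreover have "\<beta> < pi / 2" if "right_decr m m' x"
        using \<beta>(1) lt1 that right_types_exclusive(1)[of m m' x] by (auto simp: exit_bc_def split: if_splits)
      ultimately show ?thesis
        using \<beta>(2) 3 left_types_exclusive[of m m' x] unfolding controlled_def by blast
    qed
  qed
qed

lemma controlled_zero:
  assumes below: "\<And>q. q \<in> quantities \<Longrightarrow> \<nu> < q"
  shows "controlled \<nu> T 0"
proof -
  have nl: "\<not> left_incr m m' 0" "\<not> left_decr m m' 0" by (auto simp: left_incr_def left_decr_def)
  have ub: "limsup_le T 0 (bdry_angle L)" using T0 by (auto simp: limsup_le_def)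
  have "bdry_angle L < pi" using bdry_angle_bounds(2)[OF L] pi_gt_zero by linarith
  \<comment> \<open>For \<open>snd L \<noteq> 0\<close> the initial angle is strictly below pi/2
    already.\<close>
  moreover have "\<nu> < c 0 \<and> (\<forall>\<^sub>F s in at_top. T s 0 \<le> pi / 2)"
    if d: "right_decr m m' 0" "snd L = 0"
  proof -
    have "0 \<in> M1 m" using d by (simp add: M1_iff)
    hence "\<nu> < c 0" using d by (intro below point_quantity_mem) auto
    thus ?thesis using T0 bdry_angle_bounds(2)[OF L] by simp
  qed
  ultimately show ?thesis
    unfolding controlled_def using nl ub bdry_angle_bounds(3)[OF L] by blast
qed

text \<open>All cases leave room below the target except a strict increase up to 1 with
  \<open>snd R = 0\<close>: there the target is exactly pi/2 and the exact bound is needed.\<close>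

lemma eventually_angle_le_target:
  assumes below: "\<And>q. q \<in> quantities \<Longrightarrow> \<nu> < q"
  shows "\<forall>\<^sub>F s in at_top. T s 1 \<le> pi - bdry_angle R"
proof -
  have ctrl: "controlled \<nu> T x" if "0 \<le> x" "x \<le> 1" for x
    by (rule real_induct_01[where P="controlled \<nu> T"])
       (use that controlled_zero[OF below] controlled_right controlled_left[OF below] in auto)
  have Rb: "bdry_angle R \<le> pi / 2" "snd R \<noteq> 0 \<Longrightarrow> bdry_angle R < pi / 2"
    using bdry_angle_bounds[OF R] by auto
  consider "left_incr m m' 1" | "left_decr m m' 1" | "left_flat m 1" using left_cases[of 1] by auto
  thus ?thesis
  proof cases
    case 1
    show ?thesis
    proof (cases "snd R = 0")
      case True
      have "1 \<in> M1 m" using 1 by (simp add: M1_iff)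
      hence "\<nu> < c 1" using True by (intro below point_quantity_mem) auto
      hence "\<forall>\<^sub>F s in at_top. T s 1 \<le> pi / 2"
        using eventually_le_at_maximum[OF zero_less_one order_refl 1 _ ctrl] by simp
      thus ?thesis using Rb by (auto elim!: eventually_mono)
    next
      case False
      have "limsup_le T 1 (pi / 2)" using ctrl[of 1] 1 by (simp add: controlled_def)
      thus ?thesis by (rule limsup_leD) (use Rb(2)[OF False] in simp)
    qed
  next
    case 2
    have "limsup_le T 1 0" using ctrl[of 1] 2 by (simp add: controlled_def)
    thus ?thesis by (rule limsup_leD) (use Rb(1) pi_gt_zero in linarith)
  next
    case 3
    obtain a where a: "0 \<le> a" "a < 1" "m constant_on {a..1}" "0 < a \<longrightarrow> \<not> left_flat m a"
      using flat_start[OF 3 order_refl] by metis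
    have seg: "segment a 1" using a by (simp add: segment_iff)
    obtain \<beta> where \<beta>: "\<beta> < pi - bdry_angle (exit_bc 1)" "limsup_le T 1 \<beta>"
      by (rule limsup_le_exit[OF seg ctrl below[OF segment_quantity_mem[OF seg]]]) (use a in auto)
    from \<beta>(2) show ?thesis by (rule limsup_leD) (use \<beta>(1) in \<open>simp add: exit_bc_def\<close>)
  qed
qed

end

theorem eigenvalue_lower_bound:
  assumes "\<And>q. q \<in> quantities \<Longrightarrow> \<nu> < q"
  shows "\<forall>\<^sub>F s in at_top. \<nu> \<le> eigenvalue s"
proof -
  obtain K T where fam: "angle_family (\<lambda>_. 1) (\<lambda>x. \<nu> - c x) m' K T" and T0: "\<And>s. T s 0 = bdry_angle L"
    using angle_family_exists by metis
  show ?thesis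
    using eventually_angle_le_target[OF fam T0 assms] eigenvalue_iff(1)[OF fam T0] by simp
qed

end

subsection \<open>Upper bound\<close>

text \<open>Near 0 the bounded terms contribute at least 1 - e - K e, and the drift has the helpful
  sign, so the estimate does not depend on the size of \<open>q\<close>.\<close>

lemma fld_near_zero_ge:
  assumes "\<bar>v\<bar> \<le> e" "e \<le> 1" "e * (1 + K) \<le> 1 / 2" "\<bar>B x\<bar> \<le> K" "q x * v \<ge> 0"
  shows "1 / 2 \<le> fld (\<lambda>_. 1) B q x v"
proof -
  have e0: "0 \<le> e" using assms by linarith
  have "(sin v)\<^sup>2 \<le> e * e"
    using sin_cos_small(3)[of v e] assms by (simp add: power2_eq_square)
  also have "e * e \<le> e * 1" using e0 assms by (intro mult_left_mono) auto
  finally have "\<bar>B x\<bar> * (sin v)\<^sup>2 \<le> K * e" using assms by (intro mult_mono) auto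
  moreover have "- (\<bar>B x\<bar> * (sin v)\<^sup>2) \<le> B x * (sin v)\<^sup>2"
    using mult_right_mono[of "- \<bar>B x\<bar>" "B x" "(sin v)\<^sup>2"] by simp
  moreover have "q x * (sin v * cos v) \<ge> 0" using assms by (intro times_sin_cos_nonneg) auto
  ultimately show ?thesis
    using sin_cos_small(2)[of v e] assms unfolding fld_def by (simp add: algebra_simps)
qed

lemma fld_plus_pi: "fld A B q x (pi + v) = fld A B q x v"
  by (simp add: fld_def sin_add cos_add)

context advection_problem
begin

context
  fixes \<nu> K T
  assumes fam: "angle_family (\<lambda>_. 1) (\<lambda>x. \<nu> - c x) m' K T" and T0: "\<And>s. T s 0 = bdry_angle L"
begin

lemma angle_nonneg: "0 \<le> x \<Longrightarrow> x \<le> 1 \<Longrightarrow> 0 \<le> T s x"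
  using angle_pos[OF angle_familyD(1)[OF fam], of s x] T0 bdry_angle_bounds(1)[OF L]
  by (cases "x = 0") auto

lemma eventually_ge_target:
  assumes x: "0 \<le> x" "x \<le> 1" and ev: "\<forall>\<^sub>F s in at_top. pi \<le> T s x"
  shows "\<forall>\<^sub>F s in at_top. pi - bdry_angle R \<le> T s 1"
  using ev
proof eventually_elim
  case (elim s)
  have "T s 1 \<ge> pi"
    using angle_gt_pi[OF angle_sol_subset[OF angle_familyD(1)[OF fam] x(1) order_refl] _ elim, of 1] elim x
    by (cases "x = 1") auto
  thus ?case using bdry_angle_bounds(1)[OF R] by simp
qed

lemma small_step:
  obtains e where "0 < e" "e \<le> 1" "e * (1 + K) \<le> 1 / 2"
proof (rule that[of "1 / (2 * (1 + K))"])
  have K: "K > 0" by (rule angle_familyD(2)[OF fam])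
  show "0 < 1 / (2 * (1 + K))" "1 / (2 * (1 + K)) \<le> 1" "1 / (2 * (1 + K)) * (1 + K) \<le> 1 / 2"
    using K by (auto simp: field_simps)
qed

text \<open>At \<open>x - e\<close> only nonnegativity is known, and 0 is a rest point of the drift.
  A line of slope 1/2 lifts the angle to at least \<open>e / 4\<close> at \<open>x - h\<close>,
  uniformly in s, and from there the drift takes it to pi/2.\<close>

lemma liminf_ge_left_incr:
  assumes x: "left_incr m m' x" "x \<le> 1"
  shows "liminf_ge T x (pi / 2)"
proof -
  obtain d where d: "0 < d" "d \<le> 1" "d * (1 + K) \<le> 1 / 2" using small_step by metis
  obtain e where e: "0 < e" "e \<le> d" "e \<le> x" "\<And>t. t \<in> {x-e..x} \<Longrightarrow> 0 \<le> m' t" "\<And>t. t \<in> {x-e..<x} \<Longrightarrow> m t < m x"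
    using left_incrE[OF x(1) d(1)] by metis
  have e4: "e / 4 > 0" using e by simp
  obtain h0 where h0: "h0 > 0" "\<And>r. r \<le> h0 \<Longrightarrow> K * r < e / 4" using short_step[OF fam T0 e4] by metis
  \<comment> \<open>\<open>h \<le> e / 2\<close> leaves room for the climb, and
    \<open>K * h < e / 4\<close> keeps the error of the last stretch below the height
    reached.\<close>
  define h where "h = min h0 (e / 2)"
  have h: "h > 0" "h \<le> e / 2" "K * h < e / 4" using h0 e by (auto simp: h_def)
  have "\<forall>\<^sub>F s in at_top. e / 4 \<le> T s (x - h)"
    using eventually_ge_at_top[of 0]
  proof eventually_elim
    case (elim s)
    have "0 + 1 / 2 * (x - h - (x - e)) \<le> T s (x - h)"
    proof (rule angle_linear_ge[OF angle_sol_subset[OF angle_familyD(1)[OF fam]]])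
      show "0 \<le> T s (x - e)" using angle_nonneg e x by simp
      fix t assume t: "t \<in> {x - e..x - h}"
      have "1 / 2 * (t - (x - e)) \<le> 1 * e" using t h by (intro mult_mono) auto
      moreover have "2 * s * m' t * (0 + 1 / 2 * (t - (x - e))) \<ge> 0"
        using elim e(4)[of t] t h by (intro mult_nonneg_nonneg) auto
      ultimately show "1 / 2 \<le> fld (\<lambda>_. 1) (\<lambda>x. \<nu> - c x) (\<lambda>x. 2 * s * m' x) t (0 + 1 / 2 * (t - (x - e)))"
        using t e h d angle_familyD(4)[OF fam, of t] x
        by (intro fld_near_zero_ge[where e=d and K=K]) auto
    qed (use h e x in auto)
    moreover have "e / 4 \<le> 1 / 2 * (x - h - (x - e))" using h by simp
    ultimately show ?case by linarith
  qed
  hence lb: "liminf_ge T (x - h) (e / 4)"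
    unfolding liminf_ge_def by (auto elim!: eventually_mono)
  show ?thesis
    by (rule liminf_ge_increase[OF fam grad _ _ x(2) _ _ lb]) (use h e d pi_gt3 in auto)
qed

text \<open>The drift brings the angle close to pi at \<open>w\<close> but not beyond. On a further
  piece of the stretch the cos^2 term lifts it from pi - r/2 to pi, from where it cannot
  return.\<close>

lemma eventually_ge_past_half:
  assumes y: "0 \<le> y" "y < w" "w < z" "z \<le> 1" and nn: "\<And>t. t \<in> {y..z} \<Longrightarrow> m' t \<le> 0"
    and strict: "\<And>t. t \<in> {y..<w} \<Longrightarrow> m w < m t"
    and lb: "liminf_ge T y \<alpha>" and \<alpha>: "pi / 2 + K * (w - y) < \<alpha>" "\<alpha> \<le> pi"
  shows "\<forall>\<^sub>F s in at_top. pi - bdry_angle R \<le> T s 1"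
proof -
  have lw: "liminf_ge T w pi"
    by (rule liminf_ge_decrease[OF fam grad _ y(2) _ _ _ lb]) (use y nn strict \<alpha> in auto)
  obtain d where d: "0 < d" "d \<le> 1" "d * (1 + K) \<le> 1 / 2" using small_step by metis
  define r where "r = min d (z - w)"
  have r: "r > 0" "r \<le> d" "w + r \<le> z" using d y by (auto simp: r_def)
  have "\<forall>\<^sub>F s in at_top. pi - r / 2 \<le> T s w" by (rule liminf_geD[OF lw]) (use r in simp)
  with eventually_ge_at_top[of 0] have "\<forall>\<^sub>F s in at_top. pi \<le> T s (w + r)"
  proof eventually_elim
    case (elim s)
    have "(pi - r / 2) + 1 / 2 * (w + r - w) \<le> T s (w + r)"
    proof (rule angle_linear_ge[OF angle_sol_subset[OF angle_familyD(1)[OF fam]] _ elim(2)])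
      fix t assume t: "t \<in> {w..w + r}"
      \<comment> \<open>Signed distance of the barrier from pi, rising from -r/2 to 0. It is
        nonpositive, so with \<open>m' t \<le> 0\<close> the drift helps.\<close>
      define v where "v = (t - w - r) / 2"
      have t': "w \<le> t" "t \<le> w + r" using t by auto
      have v: "v \<le> 0" using t' by (simp add: v_def)
      have v': "- v \<le> d" using t' r(1,2) by (simp add: v_def field_simps)
      have "m' t \<le> 0" using nn[of t] t r y by auto
      hence "2 * s * m' t * v \<ge> 0" using elim v by (simp add: mult_nonneg_nonpos mult_nonpos_nonpos)
      then have "1 / 2 \<le> fld (\<lambda>_. 1) (\<lambda>x. \<nu> - c x) (\<lambda>x. 2 * s * m' x) t v"
        using t r d v v' y angle_familyD(4)[OF fam, of t]
        by (intro fld_near_zero_ge[where e=d and K=K]) auto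
      moreover have "pi - r / 2 + 1 / 2 * (t - w) = pi + v" by (simp add: v_def field_simps)
      ultimately show "1 / 2 \<le> fld (\<lambda>_. 1) (\<lambda>x. \<nu> - c x) (\<lambda>x. 2 * s * m' x) t (pi - r / 2 + 1 / 2 * (t - w))"
        by (simp only: fld_plus_pi)
    qed (use r y in auto)
    thus ?case by simp
  qed
  thus ?thesis by (rule eventually_ge_target[rotated 2]) (use r y in auto)
qed

text \<open>The limiting flow passes its target at \<open>b\<close> with room to spare. Under a
  Dirichlet exit this target is already pi; under a Neumann exit before 1 it is pi/2, and the
  decrease of m after \<open>b\<close> does the rest.\<close>

lemma eventually_ge_segment:
  assumes ab: "segment a b" and less: "lambda1 c (entry_bc a) (exit_bc b) a b < \<nu>"
  shows "\<forall>\<^sub>F s in at_top. pi - bdry_angle R \<le> T s 1"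
proof -
  have ab': "0 \<le> a" "a < b" "b \<le> 1" using ab by (auto simp: segment_iff)
  have entry: "liminf_ge T a (bdry_angle (entry_bc a))"
  proof -
    consider "a = 0" | "a \<noteq> 0" "left_incr m m' a" | "a \<noteq> 0" "\<not> left_incr m m' a" by blast
    thus ?thesis
    proof cases
      case 2
      thus ?thesis using liminf_ge_left_incr ab' by (simp add: entry_bc_def)
    next
      case 3
      have "- e \<le> T s a" if "e > 0" for e s
        using angle_nonneg[of a s] ab' that by simp
      thus ?thesis using 3 by (simp add: entry_bc_def liminf_ge_def)
    qed (use T0 in \<open>simp add: entry_bc_def liminf_ge_def\<close>)
  qed
  obtain \<psi> where \<psi>: "angle_sol (\<lambda>_. 1) (\<lambda>x. \<nu> - c x) (\<lambda>_. 0) \<psi> a b" "\<psi> a = bdry_angle (entry_bc a)"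
    "pi - bdry_angle (exit_bc b) < \<psi> b"
    using segment_angle[OF ab, of \<nu>] less by metis
  have lb: "liminf_ge T b (\<psi> b)"
    by (rule liminf_ge_flat[OF fam ab'(1) less_imp_le[OF ab'(2)] ab'(3) segment_deriv_zero[OF ab] \<psi>(1)])
       (use entry \<psi>(2) in auto)
  have "right_incr m m' b \<or> right_decr m m' b" if "b < 1"
    using right_cases[of b] ab ab' that by (auto simp: segment_iff)
  then consider "b = 1" | "b < 1" "right_incr m m' b" | "b < 1" "right_decr m m' b"
    using ab'(3) by (metis less_le)
  thus ?thesis
  proof cases
    case 1
    thus ?thesis using liminf_geD[OF lb \<psi>(3)] by (simp add: exit_bc_def)
  next
    case 2
    hence "\<forall>\<^sub>F s in at_top. pi \<le> T s b" using liminf_geD[OF lb \<psi>(3)] by (simp add: exit_bc_def)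
    thus ?thesis by (rule eventually_ge_target[rotated 2]) (use ab' in auto)
  next
    case 3
    hence "exit_bc b = Neumann" using right_types_exclusive(1)[of m m' b] by (auto simp: exit_bc_def)
    hence ps: "pi / 2 < \<psi> b" using \<psi>(3) by simp
    \<comment> \<open>Capped at pi, as \<open>eventually_ge_past_half\<close> requires.\<close>
    define \<alpha> where "\<alpha> = min (\<psi> b) pi"
    have \<alpha>: "pi / 2 < \<alpha>" "\<alpha> \<le> pi" "liminf_ge T b \<alpha>"
      using ps liminf_ge_mono[OF lb] by (auto simp: \<alpha>_def)
    have \<alpha>': "\<alpha> - pi / 2 > 0" using \<alpha> by simp
    obtain h where h: "h > 0" "\<And>r. r \<le> h \<Longrightarrow> K * r < \<alpha> - pi / 2"
      using short_step[OF fam T0 \<alpha>'] by metis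
    obtain e where e: "0 < e" "e \<le> h" "b + e \<le> 1" "\<And>t. t \<in> {b..b+e} \<Longrightarrow> m' t \<le> 0" "\<And>t. t \<in> {b<..b+e} \<Longrightarrow> m t < m b"
      using right_decrE[OF 3(2) h(1)] by metis
    obtain w where w: "b < w" "w < b + e" "\<And>t. t \<in> {b..<w} \<Longrightarrow> m w < m t"
      by (rule decrease_strict_point[of b "b + e"]) (use e ab' in auto)
    show ?thesis
      by (rule eventually_ge_past_half[OF _ w(1,2) e(3,4) w(3) \<alpha>(3)]) (use ab' \<alpha> h(2)[of "w - b"] w e in auto)
  qed
qed

text \<open>At \<open>x\<close> the angle is eventually at least pi/2 exactly, by c < \<nu> just
  before \<open>x\<close> or by the Neumann condition at 0. For \<open>x = 1\<close> this is the
  target; otherwise the angle gains a height independent of s after \<open>x\<close>, enough to be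
  carried to pi.\<close>

lemma eventually_ge_point:
  assumes x: "x \<in> M1 m" "x = 0 \<Longrightarrow> snd L = 0" "x = 1 \<Longrightarrow> snd R = 0" and less: "c x < \<nu>"
  shows "\<forall>\<^sub>F s in at_top. pi - bdry_angle R \<le> T s 1"
proof -
  have x01: "0 \<le> x" "x \<le> 1" using x(1) by (auto simp: M1_iff)
  define g where "g = (\<nu> - c x) / 2"
  have g: "g > 0" using less by (simp add: g_def)
  obtain h where h: "h > 0" "\<And>t. t \<in> {0..1} \<Longrightarrow> \<bar>t - x\<bar> \<le> h \<Longrightarrow> \<bar>c t - c x\<bar> < g"
    using c_near[OF x01 g] by metis
  have B: "g \<le> \<nu> - c t" if "t \<in> {0..1}" "\<bar>t - x\<bar> \<le> h" for t
    using h(2)[OF that] unfolding g_def by (simp add: abs_if field_simps split: if_splits)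
  have half: "\<forall>\<^sub>F s in at_top. pi / 2 \<le> T s x"
  proof (cases "x = 0")
    case True
    hence "bdry_angle L = pi / 2" using x(2) by (simp add: bdry_angle_def)
    thus ?thesis using True T0 by simp
  next
    case False
    hence i: "left_incr m m' x" using x(1) by (simp add: M1_iff)
    obtain w where w: "x - h < w" "0 < w" "w < x" "left_incr m m' w" "\<And>t. t \<in> {w..x} \<Longrightarrow> 0 \<le> m' t"
      using left_incr_accumulates[OF i x01(2) h(1)] by metis
    show ?thesis
      by (rule eventually_ge_before_maximum[OF fam _ w(3) x01(2) w(5) _ g liminf_ge_left_incr[OF w(4)]])
         (use w x01 in \<open>auto intro!: B\<close>)
  qed
  show ?thesis
  proof (cases "x = 1")
    case True
    hence "pi - bdry_angle R = pi / 2" using x(3) by (simp add: bdry_angle_def)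
    thus ?thesis using True half by (simp only:)
  next
    case False
    hence i: "right_decr m m' x" using x(1) x01 by (simp add: M1_iff)
    obtain e where e: "0 < e" "e \<le> h" "x + e \<le> 1" "\<And>t. t \<in> {x..x+e} \<Longrightarrow> m' t \<le> 0" "\<And>t. t \<in> {x<..x+e} \<Longrightarrow> m t < m x"
      using right_decrE[OF i h(1)] by metis
    obtain w where w: "x < w" "w < x + e" "\<And>t. t \<in> {x..<w} \<Longrightarrow> m w < m t"
      by (rule decrease_strict_point[of x "x + e"]) (use e x01 in auto)
    define k where "k = g / (1 + K + g)"
    have k: "0 < k" "k \<le> 1" using g angle_familyD(2)[OF fam] by (auto simp: k_def)
    have q: "k * (w - x) / 2 > 0" using k w by simp
    obtain r where r: "r > 0" "\<And>t. t \<le> r \<Longrightarrow> K * t < k * (w - x) / 2" using short_step[OF fam T0 q] by metis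
    \<comment> \<open>Past the midpoint of \<open>x\<close> and \<open>w\<close> the gain is at
      least \<open>k * (w - x) / 2\<close>; close to \<open>w\<close> the error
      \<open>K * (w - y)\<close> is smaller than that.\<close>
    define y where "y = max ((x + w) / 2) (w - r)"
    have y: "x < y" "y < w" "(x + w) / 2 \<le> y" "w - y \<le> r" using w r by (auto simp: y_def max_def field_simps)
    have "\<forall>\<^sub>F s in at_top. pi / 2 + g / (1 + K + g) * (y - x) \<le> T s y"
      by (rule eventually_ge_past_maximum[OF fam x01(1) _ _ _ _ g half])
         (use y w e x01 in \<open>auto intro!: B\<close>)
    hence lb: "liminf_ge T y (pi / 2 + k * (y - x))"
      unfolding liminf_ge_def k_def by (auto elim!: eventually_mono)
    have "k * ((w - x) / 2) \<le> k * (y - x)" using k y by (intro mult_left_mono) (auto simp: field_simps)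
    hence 1: "pi / 2 + K * (w - y) < pi / 2 + k * (y - x)" using r(2)[OF y(4)] by simp
    have "k * (y - x) \<le> 1 * 1" using k y w e x01 by (intro mult_mono) auto
    hence 2: "pi / 2 + k * (y - x) \<le> pi" using pi_gt3 by simp
    show ?thesis
      by (rule eventually_ge_past_half[OF _ y(2) w(2) e(3) _ _ lb 1 2]) (use y w e x01 in auto)
  qed
qed

end

theorem eigenvalue_upper_bound:
  assumes q: "q \<in> quantities" and less: "q < \<nu>"
  shows "\<forall>\<^sub>F s in at_top. eigenvalue s \<le> \<nu>"
proof -
  obtain K T where fam: "angle_family (\<lambda>_. 1) (\<lambda>x. \<nu> - c x) m' K T" and T0: "\<And>s. T s 0 = bdry_angle L"
    using angle_family_exists by metis
  have "\<forall>\<^sub>F s in at_top. pi - bdry_angle R \<le> T s 1"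
    using q unfolding quantities_def
  proof
    assume "q \<in> segment_quantities"
    thus ?thesis using eventually_ge_segment[OF fam T0] less unfolding segment_quantities_def by blast
  next
    assume "q \<in> point_quantities"
    then obtain x where "q = c x" "x \<in> M1 m" "x = 0 \<longrightarrow> snd L = 0" "x = 1 \<longrightarrow> snd R = 0"
      unfolding point_quantities_def by blast
    thus ?thesis using eventually_ge_point[OF fam T0, of x] less by blast
  qed
  thus ?thesis using eigenvalue_iff(2)[OF fam T0] by simp
qed

end

subsection \<open>Existence of the minima\<close>

text \<open>Captures values tending to infinity along an infinite family. It passes to subsets and
  makes minima attained, as \<open>LEAST\<close> on the reals requires.\<close>

definition finite_sublevels :: "real set \<Rightarrow> bool" where
  "finite_sublevels S \<longleftrightarrow> (\<forall>r. finite {q\<in>S. q \<le> r})"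

lemma finite_sublevels_subset: "finite_sublevels S \<Longrightarrow> S' \<subseteq> S \<Longrightarrow> finite_sublevels S'"
  unfolding finite_sublevels_def by (blast intro: finite_subset[of "{q\<in>S'. q \<le> _}" "{q\<in>S. q \<le> _}"])

lemma finite_sublevels_minimum:
  assumes "finite_sublevels S" "S \<noteq> {}"
  obtains y where "is_minimum S y"
proof -
  obtain q where q: "q \<in> S" using assms(2) by blast
  define F where "F = {p\<in>S. p \<le> q}"
  have F: "finite F" "F \<noteq> {}" using assms(1) q by (auto simp: F_def finite_sublevels_def)
  have "Min F \<in> F" by (rule Min_in[OF F])
  moreover have "Min F \<le> z" if "z \<in> S" for z
  proof (cases "z \<le> q")
    case True
    thus ?thesis using that F(1) by (intro Min_le) (auto simp: F_def)
  next
    case False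
    have "Min F \<le> q" by (rule Min_le[OF F(1)]) (use q in \<open>simp add: F_def\<close>)
    thus ?thesis using False by simp
  qed
  ultimately show thesis using that unfolding is_minimum_def F_def by blast
qed

lemma min_omit_minimum:
  assumes "finite_sublevels S"
  shows "min_omit S \<subseteq> S" and "\<And>x. x \<in> S \<Longrightarrow> \<exists>y\<in>min_omit S. y \<le> x"
proof -
  have *: "(LEAST y. y \<in> S) \<in> S \<and> (\<forall>x\<in>S. (LEAST y. y \<in> S) \<le> x)" if ne: "S \<noteq> {}"
  proof -
    obtain y where y: "y \<in> S" "\<And>z. z \<in> S \<Longrightarrow> y \<le> z"
      using finite_sublevels_minimum[OF assms ne] unfolding is_minimum_def by metis
    hence "(LEAST y. y \<in> S) = y" by (intro Least_equality) auto
    thus ?thesis using y by simp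
  qed
  show "min_omit S \<subseteq> S" using * by (auto simp: min_omit_def)
  show "\<exists>y\<in>min_omit S. y \<le> x" if "x \<in> S" for x
  proof -
    have "S \<noteq> {}" using that by blast
    thus ?thesis using * that by (auto simp: min_omit_def)
  qed
qed

section \<open>Finiteness and comparison of the limiting quantities\<close>

context advection_problem
begin

text \<open>For \<open>M2\<close> and \<open>M5\<close> the angle has to rise by pi/2, from pi/2 to
  pi or from 0 to pi/2, at speed at most \<open>K\<close>. Short segments therefore have large
  eigenvalues, and only finitely many are long. The remaining segments are finite in number:
  \<open>M3\<close>, \<open>M4\<close> and those containing 0 or 1.\<close>

lemma finite_below_segments: "finite {(a, b). segment a b \<and> lambda1 c (entry_bc a) (exit_bc b) a b \<le> r}"
proof -
  have "continuous_on {0..1} (\<lambda>x. r - c x)" by (intro continuous_intros c_cont)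
  then obtain K0 where K0: "K0 > 0" "\<And>x. x \<in> {0..1} \<Longrightarrow> \<bar>r - c x\<bar> \<le> K0"
    using continuous_on_Icc_abs_bound by metis
  define K where "K = max 1 K0"
  have K: "K > 0" "1 \<le> K" "\<And>x. x \<in> {0..1} \<Longrightarrow> \<bar>r - c x\<bar> \<le> K" using K0(2) by (force simp: K_def)+
  \<comment> \<open>On a segment shorter than this the angle rises by less than 1, hence by less
    than pi/2.\<close>
  define h where "h = 1 / K"
  have h: "h > 0" using K by (simp add: h_def)
  have long: "h \<le> b - a"
    if ab: "segment a b" and le: "lambda1 c (entry_bc a) (exit_bc b) a b \<le> r"
      and bc: "bdry_angle (entry_bc a) + pi / 2 \<le> pi - bdry_angle (exit_bc b)" for a b
  proof (rule ccontr)
    assume "\<not> h \<le> b - a"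
    hence "K * (b - a) < K * h" using K by (intro mult_strict_left_mono) auto
    hence Kh: "K * (b - a) < 1" using K by (simp add: h_def)
    obtain \<psi> where \<psi>: "angle_sol (\<lambda>_. 1) (\<lambda>x. r - c x) (\<lambda>_. 0) \<psi> a b" "\<psi> a = bdry_angle (entry_bc a)"
      "\<not> \<psi> b < pi - bdry_angle (exit_bc b)"
      using segment_angle[OF ab, of r] le by (metis not_less)
    have "\<psi> b \<le> bdry_angle (entry_bc a) + K * (b - a)"
    proof (rule angle_linear_le[OF \<psi>(1)])
      fix x assume x: "x \<in> {a..b}"
      define v where "v = bdry_angle (entry_bc a) + K * (x - a)"
      have "(r - c x) * (sin v)\<^sup>2 + 1 * (cos v)\<^sup>2 \<le> K"
        using K x ab by (intro convex_comb_le) (auto simp: segment_iff)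
      thus "fld (\<lambda>_. 1) (\<lambda>x. r - c x) (\<lambda>_. 0) x (bdry_angle (entry_bc a) + K * (x - a)) \<le> K"
        unfolding v_def[symmetric] fld_def by simp
    qed (use ab \<psi>(2) in \<open>auto simp: segment_iff\<close>)
    thus False using \<psi>(3) bc Kh pi_gt3 by simp
  qed
  have "{(a, b). segment a b \<and> lambda1 c (entry_bc a) (exit_bc b) a b \<le> r} \<subseteq>
      {(a, b). segment a b \<and> (\<exists>e\<in>{0, 1}. a \<le> e \<and> e \<le> b)} \<union> M3 m m' \<union> M4 m m' \<union>
      {(a, b). segment a b \<and> h \<le> b - a}"
  proof (rule subsetI, rule ccontr)
    fix p
    assume p: "p \<in> {(a, b). segment a b \<and> lambda1 c (entry_bc a) (exit_bc b) a b \<le> r}"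
      and np: "p \<notin> {(a, b). segment a b \<and> (\<exists>e\<in>{0, 1}. a \<le> e \<and> e \<le> b)} \<union> M3 m m' \<union> M4 m m' \<union>
        {(a, b). segment a b \<and> h \<le> b - a}"
    obtain a b where [simp]: "p = (a, b)" by (cases p)
    have ab: "segment a b" and le: "lambda1 c (entry_bc a) (exit_bc b) a b \<le> r" using p by auto
    have ab': "0 \<le> a" "a < b" "b \<le> 1" using ab by (auto simp: segment_iff)
    have n: "(a, b) \<notin> M3 m m'" "(a, b) \<notin> M4 m m'" "\<not> h \<le> b - a" and int: "0 < a" "b < 1"
      using np ab ab' by auto
    have l: "left_incr m m' a \<or> left_decr m m' a" and r: "right_incr m m' b \<or> right_decr m m' b"
      using left_cases[of a] right_cases[of b] ab int ab' by (auto simp: segment_iff)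
    have "left_incr m m' a \<longleftrightarrow> right_incr m m' b"
      using n(1,2) ab int l r by (auto simp: M_segments_iff)
    hence "bdry_angle (entry_bc a) + pi / 2 \<le> pi - bdry_angle (exit_bc b)"
      using int by (auto simp: entry_bc_def exit_bc_def)
    thus False using long[OF ab le] n(3) by simp
  qed
  moreover have "finite \<dots>"
    using finite_M34 finite_long_segments[OF h] finite_segments_meeting[of "{0, 1}"] by simp
  ultimately show ?thesis by (rule finite_subset)
qed

lemma finite_sublevels_quantities: "finite_sublevels quantities"
  unfolding finite_sublevels_def
proof
  fix r
  have "{q\<in>quantities. q \<le> r} \<subseteq>
      (\<lambda>(a, b). lambda1 c (entry_bc a) (exit_bc b) a b) `
        {(a, b). segment a b \<and> lambda1 c (entry_bc a) (exit_bc b) a b \<le> r} \<union> c ` M1 m"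
    unfolding quantities_def segment_quantities_def point_quantities_def by force
  moreover have "finite (M1 m)" using finite_interior_M1 by (simp add: finite_Diff2)
  hence "finite ((\<lambda>(a, b). lambda1 c (entry_bc a) (exit_bc b) a b) `
        {(a, b). segment a b \<and> lambda1 c (entry_bc a) (exit_bc b) a b \<le> r} \<union> c ` M1 m)"
    using finite_below_segments[of r] by simp
  ultimately show "finite {q\<in>quantities. q \<le> r}" by (rule finite_subset)
qed

lemma segment_family_cases:
  assumes ab: "segment a b"
  shows "(a, b) \<in> M2 m m' \<or> (a, b) \<in> M3 m m' \<or> (a, b) \<in> M4 m m' \<or> (a, b) \<in> M5 m m' \<or>
    (a, b) \<in> M6 m m' \<or> (a, b) \<in> M7 m m' \<or> (a, b) \<in> M8 m m' \<or> (a, b) \<in> M9 m m'"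
proof -
  \<comment> \<open>The interval [0, 1] itself is in none of the families; it is excluded because m
    is not constant.\<close>
  have ab': "0 \<le> a" "a < b" "b \<le> 1" "\<not> (a = 0 \<and> b = 1)" using ab nonconst by (auto simp: segment_iff)
  have l: "a = 0 \<or> (0 < a \<and> left_incr m m' a) \<or> (0 < a \<and> left_decr m m' a)"
    using left_cases[of a] ab ab' by (auto simp: segment_iff)
  have r: "b = 1 \<or> (b < 1 \<and> right_incr m m' b) \<or> (b < 1 \<and> right_decr m m' b)"
    using right_cases[of b] ab ab' by (auto simp: segment_iff)
  show ?thesis
    unfolding M_segments_iff using l r ab ab'(4) by (elim disjE conjE) simp_all
qed

lemma segment_bcs:
  "(a, b) \<in> M2 m m' \<Longrightarrow> segment a b \<and> entry_bc a = Neumann \<and> exit_bc b = Dirichlet"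
  "(a, b) \<in> M3 m m' \<Longrightarrow> segment a b \<and> entry_bc a = Neumann \<and> exit_bc b = Neumann"
  "(a, b) \<in> M4 m m' \<Longrightarrow> segment a b \<and> entry_bc a = Dirichlet \<and> exit_bc b = Dirichlet"
  "(a, b) \<in> M5 m m' \<Longrightarrow> segment a b \<and> entry_bc a = Dirichlet \<and> exit_bc b = Neumann"
  "(a, b) \<in> M6 m m' \<Longrightarrow> segment a b \<and> a = 0 \<and> entry_bc a = L \<and> exit_bc b = Dirichlet"
  "(a, b) \<in> M7 m m' \<Longrightarrow> segment a b \<and> a = 0 \<and> entry_bc a = L \<and> exit_bc b = Neumann"
  "(a, b) \<in> M8 m m' \<Longrightarrow> segment a b \<and> b = 1 \<and> entry_bc a = Neumann \<and> exit_bc b = R"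
  "(a, b) \<in> M9 m m' \<Longrightarrow> segment a b \<and> b = 1 \<and> entry_bc a = Dirichlet \<and> exit_bc b = R"
proof -
  have nl: "left_decr m m' a \<Longrightarrow> \<not> left_incr m m' a" and nr: "right_decr m m' b \<Longrightarrow> \<not> right_incr m m' b"
    using left_types_exclusive(1) right_types_exclusive(1) by blast+
  show
    "(a, b) \<in> M2 m m' \<Longrightarrow> segment a b \<and> entry_bc a = Neumann \<and> exit_bc b = Dirichlet"
    "(a, b) \<in> M3 m m' \<Longrightarrow> segment a b \<and> entry_bc a = Neumann \<and> exit_bc b = Neumann"
    "(a, b) \<in> M4 m m' \<Longrightarrow> segment a b \<and> entry_bc a = Dirichlet \<and> exit_bc b = Dirichlet"
    "(a, b) \<in> M5 m m' \<Longrightarrow> segment a b \<and> entry_bc a = Dirichlet \<and> exit_bc b = Neumann"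
    "(a, b) \<in> M6 m m' \<Longrightarrow> segment a b \<and> a = 0 \<and> entry_bc a = L \<and> exit_bc b = Dirichlet"
    "(a, b) \<in> M7 m m' \<Longrightarrow> segment a b \<and> a = 0 \<and> entry_bc a = L \<and> exit_bc b = Neumann"
    "(a, b) \<in> M8 m m' \<Longrightarrow> segment a b \<and> b = 1 \<and> entry_bc a = Neumann \<and> exit_bc b = R"
    "(a, b) \<in> M9 m m' \<Longrightarrow> segment a b \<and> b = 1 \<and> entry_bc a = Dirichlet \<and> exit_bc b = R"
    by (auto simp: M_segments_iff entry_bc_def exit_bc_def nl nr)
qed

text \<open>Together the two claims show that \<open>limit_quantities\<close>, where several
  families are reduced to their minima, has the same minimum as \<open>quantities\<close>.\<close>

lemma limit_quantities_subset: "limit_quantities m m' c L R \<subseteq> quantities"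
  and limit_quantities_below: "q \<in> quantities \<Longrightarrow> \<exists>y\<in>limit_quantities m m' c L R. y \<le> q"
proof -
  define F2 where "F2 = {lambda1 c Neumann Dirichlet a b | a b. (a, b) \<in> M2 m m'}"
  define F3 where "F3 = {lambda1 c Neumann Neumann a b | a b. (a, b) \<in> M3 m m'}"
  define F4 where "F4 = {lambda1 c Dirichlet Dirichlet a b | a b. (a, b) \<in> M4 m m'}"
  define F5 where "F5 = {lambda1 c Dirichlet Neumann a b | a b. (a, b) \<in> M5 m m'}"
  define F1 where "F1 = {c x | x. x \<in> M1 m - {0, 1}}"
  define F6 where "F6 = {lambda1 c L Dirichlet 0 a | a. (0, a) \<in> M6 m m'}"
  define F7 where "F7 = {lambda1 c L Neumann 0 a | a. (0, a) \<in> M7 m m'}"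
  define F8 where "F8 = {lambda1 c Neumann R a 1 | a. (a, 1) \<in> M8 m m'}"
  define F9 where "F9 = {lambda1 c Dirichlet R a 1 | a. (a, 1) \<in> M9 m m'}"
  define E0 where "E0 = (if 0 \<in> M1 m \<and> snd L = 0 then {c 0} else {})"
  define E1 where "E1 = (if 1 \<in> M1 m \<and> snd R = 0 then {c 1} else {})"
  define U where "U = min_omit F2 \<union> min_omit F3 \<union> min_omit F4 \<union> min_omit F5"
  have LQ: "limit_quantities m m' c L R = min_omit U \<union> min_omit F1 \<union> F6 \<union> F7 \<union> F8 \<union> F9 \<union> E0 \<union> E1"
    unfolding limit_quantities_def frakL_def U_def F1_def F2_def F3_def F4_def F5_def F6_def F7_def
      F8_def F9_def E0_def E1_def by simp
  have mem: "lambda1 c L' R' a b \<in> quantities" if "segment a b" "entry_bc a = L'" "exit_bc b = R'" for a b L' R'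
    using segment_quantity_mem that by blast
  have sub: "F2 \<subseteq> quantities" "F3 \<subseteq> quantities" "F4 \<subseteq> quantities" "F5 \<subseteq> quantities"
    "F6 \<subseteq> quantities" "F7 \<subseteq> quantities" "F8 \<subseteq> quantities" "F9 \<subseteq> quantities"
    unfolding F2_def F3_def F4_def F5_def F6_def F7_def F8_def F9_def using segment_bcs mem by blast+
  have subp: "F1 \<subseteq> quantities" "E0 \<subseteq> quantities" "E1 \<subseteq> quantities"
    unfolding F1_def E0_def E1_def by (auto intro!: point_quantity_mem)
  note fin = finite_sublevels_subset[OF finite_sublevels_quantities]
  note min = min_omit_minimum[OF fin]
  have subU: "U \<subseteq> quantities"
    using min(1)[OF sub(1)] min(1)[OF sub(2)] min(1)[OF sub(3)] min(1)[OF sub(4)] sub unfolding U_def by blast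
  show "limit_quantities m m' c L R \<subseteq> quantities"
    unfolding LQ using min(1)[OF subU] min(1)[OF subp(1)] sub subp subU by blast
  show "\<exists>y\<in>limit_quantities m m' c L R. y \<le> q" if q: "q \<in> quantities"
  proof -
    \<comment> \<open>Two nested minima: over one of the families \<open>M2\<close> to
      \<open>M5\<close>, then over the results.\<close>
    have viaU: "\<exists>y\<in>limit_quantities m m' c L R. y \<le> q" if ex: "\<exists>u\<in>U. u \<le> q"
    proof -
      obtain u where u: "u \<in> U" "u \<le> q" using ex by blast
      obtain y where "y \<in> min_omit U" "y \<le> u" using min(2)[OF subU u(1)] by blast
      hence "y \<in> limit_quantities m m' c L R" "y \<le> q" using u(2) unfolding LQ by auto
      thus ?thesis by blast
    qed
    have direct: "\<exists>y\<in>limit_quantities m m' c L R. y \<le> q" if "q \<in> F6 \<union> F7 \<union> F8 \<union> F9 \<union> E0 \<union> E1"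
      using that unfolding LQ by blast
    from q consider "q \<in> segment_quantities" | "q \<in> point_quantities" unfolding quantities_def by blast
    thus ?thesis
    proof cases
      case 1
      then obtain a b where ab: "segment a b" and q: "q = lambda1 c (entry_bc a) (exit_bc b) a b"
        unfolding segment_quantities_def by blast
      from segment_family_cases[OF ab] show ?thesis
      proof (elim disjE)
        assume "(a, b) \<in> M2 m m'"
        hence "q \<in> F2" using segment_bcs(1) q unfolding F2_def by force
        thus ?thesis using min(2)[OF sub(1)] by (intro viaU) (auto simp: U_def)
      next
        assume "(a, b) \<in> M3 m m'"
        hence "q \<in> F3" using segment_bcs(2) q unfolding F3_def by force
        thus ?thesis using min(2)[OF sub(2)] by (intro viaU) (auto simp: U_def)
      next
        assume "(a, b) \<in> M4 m m'"
        hence "q \<in> F4" using segment_bcs(3) q unfolding F4_def by force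
        thus ?thesis using min(2)[OF sub(3)] by (intro viaU) (auto simp: U_def)
      next
        assume "(a, b) \<in> M5 m m'"
        hence "q \<in> F5" using segment_bcs(4) q unfolding F5_def by force
        thus ?thesis using min(2)[OF sub(4)] by (intro viaU) (auto simp: U_def)
      next
        assume "(a, b) \<in> M6 m m'"
        hence "q \<in> F6" using segment_bcs(5) q unfolding F6_def by force
        thus ?thesis by (intro direct) blast
      next
        assume "(a, b) \<in> M7 m m'"
        hence "q \<in> F7" using segment_bcs(6) q unfolding F7_def by force
        thus ?thesis by (intro direct) blast
      next
        assume "(a, b) \<in> M8 m m'"
        hence "q \<in> F8" using segment_bcs(7) q unfolding F8_def by force
        thus ?thesis by (intro direct) blast
      next
        assume "(a, b) \<in> M9 m m'"
        hence "q \<in> F9" using segment_bcs(8) q unfolding F9_def by force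
        thus ?thesis by (intro direct) blast
      qed
    next
      case 2
      then obtain x where x: "q = c x" "x \<in> M1 m" "x = 0 \<longrightarrow> snd L = 0" "x = 1 \<longrightarrow> snd R = 0"
        unfolding point_quantities_def by blast
      show ?thesis
      proof (cases "x \<in> {0, 1}")
        case True
        hence "q \<in> E0 \<union> E1" using x by (auto simp: E0_def E1_def)
        thus ?thesis by (intro direct) blast
      next
        case False
        hence "q \<in> F1" using x by (auto simp: F1_def)
        thus ?thesis using min(2)[OF subp(1)] unfolding LQ by blast
      qed
    qed
  qed
qed

section \<open>The limit of the principal eigenvalue\<close>

lemma eigenvalue_at_top:
  assumes "quantities = {}"
  shows "filterlim eigenvalue at_top at_top"
  unfolding filterlim_at_top by (intro allI eigenvalue_lower_bound) (simp add: assms)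

lemma eigenvalue_tendsto:
  assumes "quantities \<noteq> {}"
  obtains l where "(eigenvalue \<longlongrightarrow> l) at_top" "is_minimum (limit_quantities m m' c L R) l"
proof -
  obtain l where l: "l \<in> quantities" "\<And>q. q \<in> quantities \<Longrightarrow> l \<le> q"
    using finite_sublevels_minimum[OF finite_sublevels_quantities assms] unfolding is_minimum_def by metis
  have "(eigenvalue \<longlongrightarrow> l) at_top"
  proof (rule order_tendstoI)
    fix a assume a: "a < l"
    \<comment> \<open>The midpoint is strictly below every limiting quantity and strictly above
      \<open>a\<close>.\<close>
    have "\<forall>\<^sub>F s in at_top. (a + l) / 2 \<le> eigenvalue s"
      by (rule eigenvalue_lower_bound) (use l(2) a in force)
    thus "\<forall>\<^sub>F s in at_top. a < eigenvalue s" by eventually_elim (use a in \<open>simp add: field_simps\<close>)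
  next
    fix a assume a: "l < a"
    have "\<forall>\<^sub>F s in at_top. eigenvalue s \<le> (a + l) / 2"
      by (rule eigenvalue_upper_bound[OF l(1)]) (use a in simp)
    thus "\<forall>\<^sub>F s in at_top. eigenvalue s < a" by eventually_elim (use a in \<open>simp add: field_simps\<close>)
  qed
  moreover have "is_minimum (limit_quantities m m' c L R) l"
    unfolding is_minimum_def
  proof
    obtain y where y: "y \<in> limit_quantities m m' c L R" "y \<le> l" using limit_quantities_below[OF l(1)] by blast
    hence "y = l" using l(2) limit_quantities_subset by (meson order_antisym subsetD)
    thus "l \<in> limit_quantities m m' c L R" using y by simp
    show "\<forall>z\<in>limit_quantities m m' c L R. l \<le> z" using l(2) limit_quantities_subset by blast
  qed
  ultimately show thesis using that by blast
qed

lemma eigenvalue_at_top_iff: "filterlim eigenvalue at_top at_top \<longleftrightarrow> quantities = {}"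
proof
  assume lim: "filterlim eigenvalue at_top at_top"
  show "quantities = {}"
  proof (rule ccontr)
    assume "quantities \<noteq> {}"
    then obtain q where "q \<in> quantities" by blast
    hence "\<forall>\<^sub>F s in at_top. eigenvalue s \<le> q + 1" by (rule eigenvalue_upper_bound) simp
    moreover have "\<forall>\<^sub>F s in at_top. q + 2 \<le> eigenvalue s" using lim by (simp add: filterlim_at_top)
    ultimately have "\<forall>\<^sub>F s in (at_top :: real filter). False"
      by eventually_elim simp
    thus False by simp
  qed
qed (rule eigenvalue_at_top)

end

text \<open>For Neumann conditions the principal eigenvalue is bounded by the maximum of \<open>c\<close>, so the lower
  bound shows that there is a point or a segment of local maximum.\<close>

lemma (in potential) maximum_exists:
  assumes nonconst: "\<not> m constant_on {0..1}"
  shows "M1 m \<noteq> {} \<or> (\<exists>a b. segment a b)"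
proof (rule ccontr)
  assume none: "\<not> (M1 m \<noteq> {} \<or> (\<exists>a b. segment a b))"
  interpret N: advection_problem m m' "\<lambda>_. 0" Neumann Neumann
    by unfold_locales (use nonconst in auto)
  have "N.quantities = {}"
    using none unfolding N.quantities_def N.segment_quantities_def N.point_quantities_def by blast
  hence "\<forall>\<^sub>F s in at_top. 1 \<le> N.eigenvalue s" by (intro N.eigenvalue_lower_bound) simp
  then obtain s where s: "1 \<le> N.eigenvalue s" by (auto simp: eventually_at_top_linorder)
  obtain K T where fam: "angle_family (\<lambda>_. 1) (\<lambda>x. 0 - 0) m' K T" and T0: "\<And>s. T s 0 = bdry_angle Neumann"
    using N.angle_family_exists[of 0] by metis
  \<comment> \<open>For c = 0 and \<nu> = 0 the constant angle pi/2 solves the equation; it belongs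
    to the constant eigenfunction.\<close>
  have "pi / 2 \<le> T s 1"
    by (rule angle_ge[OF angle_familyD(1)[OF fam, of s], where V="\<lambda>_. pi / 2" and V'="\<lambda>_. 0"])
       (use T0 in \<open>auto simp: fld_def\<close>)
  hence "N.eigenvalue s \<le> 0" using N.eigenvalue_iff(2)[OF fam T0, of s] by simp
  thus False using s by simp
qed

theorem theorem1p2:
  fixes m m' m'' c :: "real \<Rightarrow> real"
    and hbar1 hbar2 l1 l2 :: real
    and lam :: "real \<Rightarrow> real"
  assumes m_C2: "C2_on 0 1 m m' m''"
    and c_cont: "continuous_on {0..1} c"
    and m_nonconst: "\<not> m constant_on {0..1}"
    and m'_sign: "finitely_many_sign_changes m'"
    and bc1: "hbar1 \<ge> 0" "l1 \<ge> 0" "hbar1 + l1 > 0"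
    and bc2: "hbar2 \<ge> 0" "l2 \<ge> 0" "hbar2 + l2 > 0"
    and lam: "\<And>s. lam s =
      principal_eigenvalue (\<lambda>x. 2 * s * m' x) c (hbar1, l1) (hbar2, l2) 0 1"
  shows "(filterlim lam at_top at_top \<longleftrightarrow>
            (l1 > 0 \<and> l2 > 0 \<and> M_eq_M1 m m' \<and> M1 m \<subseteq> {0, 1}) \<or>
            (l1 > 0 \<and> l2 = 0 \<and> M_eq_M1 m m' \<and> M1 m = {0}) \<or>
            (l1 = 0 \<and> l2 > 0 \<and> M_eq_M1 m m' \<and> M1 m = {1})) \<and>
         (\<not> filterlim lam at_top at_top \<longrightarrow>
            (\<exists>l. (lam \<longlongrightarrow> l) at_top \<and>
                 is_minimum (limit_quantities m m' c (hbar1, l1) (hbar2, l2)) l))"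
proof -
  have "continuous_on {0..1} m'"
    using m_C2 unfolding C2_on_def by (meson DERIV_continuous continuous_on_eq_continuous_within)
  hence grad: "gradient_on01 m m'" using m_C2 by (simp add: gradient_on01_def C2_on_def)
  interpret advection_problem m m' c "(hbar1, l1)" "(hbar2, l2)"
    by unfold_locales (use grad m'_sign c_cont m_nonconst bc1 bc2 in \<open>auto simp: admissible_bc_def\<close>)
  have lam_eq: "lam = eigenvalue" using lam by (auto simp: eigenvalue_def)
  have M: "M_eq_M1 m m' \<longleftrightarrow> (\<forall>a b. \<not> segment a b)"
  proof
    assume "M_eq_M1 m m'"
    thus "\<forall>a b. \<not> segment a b" using segment_family_cases unfolding M_eq_M1_def by blast
  next
    assume "\<forall>a b. \<not> segment a b"
    thus "M_eq_M1 m m'" unfolding M_eq_M1_def using segment_bcs by (intro conjI equals0I) auto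
  qed
  \<comment> \<open>This turns \<open>M1 m \<subseteq> {0}\<close> and
    \<open>M1 m \<subseteq> {1}\<close> into equalities when exactly one of \<open>l1\<close>,
    \<open>l2\<close> vanishes, and it rules out divergence when both vanish.\<close>
  have ne: "M1 m \<noteq> {}" if "M_eq_M1 m m'" using maximum_exists[OF m_nonconst] that M by blast
  have Q: "quantities = {} \<longleftrightarrow> M_eq_M1 m m' \<and> (\<forall>x\<in>M1 m. (x = 0 \<and> l1 \<noteq> 0) \<or> (x = 1 \<and> l2 \<noteq> 0))"
    unfolding M quantities_def segment_quantities_def point_quantities_def by auto
  have "quantities = {} \<longleftrightarrow>
            (l1 > 0 \<and> l2 > 0 \<and> M_eq_M1 m m' \<and> M1 m \<subseteq> {0, 1}) \<or>
            (l1 > 0 \<and> l2 = 0 \<and> M_eq_M1 m m' \<and> M1 m = {0}) \<or>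
            (l1 = 0 \<and> l2 > 0 \<and> M_eq_M1 m m' \<and> M1 m = {1})"
    unfolding Q using ne bc1(2) bc2(2) by (cases "l1 = 0"; cases "l2 = 0") (auto simp: less_le)
  thus ?thesis unfolding lam_eq eigenvalue_at_top_iff using eigenvalue_tendsto by metis
qed

end
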